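(* Let $(\widehat M,\widehat g)$ be the time-like cone over a semi-Riemannian manifold $(M,g)$ with Levi-Civita connection $\nabla$. (a) If $(\widehat M,\widehat g)$ admits a parallel, totally null $2$-plane field, then, locally over an open dense subset, the base $(M,g)$ admits two vector fields $V$ (nowhere vanishing) and $Z$ satisfying $$g(V,V)=0,\qquad g(Z,Z)=1,\qquad g(V,Z)=0,$$ and such that for all $X\in TM$ $$\nabla_XV=\alpha(X)V+g(X,V)Z,\qquad \nabla_XZ=-X+\beta(X)V+g(X,Z)Z,$$ with $1$-forms $\alpha$ and $\beta$ on $M$ (defined where $V,Z$ are). In particular, the base $(M,g)$ admits (locally over this subset) a geodesic, shearfree null congruence defined by $V$. (b) Conversely, each pair of vector fields $V$ (nowhere vanishing) and $Z$ on $M$ satisfying $$g(V,V)=0,\qquad g(Z,Z)=1,\qquad g(V,Z)=0,$$ and, for some $1$-forms $\alpha,\beta$ on $M$ and all $X\in TM$, $$\nabla_XV=\alpha(X)V+g(X,V)Z,\qquad \nabla_XZ=-X+\beta(X)V+g(X,Z)Z,$$ defines a parallel distribution of totally null $2$-planes on the cone, namely the one spanned by $V$ and $\xi+Z$.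
   Context: The time-like cone over $(M,g)$ is $\widehat M=\mathbb R^{>0}\times M$ with the metric $\widehat g=-dr^2+r^2g$, and $\xi=r\,\partial_r$ is its Euler vector field; vector fields on $M$ are regarded as ($r$-independent) vector fields on $\widehat M$. A parallel totally null $2$-plane field is a rank two subbundle of $T\widehat M$ on which $\widehat g$ vanishes identically and which is invariant under parallel transport of the Levi-Civita connection of $\widehat g$. "Locally over an open dense subset" means that every point of some open dense subset of $M$ has a neighbourhood on which such $V,Z,\alpha,\beta$ exist. A null vector field $V$ is geodesic if $\nabla_VV$ is a multiple of $V$; a geodesic null vector field is shearfree if $\mathcal L_Vg=\lambda g+\theta\cdot V^\flat$ for a function $\lambda$ and a $1$-form $\theta$, where $V^\flat=g(V,\cdot)$ and the dot is the symmetric product. *)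

theory Defs
  imports "HOL-Analysis.Analysis"
begin

section \<open>Smooth manifolds\<close>

text \<open>\<open>Ck_on k f S\<close> and \<open>smooth_on f S\<close> are meant for open sets \<open>S\<close>.\<close>

primrec Ck_on ::
  "nat \<Rightarrow> ('a::real_normed_vector \<Rightarrow> 'b::real_normed_vector) \<Rightarrow> 'a set \<Rightarrow> bool" where
  "Ck_on 0 f S \<longleftrightarrow> continuous_on S f"
| "Ck_on (Suc k) f S \<longleftrightarrow>
     (\<forall>x\<in>S. f differentiable (at x)) \<and>
     (\<forall>v. Ck_on k (\<lambda>x. frechet_derivative f (at x) v) S)"

definition smooth_on :: "('a::real_normed_vector \<Rightarrow> 'b::real_normed_vector) \<Rightarrow> 'a set \<Rightarrow> bool" where
  "smooth_on f S \<longleftrightarrow> (\<forall>k. Ck_on k f S)"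

datatype ('a, 'b) chart = Chart (chart_dom: "'a set") (chart_map: "'a \<Rightarrow> 'b")

definition chart_inv :: "('a, 'b) chart \<Rightarrow> 'b \<Rightarrow> 'a" where
  "chart_inv c = inv_into (chart_dom c) (chart_map c)"

definition is_chart :: "('a::topological_space, 'b::topological_space) chart \<Rightarrow> bool" where
  "is_chart c \<longleftrightarrow> open (chart_dom c) \<and> open (chart_map c ` chart_dom c) \<and>
     homeomorphism (chart_dom c) (chart_map c ` chart_dom c) (chart_map c) (chart_inv c)"

text \<open>
  A manifold is given by an atlas together with a choice, for every point \<open>p\<close>, of a preferred
  chart \<open>chart_at M p\<close> around \<open>p\<close>. The preferred chart carries no geometric
  content: it only serves to identify the tangent space at \<open>p\<close> with the model space
  \<open>'b\<close>. A tangent vector at \<open>p\<close> is thus an element of \<open>'b\<close>, namely its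
  component vector in the chart \<open>chart_at M p\<close>; vector fields, one-forms and metrics are
  functions of type \<open>'a \<Rightarrow> 'b\<close>, \<open>'a \<Rightarrow> 'b \<Rightarrow> real\<close> and
  \<open>'a \<Rightarrow> 'b \<Rightarrow> 'b \<Rightarrow> real\<close>, and all pointwise linear algebra is that of
  \<open>'b\<close>. Since the preferred chart jumps from point to point, smoothness and derivatives
  are always taken after passing to a fixed chart. Values outside the region under consideration
  are irrelevant.
\<close>

record ('a, 'b) manifold =
  atlas :: "('a, 'b) chart set"
  chart_at :: "'a \<Rightarrow> ('a, 'b) chart"

definition pts :: "('a, 'b) manifold \<Rightarrow> 'a set" where
  "pts M = (\<Union>c\<in>atlas M. chart_dom c)"

definition smooth_manifold ::
  "('a::{t2_space, second_countable_topology}, 'b::euclidean_space) manifold \<Rightarrow> bool" where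
  "smooth_manifold M \<longleftrightarrow>
     (\<forall>c\<in>atlas M. is_chart c) \<and>
     (\<forall>c\<in>atlas M. \<forall>d\<in>atlas M.
        smooth_on (chart_map d \<circ> chart_inv c) (chart_map c ` (chart_dom c \<inter> chart_dom d))) \<and>
     (\<forall>p\<in>pts M. chart_at M p \<in> atlas M \<and> p \<in> chart_dom (chart_at M p))"

subsection \<open>Tensor fields\<close>

text \<open>Components in the chart \<open>c\<close> of a tangent vector \<open>v\<close> at \<open>p\<close>.\<close>

definition chart_components ::
  "('a, 'b::euclidean_space) manifold \<Rightarrow> ('a, 'b) chart \<Rightarrow> 'a \<Rightarrow> 'b \<Rightarrow> 'b" where
  "chart_components M c p v =
     frechet_derivative (chart_map c \<circ> chart_inv (chart_at M p))
       (at (chart_map (chart_at M p) p)) v"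

text \<open>
  The vector field on \<open>chart_dom c\<close> with constant components \<open>w\<close> in the chart
  \<open>c\<close>; for basis vectors \<open>w\<close> these are the coordinate vector fields of
  \<open>c\<close>.
\<close>

definition coord_field ::
  "('a, 'b::euclidean_space) manifold \<Rightarrow> ('a, 'b) chart \<Rightarrow> 'b \<Rightarrow> 'a \<Rightarrow> 'b" where
  "coord_field M c w p =
     frechet_derivative (chart_map (chart_at M p) \<circ> chart_inv c) (at (chart_map c p)) w"

definition smooth_function ::
  "('a, 'b::euclidean_space) manifold \<Rightarrow> 'a set \<Rightarrow> ('a \<Rightarrow> real) \<Rightarrow> bool" where
  "smooth_function M U f \<longleftrightarrow>
     (\<forall>c\<in>atlas M. smooth_on (\<lambda>x. f (chart_inv c x)) (chart_map c ` (chart_dom c \<inter> U)))"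

definition vector_field ::
  "('a, 'b::euclidean_space) manifold \<Rightarrow> 'a set \<Rightarrow> ('a \<Rightarrow> 'b) \<Rightarrow> bool" where
  "vector_field M U X \<longleftrightarrow>
     (\<forall>c\<in>atlas M. smooth_on (\<lambda>x. chart_components M c (chart_inv c x) (X (chart_inv c x)))
        (chart_map c ` (chart_dom c \<inter> U)))"

definition one_form ::
  "('a, 'b::euclidean_space) manifold \<Rightarrow> 'a set \<Rightarrow> ('a \<Rightarrow> 'b \<Rightarrow> real) \<Rightarrow> bool" where
  "one_form M U \<alpha> \<longleftrightarrow>
     (\<forall>p\<in>U. linear (\<alpha> p)) \<and>
     (\<forall>c\<in>atlas M. \<forall>w.
        smooth_function M (chart_dom c \<inter> U) (\<lambda>p. \<alpha> p (coord_field M c w p)))"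

text \<open>
  Nondegeneracy forces the index of the metric to be constant on connected components, so no
  separate condition on the signature is imposed.
\<close>

definition semi_riemannian ::
  "('a::{t2_space, second_countable_topology}, 'b::euclidean_space) manifold
    \<Rightarrow> ('a \<Rightarrow> 'b \<Rightarrow> 'b \<Rightarrow> real) \<Rightarrow> bool" where
  "semi_riemannian M g \<longleftrightarrow>
     smooth_manifold M \<and>
     (\<forall>p\<in>pts M. bilinear (g p) \<and> (\<forall>u v. g p u v = g p v u) \<and>
        (\<forall>u. (\<forall>v. g p u v = 0) \<longrightarrow> u = 0)) \<and>
     (\<forall>c\<in>atlas M. \<forall>u v.
        smooth_function M (chart_dom c) (\<lambda>p. g p (coord_field M c u p) (coord_field M c v p)))"

subsection \<open>Derivatives and the Levi-Civita connection\<close>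

text \<open>The derivative of the function \<open>f\<close> in the direction of the tangent vector
  \<open>x\<close> at \<open>p\<close>.\<close>

definition dir_deriv ::
  "('a, 'b::euclidean_space) manifold \<Rightarrow> 'a \<Rightarrow> 'b \<Rightarrow> ('a \<Rightarrow> real) \<Rightarrow> real" where
  "dir_deriv M p x f =
     frechet_derivative (\<lambda>y. f (chart_inv (chart_at M p) y)) (at (chart_map (chart_at M p) p)) x"

text \<open>The coordinate formula \<open>[X, Y]\<^sup>i = X(Y\<^sup>i) - Y(X\<^sup>i)\<close>, evaluated in the
  preferred chart at \<open>p\<close>.\<close>

definition lie_bracket ::
  "('a, 'b::euclidean_space) manifold \<Rightarrow> ('a \<Rightarrow> 'b) \<Rightarrow> ('a \<Rightarrow> 'b) \<Rightarrow> 'a \<Rightarrow> 'b" where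
  "lie_bracket M X Y p =
     (let c = chart_at M p;
          X' = (\<lambda>x. chart_components M c (chart_inv c x) (X (chart_inv c x)));
          Y' = (\<lambda>x. chart_components M c (chart_inv c x) (Y (chart_inv c x)))
      in frechet_derivative Y' (at (chart_map c p)) (X p)
         - frechet_derivative X' (at (chart_map c p)) (Y p))"

text \<open>
  \<open>nabla p x Y\<close> stands for \<open>\<nabla>\<^sub>x Y\<close>, where \<open>x\<close> is a tangent vector at
  \<open>p\<close> and \<open>Y\<close> is a vector field defined near \<open>p\<close>. Applying the
  Leibniz rule to the restrictions of \<open>Y\<close> to smaller open sets shows that
  \<open>nabla p x Y\<close> depends on the germ of \<open>Y\<close> at \<open>p\<close> only.
\<close>

definition affine_connection ::
  "('a::topological_space, 'b::euclidean_space) manifold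
    \<Rightarrow> ('a \<Rightarrow> 'b \<Rightarrow> ('a \<Rightarrow> 'b) \<Rightarrow> 'b) \<Rightarrow> bool" where
  "affine_connection M nabla \<longleftrightarrow>
     (\<forall>U Y. open U \<and> U \<subseteq> pts M \<and> vector_field M U Y \<longrightarrow>
        (\<forall>p\<in>U. linear (\<lambda>x. nabla p x Y)) \<and>
        (\<forall>X. vector_field M U X \<longrightarrow> vector_field M U (\<lambda>q. nabla q (X q) Y)) \<and>
        (\<forall>Y'. vector_field M U Y' \<longrightarrow>
           (\<forall>p\<in>U. \<forall>x. nabla p x (\<lambda>q. Y q + Y' q) = nabla p x Y + nabla p x Y')) \<and>
        (\<forall>f. smooth_function M U f \<longrightarrow>
           (\<forall>p\<in>U. \<forall>x. nabla p x (\<lambda>q. f q *\<^sub>R Y q)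
                          = dir_deriv M p x f *\<^sub>R Y p + f p *\<^sub>R nabla p x Y)))"

definition torsion_free ::
  "('a::topological_space, 'b::euclidean_space) manifold
    \<Rightarrow> ('a \<Rightarrow> 'b \<Rightarrow> ('a \<Rightarrow> 'b) \<Rightarrow> 'b) \<Rightarrow> bool" where
  "torsion_free M nabla \<longleftrightarrow>
     (\<forall>U X Y. open U \<and> U \<subseteq> pts M \<and> vector_field M U X \<and> vector_field M U Y \<longrightarrow>
        (\<forall>p\<in>U. nabla p (X p) Y - nabla p (Y p) X = lie_bracket M X Y p))"

definition metric_connection ::
  "('a::topological_space, 'b::euclidean_space) manifold \<Rightarrow> ('a \<Rightarrow> 'b \<Rightarrow> 'b \<Rightarrow> real)
    \<Rightarrow> ('a \<Rightarrow> 'b \<Rightarrow> ('a \<Rightarrow> 'b) \<Rightarrow> 'b) \<Rightarrow> bool" where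
  "metric_connection M g nabla \<longleftrightarrow>
     (\<forall>U Y Z. open U \<and> U \<subseteq> pts M \<and> vector_field M U Y \<and> vector_field M U Z \<longrightarrow>
        (\<forall>p\<in>U. \<forall>x. dir_deriv M p x (\<lambda>q. g q (Y q) (Z q))
                       = g p (nabla p x Y) (Z p) + g p (Y p) (nabla p x Z)))"

definition levi_civita ::
  "('a::topological_space, 'b::euclidean_space) manifold \<Rightarrow> ('a \<Rightarrow> 'b \<Rightarrow> 'b \<Rightarrow> real)
    \<Rightarrow> ('a \<Rightarrow> 'b \<Rightarrow> ('a \<Rightarrow> 'b) \<Rightarrow> 'b) \<Rightarrow> bool" where
  "levi_civita M g nabla \<longleftrightarrow>
     affine_connection M nabla \<and> torsion_free M nabla \<and> metric_connection M g nabla"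

section \<open>Parallel totally null distributions\<close>

definition subbundle ::
  "('a::topological_space, 'b::euclidean_space) manifold \<Rightarrow> nat \<Rightarrow> ('a \<Rightarrow> 'b set) \<Rightarrow> bool" where
  "subbundle M k N \<longleftrightarrow>
     (\<forall>p\<in>pts M. \<exists>U (E :: nat \<Rightarrow> 'a \<Rightarrow> 'b). open U \<and> p \<in> U \<and> U \<subseteq> pts M \<and>
        (\<forall>i<k. vector_field M U (E i)) \<and>
        (\<forall>q\<in>U. N q = span ((\<lambda>i. E i q) ` {..<k}) \<and> dim (N q) = k))"

definition totally_null ::
  "('a, 'b) manifold \<Rightarrow> ('a \<Rightarrow> 'b \<Rightarrow> 'b \<Rightarrow> real) \<Rightarrow> ('a \<Rightarrow> 'b set) \<Rightarrow> bool" where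
  "totally_null M g N \<longleftrightarrow> (\<forall>p\<in>pts M. \<forall>u\<in>N p. \<forall>v\<in>N p. g p u v = 0)"

text \<open>Curves are defined on open intervals \<open>I\<close>.\<close>

definition smooth_curve ::
  "('a::topological_space, 'b::euclidean_space) manifold \<Rightarrow> real set \<Rightarrow> (real \<Rightarrow> 'a) \<Rightarrow> bool" where
  "smooth_curve M I \<gamma> \<longleftrightarrow>
     open I \<and> is_interval I \<and> continuous_on I \<gamma> \<and> \<gamma> ` I \<subseteq> pts M \<and>
     (\<forall>c\<in>atlas M. smooth_on (\<lambda>t. chart_map c (\<gamma> t)) {t\<in>I. \<gamma> t \<in> chart_dom c})"

definition velocity ::
  "('a, 'b::euclidean_space) manifold \<Rightarrow> (real \<Rightarrow> 'a) \<Rightarrow> real \<Rightarrow> 'b" where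
  "velocity M \<gamma> t = vector_derivative (\<lambda>s. chart_map (chart_at M (\<gamma> t)) (\<gamma> s)) (at t)"

text \<open>
  The covariant derivative along \<open>\<gamma>\<close>: writing \<open>Y\<close> near the time
  \<open>t\<close> as \<open>Y(s) = \<Sum>\<^sub>i y\<^sup>i(s) E\<^sub>i(\<gamma>(s))\<close> with the coordinate fields
  \<open>E\<^sub>i\<close> of the preferred chart at \<open>\<gamma>(t)\<close>, it is
  \<open>\<Sum>\<^sub>i (y\<^sup>i)'(t) E\<^sub>i + y\<^sup>i(t) \<nabla> E\<^sub>i\<close>, the derivative \<open>\<nabla> E\<^sub>i\<close>
  being in the direction of the velocity. The components of \<open>Y t\<close> in that chart are
  \<open>Y t\<close> itself.
\<close>

definition chart_components_along ::
  "('a, 'b::euclidean_space) manifold \<Rightarrow> (real \<Rightarrow> 'a) \<Rightarrow> (real \<Rightarrow> 'b) \<Rightarrow> real \<Rightarrow> real \<Rightarrow> 'b" where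
  "chart_components_along M \<gamma> Y t s = chart_components M (chart_at M (\<gamma> t)) (\<gamma> s) (Y s)"

definition cov_deriv_along ::
  "('a, 'b::euclidean_space) manifold \<Rightarrow> ('a \<Rightarrow> 'b \<Rightarrow> ('a \<Rightarrow> 'b) \<Rightarrow> 'b)
    \<Rightarrow> (real \<Rightarrow> 'a) \<Rightarrow> (real \<Rightarrow> 'b) \<Rightarrow> real \<Rightarrow> 'b" where
  "cov_deriv_along M nabla \<gamma> Y t =
     vector_derivative (chart_components_along M \<gamma> Y t) (at t)
     + nabla (\<gamma> t) (velocity M \<gamma> t) (coord_field M (chart_at M (\<gamma> t)) (Y t))"

text \<open>Differentiability of \<open>Y\<close> is enough here: the equation is a linear ordinary
  differential equation with smooth coefficients, so its solutions are smooth.\<close>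

definition parallel_along ::
  "('a, 'b::euclidean_space) manifold \<Rightarrow> ('a \<Rightarrow> 'b \<Rightarrow> ('a \<Rightarrow> 'b) \<Rightarrow> 'b)
    \<Rightarrow> real set \<Rightarrow> (real \<Rightarrow> 'a) \<Rightarrow> (real \<Rightarrow> 'b) \<Rightarrow> bool" where
  "parallel_along M nabla I \<gamma> Y \<longleftrightarrow>
     (\<forall>t\<in>I. chart_components_along M \<gamma> Y t differentiable (at t) \<and>
             cov_deriv_along M nabla \<gamma> Y t = 0)"

definition parallel_distribution ::
  "('a::topological_space, 'b::euclidean_space) manifold
    \<Rightarrow> ('a \<Rightarrow> 'b \<Rightarrow> ('a \<Rightarrow> 'b) \<Rightarrow> 'b) \<Rightarrow> ('a \<Rightarrow> 'b set) \<Rightarrow> bool" where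
  "parallel_distribution M nabla N \<longleftrightarrow>
     (\<forall>I \<gamma> Y. smooth_curve M I \<gamma> \<and> parallel_along M nabla I \<gamma> Y \<longrightarrow>
        (\<forall>s\<in>I. \<forall>t\<in>I. Y s \<in> N (\<gamma> s) \<longrightarrow> Y t \<in> N (\<gamma> t)))"

definition parallel_null_plane_field ::
  "('a::topological_space, 'b::euclidean_space) manifold \<Rightarrow> ('a \<Rightarrow> 'b \<Rightarrow> 'b \<Rightarrow> real)
    \<Rightarrow> ('a \<Rightarrow> 'b \<Rightarrow> ('a \<Rightarrow> 'b) \<Rightarrow> 'b) \<Rightarrow> ('a \<Rightarrow> 'b set) \<Rightarrow> bool" where
  "parallel_null_plane_field M g nabla N \<longleftrightarrow>
     subbundle M 2 N \<and> totally_null M g N \<and> parallel_distribution M nabla N"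

section \<open>The time-like cone\<close>

text \<open>
  With the product charts below, the tangent space of the cone at \<open>(r, p)\<close> is
  \<open>real \<times> 'b\<close>, the pair \<open>(a, u)\<close> standing for \<open>a \<partial>\<^sub>r + u\<close>.
\<close>

definition cone_chart :: "('a, 'b) chart \<Rightarrow> (real \<times> 'a, real \<times> 'b) chart" where
  "cone_chart c = Chart ({0<..} \<times> chart_dom c) (\<lambda>(r, p). (r, chart_map c p))"

definition cone_manifold :: "('a, 'b) manifold \<Rightarrow> (real \<times> 'a, real \<times> 'b) manifold" where
  "cone_manifold M =
     \<lparr>atlas = cone_chart ` atlas M, chart_at = (\<lambda>(r, p). cone_chart (chart_at M p))\<rparr>"

definition cone_metric ::
  "('a \<Rightarrow> 'b \<Rightarrow> 'b \<Rightarrow> real) \<Rightarrow> real \<times> 'a \<Rightarrow> real \<times> 'b \<Rightarrow> real \<times> 'b \<Rightarrow> real" where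
  "cone_metric g = (\<lambda>(r, p) (a, u) (b, v). - (a * b) + r\<^sup>2 * g p u v)"

definition euler_field :: "real \<times> 'a \<Rightarrow> real \<times> 'b::zero" where
  "euler_field = (\<lambda>(r, p). (r, 0))"

definition cone_lift :: "('a \<Rightarrow> 'b) \<Rightarrow> real \<times> 'a \<Rightarrow> real \<times> 'b" where
  "cone_lift X = (\<lambda>(r, p). (0, X p))"

section \<open>Geodesic shearfree null congruences\<close>

definition lie_deriv_metric ::
  "('a, 'b::euclidean_space) manifold \<Rightarrow> ('a \<Rightarrow> 'b \<Rightarrow> 'b \<Rightarrow> real)
    \<Rightarrow> ('a \<Rightarrow> 'b) \<Rightarrow> ('a \<Rightarrow> 'b) \<Rightarrow> ('a \<Rightarrow> 'b) \<Rightarrow> 'a \<Rightarrow> real" where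
  "lie_deriv_metric M g V X Y p =
     dir_deriv M p (V p) (\<lambda>q. g q (X q) (Y q))
     - g p (lie_bracket M V X p) (Y p) - g p (X p) (lie_bracket M V Y p)"

definition geodesic_field ::
  "('a, 'b::euclidean_space) manifold \<Rightarrow> ('a \<Rightarrow> 'b \<Rightarrow> ('a \<Rightarrow> 'b) \<Rightarrow> 'b)
    \<Rightarrow> 'a set \<Rightarrow> ('a \<Rightarrow> 'b) \<Rightarrow> bool" where
  "geodesic_field M nabla U V \<longleftrightarrow>
     (\<exists>f. smooth_function M U f \<and> (\<forall>p\<in>U. nabla p (V p) V = f p *\<^sub>R V p))"

text \<open>The symmetric product \<open>\<theta> \<cdot> \<omega>\<close> is
  \<open>\<theta> \<otimes> \<omega> + \<omega> \<otimes> \<theta>\<close>; a normalising factor could be absorbed into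
  \<open>\<theta>\<close>.\<close>

definition shearfree_field ::
  "('a::topological_space, 'b::euclidean_space) manifold \<Rightarrow> ('a \<Rightarrow> 'b \<Rightarrow> 'b \<Rightarrow> real)
    \<Rightarrow> 'a set \<Rightarrow> ('a \<Rightarrow> 'b) \<Rightarrow> bool" where
  "shearfree_field M g U V \<longleftrightarrow>
     (\<exists>lam \<theta>. smooth_function M U lam \<and> one_form M U \<theta> \<and>
        (\<forall>W X Y. open W \<and> W \<subseteq> U \<and> vector_field M W X \<and> vector_field M W Y \<longrightarrow>
           (\<forall>p\<in>W. lie_deriv_metric M g V X Y p =
              lam p * g p (X p) (Y p)
              + (\<theta> p (X p) * g p (V p) (Y p) + g p (V p) (X p) * \<theta> p (Y p)))))"

definition geodesic_shearfree_null_congruence ::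
  "('a::topological_space, 'b::euclidean_space) manifold \<Rightarrow> ('a \<Rightarrow> 'b \<Rightarrow> 'b \<Rightarrow> real)
    \<Rightarrow> ('a \<Rightarrow> 'b \<Rightarrow> ('a \<Rightarrow> 'b) \<Rightarrow> 'b) \<Rightarrow> 'a set \<Rightarrow> ('a \<Rightarrow> 'b) \<Rightarrow> bool" where
  "geodesic_shearfree_null_congruence M g nabla U V \<longleftrightarrow>
     vector_field M U V \<and> (\<forall>p\<in>U. V p \<noteq> 0 \<and> g p (V p) (V p) = 0) \<and>
     geodesic_field M nabla U V \<and> shearfree_field M g U V"

text \<open>The conditions on \<open>V\<close> and \<open>Z\<close> on the open set \<open>U\<close>.\<close>

definition null_pair ::
  "('a, 'b::euclidean_space) manifold \<Rightarrow> ('a \<Rightarrow> 'b \<Rightarrow> 'b \<Rightarrow> real)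
    \<Rightarrow> ('a \<Rightarrow> 'b \<Rightarrow> ('a \<Rightarrow> 'b) \<Rightarrow> 'b) \<Rightarrow> 'a set
    \<Rightarrow> ('a \<Rightarrow> 'b) \<Rightarrow> ('a \<Rightarrow> 'b) \<Rightarrow> ('a \<Rightarrow> 'b \<Rightarrow> real) \<Rightarrow> ('a \<Rightarrow> 'b \<Rightarrow> real) \<Rightarrow> bool" where
  "null_pair M g nabla U V Z \<alpha> \<beta> \<longleftrightarrow>
     vector_field M U V \<and> vector_field M U Z \<and> one_form M U \<alpha> \<and> one_form M U \<beta> \<and>
     (\<forall>p\<in>U. V p \<noteq> 0 \<and>
        g p (V p) (V p) = 0 \<and> g p (Z p) (Z p) = 1 \<and> g p (V p) (Z p) = 0 \<and>
        (\<forall>x. nabla p x V = \<alpha> p x *\<^sub>R V p + g p x (V p) *\<^sub>R Z p) \<and>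
        (\<forall>x. nabla p x Z = - x + \<beta> p x *\<^sub>R V p + g p x (Z p) *\<^sub>R Z p))"

end

theory Submission
  imports Defs
begin

text \<open>
  The bridge between the base and the cone is the connection of the cone. The Euler field satisfies
  \<open>\<nabla>\<^sub>w \<xi> = w\<close> (\<open>nabla_cone_euler\<close>). For a field \<open>Y\<close> on \<open>M\<close> the
  cone derivative is \<open>\<nabla>\<^sub>X Y + g(X, Y) \<xi>\<close> in a direction \<open>X\<close> tangent to \<open>M\<close>, with
  \<open>\<nabla>\<^sub>X Y\<close> formed on the base, and it is \<open>Y\<close> in the direction \<open>\<xi>\<close>
  (\<open>nabla_cone_lift\<close>). Both follow from the Koszul formula.

  If \<open>V\<close>, \<open>Z\<close> is a null pair, these formulas show that the derivatives of \<open>V\<close> and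
  \<open>\<xi> + Z\<close> are combinations of \<open>V\<close> and \<open>\<xi> + Z\<close>, and the algebraic conditions say
  that the plane is null (\<open>plane_field_of_null_pair\<close>).

  Conversely, let \<open>N\<close> be a parallel null plane field. Over no nonempty open set is \<open>N\<close> orthogonal to
  \<open>\<xi>\<close>: differentiating \<open>E \<bottom> \<xi>\<close> for a section \<open>E\<close> would give \<open>E \<bottom> X\<close> for
  all \<open>X\<close> (\<open>generic_points_dense\<close>). Where it is not orthogonal, \<open>N\<close> is spanned by
  sections of the form \<open>V\<close> and \<open>\<xi> + Z\<close> with \<open>V\<close>, \<open>Z\<close> tangent to \<open>M\<close>. Along the
  rulings of the cone parallel transport is a rescaling (\<open>parallel_distribution_radial\<close>), so
  \<open>V\<close> and \<open>Z\<close> may be taken independent of \<open>r\<close>. The condition that the derivatives of these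
  sections lie in \<open>N\<close> is the system of equations for a null pair (\<open>null_pair_of_plane_field\<close>).
  It implies that \<open>V\<close> is geodesic and shearfree, because \<open>\<L>\<^sub>V g\<close> is the symmetrisation of
  \<open>\<nabla> V\<^sup>\<flat> = \<alpha> \<otimes> V\<^sup>\<flat> + V\<^sup>\<flat> \<otimes> Z\<^sup>\<flat>\<close> (\<open>null_pair_congruence\<close>).

  What remains is to pass between invariance under parallel transport along curves and the statement that
  \<open>\<nabla>\<close> maps sections of the plane field to sections. From transport to \<open>\<nabla>\<close>
  (\<open>nabla_in_parallel_distribution\<close>) parallel fields have to exist, which is the short-time
  existence theorem for linear differential equations (\<open>linear_ode_exists\<close>). From \<open>\<nabla>\<close> to
  transport (\<open>parallel_distribution_span\<close>) a uniqueness argument of Gronwall type applies to the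
  component of a parallel field orthogonal to the plane.
\<close>

section \<open>Calculus of smooth maps between normed spaces\<close>

lemma open_nonzero_set:
  fixes f :: "'c::topological_space \<Rightarrow> real"
  assumes "open W" "continuous_on W f"
  shows "open (f -` (- {0}) \<inter> W)"
  using continuous_on_open_vimage[OF assms(1), THEN iffD1, OF assms(2), rule_format] by blast

lemmas has_frechet_derivative = iffD1[OF frechet_derivative_works]

lemma frechet_derivative_local:
  assumes "open S" "x \<in> S" "\<And>y. y \<in> S \<Longrightarrow> f y = h y"
  shows "frechet_derivative f (at x) = frechet_derivative h (at x)"
proof -
  have "(f has_derivative D) (at x) \<longleftrightarrow> (h has_derivative D) (at x)" for D
    using has_derivative_transform_within_open[OF _ assms(1,2)] assms(3) by metis
  then show ?thesis by (simp add: frechet_derivative_def)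
qed

lemma Ck_on_subset: "Ck_on k f S \<Longrightarrow> T \<subseteq> S \<Longrightarrow> Ck_on k f T"
  by (induction k arbitrary: f) (auto intro: continuous_on_subset)

lemma Ck_on_cong:
  assumes "open S" "\<And>x. x \<in> S \<Longrightarrow> f x = g x" "Ck_on k f S"
  shows "Ck_on k g S"
  using assms(2,3)
proof (induction k arbitrary: f g)
  case 0
  then show ?case by (metis Ck_on.simps(1) continuous_on_cong)
next
  case (Suc k)
  have "g differentiable at x" "frechet_derivative g (at x) = frechet_derivative f (at x)"
    if "x \<in> S" for x
  proof -
    have *: "(f has_derivative frechet_derivative f (at x)) (at x)"
      using Suc.prems that by (intro has_frechet_derivative) auto
    have "(g has_derivative frechet_derivative f (at x)) (at x)"
      using has_derivative_transform_within_open[OF * \<open>open S\<close> that] Suc.prems by auto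
    then show "g differentiable at x" "frechet_derivative g (at x) = frechet_derivative f (at x)"
      using frechet_derivative_at differentiable_def by metis+
  qed
  then show ?case
    using Suc.IH[of "\<lambda>x. frechet_derivative f (at x) _"] Suc.prems by simp
qed

lemma Ck_on_SucI:
  assumes "\<And>x. x \<in> S \<Longrightarrow> (f has_derivative D x) (at x)"
    and "\<And>v. Ck_on k (\<lambda>x. D x v) S" "open S"
  shows "Ck_on (Suc k) f S"
proof -
  have "D x v = frechet_derivative f (at x) v" if "x \<in> S" for x v
    using frechet_derivative_at[OF assms(1)[OF that]] by simp
  then have "Ck_on k (\<lambda>x. frechet_derivative f (at x) v) S" for v
    by (intro Ck_on_cong[OF \<open>open S\<close> _ assms(2)])
  then show ?thesis using assms(1) differentiableI by fastforce
qed

lemma Ck_on_local: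
  assumes "\<And>x. x \<in> S \<Longrightarrow> \<exists>T. open T \<and> x \<in> T \<and> Ck_on k f T"
  shows "Ck_on k f S"
  using assms
proof (induction k arbitrary: f)
  case 0
  then show ?case
    by (force intro!: continuous_at_imp_continuous_on simp: continuous_on_eq_continuous_at)
next
  case (Suc k)
  have "f differentiable at x" if "x \<in> S" for x
    using Suc.prems[OF that] by auto
  moreover have "Ck_on k (\<lambda>x. frechet_derivative f (at x) v) S" for v
    by (rule Suc.IH) (use Suc.prems in force)
  ultimately show ?case by simp
qed

lemma Ck_on_continuous: "Ck_on k f S \<Longrightarrow> continuous_on S f"
  by (cases k) (auto intro!: continuous_at_imp_continuous_on differentiable_imp_continuous_within)

lemma Ck_on_Suc_imp: "Ck_on (Suc k) f S \<Longrightarrow> Ck_on k f S"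
proof (induction k arbitrary: f)
  case 0
  then show ?case using Ck_on_continuous[OF 0] by simp
next
  case (Suc k)
  then show ?case by (metis Ck_on.simps(2))
qed

lemma Ck_on_const: "Ck_on k (\<lambda>x. c) S"
  by (induction k arbitrary: c) auto

lemma Ck_on_bounded_linear:
  assumes "bounded_linear h" "Ck_on k f S" "open S"
  shows "Ck_on k (\<lambda>x. h (f x)) S"
  using assms(2)
proof (induction k arbitrary: f)
  case 0
  then show ?case using linear_continuous_on_compose bounded_linear.linear
    by (simp add: assms(1) bounded_linear.continuous_on)
next
  case (Suc k)
  have D: "((\<lambda>x. h (f x)) has_derivative (\<lambda>v. h (frechet_derivative f (at x) v))) (at x)"
    if "x \<in> S" for x
    using Suc.prems that by (intro bounded_linear.has_derivative[OF assms(1)] has_frechet_derivative) auto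
  have 2: "Ck_on k (\<lambda>x. h (frechet_derivative f (at x) v)) S" for v
    using Suc by auto
  show ?case by (rule Ck_on_SucI) (fact D 2 \<open>open S\<close>)+
qed

lemma Ck_on_add:
  assumes "Ck_on k f S" "Ck_on k g S" "open S"
  shows "Ck_on k (\<lambda>x. f x + g x) S"
  using assms(1,2)
proof (induction k arbitrary: f g)
  case 0
  then show ?case by (simp add: continuous_on_add)
next
  case (Suc k)
  have D: "((\<lambda>x. f x + g x) has_derivative
      (\<lambda>v. frechet_derivative f (at x) v + frechet_derivative g (at x) v)) (at x)"
    if "x \<in> S" for x
    using Suc.prems that by (intro has_derivative_add has_frechet_derivative) auto
  have 2: "Ck_on k (\<lambda>x. frechet_derivative f (at x) v + frechet_derivative g (at x) v) S" for v
    using Suc by auto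
  show ?case by (rule Ck_on_SucI) (fact D 2 \<open>open S\<close>)+
qed

lemma Ck_on_sum:
  assumes "\<And>i. i \<in> A \<Longrightarrow> Ck_on k (f i) S" "open S"
  shows "Ck_on k (\<lambda>x. \<Sum>i\<in>A. f i x) S"
  using assms by (induction A rule: infinite_finite_induct) (auto intro: Ck_on_const Ck_on_add)

lemma Ck_on_bounded_bilinear:
  assumes "bounded_bilinear h" "Ck_on k f S" "Ck_on k g S" "open S"
  shows "Ck_on k (\<lambda>x. h (f x) (g x)) S"
  using assms(2,3)
proof (induction k arbitrary: f g)
  case 0
  then show ?case by (simp add: assms(1) bounded_bilinear.continuous_on)
next
  case (Suc k)
  let ?D = "\<lambda>x v. h (f x) (frechet_derivative g (at x) v) + h (frechet_derivative f (at x) v) (g x)"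
  have D: "((\<lambda>x. h (f x) (g x)) has_derivative ?D x) (at x)"
    if "x \<in> S" for x
    using Suc.prems that by (intro bounded_bilinear.FDERIV[OF assms(1)])
      (auto simp: frechet_derivative_works)
  have 2: "Ck_on k (\<lambda>x. ?D x v) S" for v
    using Suc.prems Suc.IH Ck_on_Suc_imp[OF Suc.prems(1)] Ck_on_Suc_imp[OF Suc.prems(2)]
    by (auto intro!: Ck_on_add \<open>open S\<close>)
  show ?case by (rule Ck_on_SucI) (fact D 2 \<open>open S\<close>)+
qed

lemma linear_basis_expansion:
  fixes h :: "'a::euclidean_space \<Rightarrow> 'b::real_vector"
  assumes "linear h"
  shows "h w = (\<Sum>b\<in>Basis. (w \<bullet> b) *\<^sub>R h b)"
proof -
  interpret linear h by fact
  show ?thesis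
    by (subst euclidean_representation[of w, symmetric]) (simp only: sum scaleR)
qed

text \<open>The chain rule gives the directional derivative of a composition as a finite sum of products
  \<open>(D f x v \<bullet> b) *\<^sub>R D h (f x) b\<close>; expanding the inner derivative in a basis is
  what keeps the induction within directional derivatives, for which \<open>Ck_on\<close> is defined.\<close>

lemma Ck_on_compose:
  fixes f :: "'a::real_normed_vector \<Rightarrow> 'b::euclidean_space"
    and h :: "'b \<Rightarrow> 'c::real_normed_vector"
  assumes "Ck_on k h T" "Ck_on k f S" "open S" "f ` S \<subseteq> T"
  shows "Ck_on k (\<lambda>x. h (f x)) S"
  using assms(1,2)
proof (induction k arbitrary: h)
  case 0
  then show ?case using assms(4) by (auto intro: continuous_on_compose2)
next
  case (Suc k)
  let ?h = "\<lambda>b x. frechet_derivative h (at x) b"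
  let ?D = "\<lambda>x v. \<Sum>b\<in>Basis. (frechet_derivative f (at x) v \<bullet> b) *\<^sub>R ?h b (f x)"
  have D: "((\<lambda>x. h (f x)) has_derivative ?D x) (at x)" if "x \<in> S" for x
  proof -
    have fd: "(f has_derivative frechet_derivative f (at x)) (at x)"
      using Suc.prems that by (intro has_frechet_derivative) auto
    have hd: "(h has_derivative frechet_derivative h (at (f x))) (at (f x))"
      using Suc.prems that assms(4) by (intro has_frechet_derivative) auto
    have eq: "(\<lambda>v. frechet_derivative h (at (f x)) (frechet_derivative f (at x) v)) = ?D x"
      by (rule ext) (rule linear_basis_expansion[OF has_derivative_linear[OF hd]])
    show ?thesis
      by (rule has_derivative_compose[OF fd hd, unfolded eq])
  qed
  have 2: "Ck_on k (\<lambda>x. ?D x v) S" for v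
  proof -
    have "Ck_on k (\<lambda>x. ?h b (f x)) S" for b
      using Suc.prems(1) by (intro Suc.IH Ck_on_Suc_imp[OF Suc.prems(2)]) simp
    moreover have "Ck_on k (\<lambda>x. frechet_derivative f (at x) v \<bullet> b) S" for b
      using Suc.prems(2)
      by (intro Ck_on_bounded_linear[OF bounded_linear_inner_left]) (auto intro: \<open>open S\<close>)
    ultimately show ?thesis
      by (intro Ck_on_sum Ck_on_bounded_bilinear[OF bounded_bilinear_scaleR] \<open>open S\<close>)
  qed
  show ?case by (rule Ck_on_SucI) (fact D 2 \<open>open S\<close>)+
qed

lemma Ck_on_inverse:
  fixes f :: "'a::real_normed_vector \<Rightarrow> real"
  assumes "Ck_on k f S" "open S" "\<And>x. x \<in> S \<Longrightarrow> f x \<noteq> 0"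
  shows "Ck_on k (\<lambda>x. inverse (f x)) S"
  using assms(1)
proof (induction k)
  case 0
  then show ?case using assms(3) by (auto intro: continuous_on_inverse)
next
  case (Suc k)
  let ?D = "\<lambda>x v. (- inverse (f x) * frechet_derivative f (at x) v) * inverse (f x)"
  have D: "((\<lambda>x. inverse (f x)) has_derivative ?D x) (at x)" if "x \<in> S" for x
    using Suc.prems that assms(3)
    by (auto intro!: derivative_eq_intros simp: frechet_derivative_works)
  have "Ck_on k (\<lambda>x. inverse (f x)) S" using Suc Ck_on_Suc_imp by blast
  then have 2: "Ck_on k (\<lambda>x. ?D x v) S" for v
    using Suc.prems Ck_on_bounded_linear[OF bounded_linear_minus[OF bounded_linear_ident]]
    by (intro Ck_on_bounded_bilinear[OF bounded_bilinear_mult] \<open>open S\<close>) (auto intro: \<open>open S\<close>)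
  show ?case by (rule Ck_on_SucI) (fact D 2 \<open>open S\<close>)+
qed

lemma smooth_on_subset: "smooth_on f S \<Longrightarrow> T \<subseteq> S \<Longrightarrow> smooth_on f T"
  by (meson smooth_on_def Ck_on_subset)

lemma smooth_on_cong:
  "open S \<Longrightarrow> smooth_on f S \<Longrightarrow> (\<And>x. x \<in> S \<Longrightarrow> f x = g x) \<Longrightarrow> smooth_on g S"
  unfolding smooth_on_def using Ck_on_cong by blast

lemma smooth_on_local:
  assumes "\<And>x. x \<in> S \<Longrightarrow> \<exists>T. open T \<and> x \<in> T \<and> smooth_on f T"
  shows "smooth_on f S"
  unfolding smooth_on_def
proof (intro allI Ck_on_local)
  fix k x
  assume "x \<in> S"
  then show "\<exists>T. open T \<and> x \<in> T \<and> Ck_on k f T"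
    using assms unfolding smooth_on_def by blast
qed

lemma smooth_on_continuous: "smooth_on f S \<Longrightarrow> continuous_on S f"
  by (meson smooth_on_def Ck_on_continuous)

lemma smooth_on_differentiable: "smooth_on f S \<Longrightarrow> x \<in> S \<Longrightarrow> f differentiable (at x)"
  by (meson smooth_on_def Ck_on.simps(2))

lemma smooth_on_has_derivative:
  "smooth_on f S \<Longrightarrow> x \<in> S \<Longrightarrow> (f has_derivative frechet_derivative f (at x)) (at x)"
  using smooth_on_differentiable frechet_derivative_works by blast

lemma smooth_on_derivative: "smooth_on f S \<Longrightarrow> smooth_on (\<lambda>x. frechet_derivative f (at x) v) S"
  unfolding smooth_on_def using Ck_on.simps(2) by blast

lemma smooth_on_const: "smooth_on (\<lambda>x. c) S"
  by (simp add: smooth_on_def Ck_on_const)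

lemma smooth_on_bounded_linear:
  "bounded_linear h \<Longrightarrow> smooth_on f S \<Longrightarrow> open S \<Longrightarrow> smooth_on (\<lambda>x. h (f x)) S"
  by (simp add: smooth_on_def Ck_on_bounded_linear)

lemma smooth_on_ident: "smooth_on (\<lambda>x. x) S"
proof -
  have "Ck_on k (\<lambda>x. x) S" for k
    by (cases k) (auto simp: frechet_derivative_ident intro: Ck_on_const)
  then show ?thesis by (simp add: smooth_on_def)
qed

lemma smooth_on_linear: "bounded_linear h \<Longrightarrow> smooth_on h S"
  using smooth_on_bounded_linear[OF _ smooth_on_ident, of h UNIV] smooth_on_subset by auto

lemma smooth_on_add:
  "smooth_on f S \<Longrightarrow> smooth_on g S \<Longrightarrow> open S \<Longrightarrow> smooth_on (\<lambda>x. f x + g x) S"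
  by (simp add: smooth_on_def Ck_on_add)

lemma smooth_on_sum:
  "(\<And>i. i \<in> A \<Longrightarrow> smooth_on (f i) S) \<Longrightarrow> open S \<Longrightarrow> smooth_on (\<lambda>x. \<Sum>i\<in>A. f i x) S"
  by (simp add: smooth_on_def Ck_on_sum)

lemma smooth_on_bounded_bilinear:
  "bounded_bilinear h \<Longrightarrow> smooth_on f S \<Longrightarrow> smooth_on g S \<Longrightarrow> open S
    \<Longrightarrow> smooth_on (\<lambda>x. h (f x) (g x)) S"
  by (simp add: smooth_on_def Ck_on_bounded_bilinear)

lemmas smooth_on_scaleR = smooth_on_bounded_bilinear[OF bounded_bilinear_scaleR]
lemmas smooth_on_mult = smooth_on_bounded_bilinear[OF bounded_bilinear_mult]
lemmas smooth_on_inner_left = smooth_on_bounded_linear[OF bounded_linear_inner_left]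

lemma smooth_on_compose:
  fixes f :: "'a::real_normed_vector \<Rightarrow> 'b::euclidean_space"
  shows "smooth_on h T \<Longrightarrow> smooth_on f S \<Longrightarrow> open S \<Longrightarrow> f ` S \<subseteq> T
    \<Longrightarrow> smooth_on (\<lambda>x. h (f x)) S"
  unfolding smooth_on_def using Ck_on_compose by blast

lemma smooth_on_inverse:
  fixes f :: "'a::real_normed_vector \<Rightarrow> real"
  shows "smooth_on f S \<Longrightarrow> open S \<Longrightarrow> (\<And>x. x \<in> S \<Longrightarrow> f x \<noteq> 0)
    \<Longrightarrow> smooth_on (\<lambda>x. inverse (f x)) S"
  by (simp add: smooth_on_def Ck_on_inverse)

lemma smooth_on_derivative_apply:
  fixes f :: "'a::euclidean_space \<Rightarrow> 'b::real_normed_vector"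
  assumes "smooth_on f S" "smooth_on v S" "open S"
  shows "smooth_on (\<lambda>x. frechet_derivative f (at x) (v x)) S"
proof -
  have "smooth_on (\<lambda>x. \<Sum>b\<in>Basis. (v x \<bullet> b) *\<^sub>R frechet_derivative f (at x) b) S"
    by (intro smooth_on_sum smooth_on_scaleR smooth_on_inner_left smooth_on_derivative assms)
  moreover have "(\<Sum>b\<in>Basis. (v x \<bullet> b) *\<^sub>R frechet_derivative f (at x) b)
      = frechet_derivative f (at x) (v x)" if "x \<in> S" for x
    using linear_basis_expansion[OF linear_frechet_derivative] 
      smooth_on_differentiable[OF assms(1) that] by metis
  ultimately show ?thesis by (rule smooth_on_cong[OF \<open>open S\<close>])
qed

lemma bounded_linear_Pair_cases:
  "bounded_linear (\<lambda>x. (x, 0))" "bounded_linear (\<lambda>y. (0, y))"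
  by (auto intro: bounded_linear_Pair bounded_linear_ident bounded_linear_zero)

lemma smooth_on_Pair:
  assumes "smooth_on f S" "smooth_on g S" "open S"
  shows "smooth_on (\<lambda>x. (f x, g x)) S"
  using smooth_on_add[OF smooth_on_bounded_linear[OF bounded_linear_Pair_cases(1) assms(1,3)]
      smooth_on_bounded_linear[OF bounded_linear_Pair_cases(2) assms(2,3)] assms(3)] by simp

section \<open>Charts and tangent vectors\<close>

text \<open>Components of tangent vectors and coordinate fields are both given by this derivative, with
  the preferred chart at \<open>p\<close> as source or as target; the chain rule for it contains all
  transformation laws.\<close>

definition transition_deriv ::
  "('a, 'b::euclidean_space) chart \<Rightarrow> ('a, 'b) chart \<Rightarrow> 'a \<Rightarrow> 'b \<Rightarrow> 'b" where
  "transition_deriv c d p = frechet_derivative (chart_map d \<circ> chart_inv c) (at (chart_map c p))"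

definition field_rep ::
  "('a, 'b::euclidean_space) manifold \<Rightarrow> ('a, 'b) chart \<Rightarrow> ('a \<Rightarrow> 'b) \<Rightarrow> 'b \<Rightarrow> 'b" where
  "field_rep M c X = (\<lambda>x. chart_components M c (chart_inv c x) (X (chart_inv c x)))"

lemma chart_components_eq: "chart_components M c p v = transition_deriv (chart_at M p) c p v"
  by (simp add: chart_components_def transition_deriv_def)

lemma coord_field_eq: "coord_field M c w p = transition_deriv c (chart_at M p) p w"
  by (simp add: coord_field_def transition_deriv_def)

lemma vector_field_eq:
  "vector_field M U X
    \<longleftrightarrow> (\<forall>c\<in>atlas M. smooth_on (field_rep M c X) (chart_map c ` (chart_dom c \<inter> U)))"
  by (simp add: vector_field_def field_rep_def)

lemma lie_bracket_eq_field_rep: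
  "lie_bracket N X Y p =
     frechet_derivative (field_rep N (chart_at N p) Y) (at (chart_map (chart_at N p) p)) (X p)
     - frechet_derivative (field_rep N (chart_at N p) X) (at (chart_map (chart_at N p) p)) (Y p)"
  by (simp add: lie_bracket_def field_rep_def Let_def)

lemma lie_bracket_swap: "lie_bracket N X Y p = - lie_bracket N Y X p"
  by (simp add: lie_bracket_eq_field_rep)

context
  fixes c :: "('a::topological_space, 'b::topological_space) chart"
  assumes c: "is_chart c"
begin

lemma chart_inv_map [simp]: "p \<in> chart_dom c \<Longrightarrow> chart_inv c (chart_map c p) = p"
  using c by (auto simp: is_chart_def homeomorphism_def)

lemma open_chart_dom: "open (chart_dom c)"
  using c by (auto simp: is_chart_def)

lemma continuous_on_chart_map: "continuous_on (chart_dom c) (chart_map c)"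
  using c by (auto simp: is_chart_def homeomorphism_def)

lemma open_chart_image:
  assumes "open U"
  shows "open (chart_map c ` (chart_dom c \<inter> U))"
proof -
  have "chart_map c ` (chart_dom c \<inter> U) = chart_inv c -` U \<inter> chart_map c ` chart_dom c"
    by force
  moreover have "continuous_on (chart_map c ` chart_dom c) (chart_inv c)"
      "open (chart_map c ` chart_dom c)"
    using c by (auto simp: is_chart_def homeomorphism_def)
  ultimately show ?thesis using continuous_on_open_vimage assms by metis
qed

lemma open_chart_image_subset: "open U \<Longrightarrow> U \<subseteq> chart_dom c \<Longrightarrow> open (chart_map c ` U)"
  using open_chart_image[of U] by (simp add: Int_absorb1)

end

locale smooth_mfd =
  fixes M :: "('a::{t2_space, second_countable_topology}, 'b::euclidean_space) manifold"
  assumes smooth: "smooth_manifold M"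
begin

lemma is_chart: "c \<in> atlas M \<Longrightarrow> is_chart c"
  using smooth by (auto simp: smooth_manifold_def)

lemmas inv_map = chart_inv_map[OF is_chart]

lemma chart_at: "p \<in> pts M \<Longrightarrow> chart_at M p \<in> atlas M"
    "p \<in> pts M \<Longrightarrow> p \<in> chart_dom (chart_at M p)"
  using smooth by (auto simp: smooth_manifold_def)

lemma in_pts: "c \<in> atlas M \<Longrightarrow> p \<in> chart_dom c \<Longrightarrow> p \<in> pts M"
  by (auto simp: pts_def)

lemma open_pts: "open (pts M)"
  unfolding pts_def using open_chart_dom[OF is_chart] by auto

lemma smooth_transition:
  "c \<in> atlas M \<Longrightarrow> d \<in> atlas M
    \<Longrightarrow> smooth_on (chart_map d \<circ> chart_inv c) (chart_map c ` (chart_dom c \<inter> chart_dom d))"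
  using smooth by (auto simp: smooth_manifold_def)

lemma has_derivative_transition:
  assumes "c \<in> atlas M" "d \<in> atlas M" "p \<in> chart_dom c" "p \<in> chart_dom d"
  shows "((chart_map d \<circ> chart_inv c) has_derivative transition_deriv c d p) (at (chart_map c p))"
  unfolding transition_deriv_def
  by (rule smooth_on_has_derivative[OF smooth_transition]) (use assms in auto)

lemma linear_transition_deriv:
  assumes "c \<in> atlas M" "d \<in> atlas M" "p \<in> chart_dom c" "p \<in> chart_dom d"
  shows "linear (transition_deriv c d p)"
  using has_derivative_transition[OF assms] has_derivative_linear by blast

lemma transition_deriv_self:
  assumes "c \<in> atlas M" "p \<in> chart_dom c"
  shows "transition_deriv c c p v = v"
proof -
  have "((\<lambda>x. x) has_derivative transition_deriv c c p) (at (chart_map c p))"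
    by (rule has_derivative_transform_within_open[OF has_derivative_transition
          open_chart_image[OF is_chart open_UNIV]])
      (use assms in \<open>auto simp: inv_map\<close>)
  then show ?thesis using has_derivative_unique[OF has_derivative_ident] by metis
qed

lemma transition_deriv_compose:
  assumes c: "c \<in> atlas M" "p \<in> chart_dom c" and d: "d \<in> atlas M" "p \<in> chart_dom d"
    and e: "e \<in> atlas M" "p \<in> chart_dom e"
  shows "transition_deriv d e p (transition_deriv c d p v) = transition_deriv c e p v"
proof -
  have *: "((chart_map e \<circ> chart_inv d) has_derivative transition_deriv d e p)
      (at ((chart_map d \<circ> chart_inv c) (chart_map c p)))"
    using has_derivative_transition[OF d(1) e(1) d(2) e(2)] by (simp add: inv_map c)
  have "(chart_map e \<circ> chart_inv c has_derivative (\<lambda>v. transition_deriv d e p (transition_deriv c d p v)))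
      (at (chart_map c p))"
    by (rule has_derivative_transform_within_open[OF
          has_derivative_compose[OF has_derivative_transition[OF c(1) d(1) c(2) d(2)] *]
          open_chart_image[OF is_chart open_chart_dom[OF is_chart[OF d(1)]]]])
      (use c d in \<open>auto simp: inv_map\<close>)
  from has_derivative_unique[OF this has_derivative_transition[OF c(1) e(1) c(2) e(2)]]
  show ?thesis by metis
qed

lemma chart_components_change:
  assumes "c \<in> atlas M" "p \<in> chart_dom c" "d \<in> atlas M" "p \<in> chart_dom d"
  shows "chart_components M d p v = transition_deriv c d p (chart_components M c p v)"
  unfolding chart_components_eq
  using transition_deriv_compose[OF chart_at[OF in_pts] assms(1-4)] assms by simp

lemma linear_chart_components:
  "c \<in> atlas M \<Longrightarrow> p \<in> chart_dom c \<Longrightarrow> linear (chart_components M c p)"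
  unfolding chart_components_eq[abs_def]
  using linear_transition_deriv[of "chart_at M p" c p] chart_at in_pts by simp

lemma linear_coord_field:
  "c \<in> atlas M \<Longrightarrow> p \<in> chart_dom c \<Longrightarrow> linear (\<lambda>w. coord_field M c w p)"
  unfolding coord_field_eq[abs_def]
  using linear_transition_deriv[of c "chart_at M p" p] chart_at in_pts by simp

lemma chart_components_coord_field [simp]:
  "c \<in> atlas M \<Longrightarrow> p \<in> chart_dom c \<Longrightarrow> chart_components M c p (coord_field M c w p) = w"
  unfolding chart_components_eq coord_field_eq
  using transition_deriv_compose[of c p "chart_at M p" c w] chart_at in_pts
  by (simp add: transition_deriv_self)

lemma coord_field_chart_components [simp]:
  "c \<in> atlas M \<Longrightarrow> p \<in> chart_dom c \<Longrightarrow> coord_field M c (chart_components M c p v) p = v"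
  unfolding chart_components_eq coord_field_eq
  using transition_deriv_compose[of "chart_at M p" p c "chart_at M p" v] chart_at in_pts
  by (simp add: transition_deriv_self)

lemma chart_components_self: "p \<in> pts M \<Longrightarrow> chart_components M (chart_at M p) p v = v"
  by (simp add: chart_components_eq transition_deriv_self chart_at)

lemma coord_field_self: "p \<in> pts M \<Longrightarrow> coord_field M (chart_at M p) v p = v"
  by (simp add: coord_field_eq transition_deriv_self chart_at)

lemma coord_expansion:
  assumes "c \<in> atlas M" "p \<in> chart_dom c"
  shows "v = (\<Sum>b\<in>Basis. (chart_components M c p v \<bullet> b) *\<^sub>R coord_field M c b p)"
  using linear_basis_expansion[OF linear_coord_field[OF assms], of "chart_components M c p v"]
  by (simp add: assms)

lemma chart_components_eq_iff:
  "c \<in> atlas M \<Longrightarrow> p \<in> chart_dom c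
    \<Longrightarrow> chart_components M c p v = chart_components M c p w \<longleftrightarrow> v = w"
  by (metis coord_field_chart_components)

subsection \<open>Smooth functions and vector fields\<close>

lemma smooth_function_subset: "smooth_function M U f \<Longrightarrow> W \<subseteq> U \<Longrightarrow> smooth_function M W f"
  unfolding smooth_function_def by (blast intro: smooth_on_subset)

lemma vector_field_subset: "vector_field M U X \<Longrightarrow> W \<subseteq> U \<Longrightarrow> vector_field M W X"
  unfolding vector_field_def by (blast intro: smooth_on_subset)

lemma smooth_function_local:
  assumes "\<And>p. p \<in> U \<Longrightarrow> \<exists>c\<in>atlas M. \<exists>W. open W \<and> p \<in> W \<and> W \<subseteq> chart_dom c
      \<and> smooth_on (\<lambda>x. f (chart_inv c x)) (chart_map c ` W)"
  shows "smooth_function M U f"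
  unfolding smooth_function_def
proof (intro ballI smooth_on_local)
  fix d x
  assume d: "d \<in> atlas M" and "x \<in> chart_map d ` (chart_dom d \<inter> U)"
  then obtain p where p: "x = chart_map d p" "p \<in> chart_dom d" "p \<in> U" by auto
  obtain c W where cW: "c \<in> atlas M" "open W" "p \<in> W" "W \<subseteq> chart_dom c"
    "smooth_on (\<lambda>x. f (chart_inv c x)) (chart_map c ` W)"
    using assms[OF p(3)] by auto
  let ?T = "chart_map d ` (chart_dom d \<inter> W)"
  have T: "open ?T" using open_chart_image[OF is_chart[OF d] cW(2)] .
  have "smooth_on (\<lambda>y. f (chart_inv c ((chart_map c \<circ> chart_inv d) y))) ?T"
    by (rule smooth_on_compose[OF cW(5) smooth_on_subset[OF smooth_transition[OF d cW(1)]] T])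
      (use cW d in \<open>auto simp: inv_map\<close>)
  then have "smooth_on (\<lambda>y. f (chart_inv d y)) ?T"
    by (rule smooth_on_cong[OF T]) (use cW d in \<open>auto simp: inv_map\<close>)
  then show "\<exists>T. open T \<and> x \<in> T \<and> smooth_on (\<lambda>y. f (chart_inv d y)) T"
    using T p cW by blast
qed

text \<open>Components in two charts differ by the derivative of a smooth transition map, so a single
  chart near each point suffices.\<close>

lemma vector_field_local:
  assumes "\<And>p. p \<in> U \<Longrightarrow> \<exists>c\<in>atlas M. \<exists>W. open W \<and> p \<in> W \<and> W \<subseteq> chart_dom c
      \<and> smooth_on (field_rep M c X) (chart_map c ` W)"
  shows "vector_field M U X"
  unfolding vector_field_eq
proof (intro ballI smooth_on_local)
  fix d x
  assume d: "d \<in> atlas M" and "x \<in> chart_map d ` (chart_dom d \<inter> U)"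
  then obtain p where p: "x = chart_map d p" "p \<in> chart_dom d" "p \<in> U" by auto
  obtain c W where cW: "c \<in> atlas M" "open W" "p \<in> W" "W \<subseteq> chart_dom c"
    "smooth_on (field_rep M c X) (chart_map c ` W)"
    using assms[OF p(3)] by auto
  let ?T = "chart_map d ` (chart_dom d \<inter> W)" and ?S = "chart_map c ` (chart_dom d \<inter> W)"
  have T: "open ?T" using open_chart_image[OF is_chart[OF d] cW(2)] .
  have S: "open ?S"
    using cW(4) open_Int[OF open_chart_dom[OF is_chart[OF d]] cW(2)]
    by (intro open_chart_image_subset[OF is_chart[OF cW(1)]]) auto
  have "smooth_on (\<lambda>y. frechet_derivative (chart_map d \<circ> chart_inv c) (at y) (field_rep M c X y)) ?S"
    by (rule smooth_on_derivative_apply[OF smooth_on_subset[OF smooth_transition[OF cW(1) d]]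
          smooth_on_subset[OF cW(5)] S]) (use cW(4) in auto)
  then have "smooth_on (\<lambda>y. frechet_derivative (chart_map d \<circ> chart_inv c)
        (at ((chart_map c \<circ> chart_inv d) y)) (field_rep M c X ((chart_map c \<circ> chart_inv d) y))) ?T"
    by (rule smooth_on_compose[OF _ smooth_on_subset[OF smooth_transition[OF d cW(1)]] T])
      (use cW d in \<open>auto simp: inv_map\<close>)
  then have "smooth_on (field_rep M d X) ?T"
  proof (rule smooth_on_cong[OF T])
    fix y
    assume "y \<in> ?T"
    then obtain q where q: "y = chart_map d q" "q \<in> chart_dom d" "q \<in> chart_dom c"
      using cW(4) by auto
    show "frechet_derivative (chart_map d \<circ> chart_inv c) (at ((chart_map c \<circ> chart_inv d) y))
        (field_rep M c X ((chart_map c \<circ> chart_inv d) y)) = field_rep M d X y"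
      using chart_components_change[OF cW(1) q(3) d q(2), of "X q"] q cW d
      by (simp add: field_rep_def inv_map transition_deriv_def)
  qed
  then show "\<exists>T. open T \<and> x \<in> T \<and> smooth_on (field_rep M d X) T"
    using T p cW by blast
qed

lemma smooth_function_chartI:
  "c \<in> atlas M \<Longrightarrow> open U \<Longrightarrow> U \<subseteq> chart_dom c
    \<Longrightarrow> smooth_on (\<lambda>x. f (chart_inv c x)) (chart_map c ` U) \<Longrightarrow> smooth_function M U f"
  by (rule smooth_function_local) blast

lemma vector_field_chartI:
  "c \<in> atlas M \<Longrightarrow> open U \<Longrightarrow> U \<subseteq> chart_dom c
    \<Longrightarrow> smooth_on (field_rep M c X) (chart_map c ` U) \<Longrightarrow> vector_field M U X"
  by (rule vector_field_local) blast

lemma smooth_function_chartD: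
  "smooth_function M U f \<Longrightarrow> c \<in> atlas M \<Longrightarrow> W \<subseteq> chart_dom c \<inter> U
    \<Longrightarrow> smooth_on (\<lambda>x. f (chart_inv c x)) (chart_map c ` W)"
  unfolding smooth_function_def by (meson image_mono smooth_on_subset)

lemma vector_field_chartD:
  "vector_field M U X \<Longrightarrow> c \<in> atlas M \<Longrightarrow> W \<subseteq> chart_dom c \<inter> U
    \<Longrightarrow> smooth_on (field_rep M c X) (chart_map c ` W)"
  unfolding vector_field_eq by (meson image_mono smooth_on_subset)

lemma smooth_function_open_cover:
  assumes "\<And>p. p \<in> U \<Longrightarrow> \<exists>W. open W \<and> p \<in> W \<and> smooth_function M W f" "U \<subseteq> pts M"
  shows "smooth_function M U f"
proof (rule smooth_function_local)
  fix p
  assume p: "p \<in> U"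
  then obtain W where W: "open W" "p \<in> W" "smooth_function M W f" using assms by blast
  have q: "p \<in> pts M" using p assms by blast
  show "\<exists>c\<in>atlas M. \<exists>W. open W \<and> p \<in> W \<and> W \<subseteq> chart_dom c
      \<and> smooth_on (\<lambda>x. f (chart_inv c x)) (chart_map c ` W)"
    using chart_at[OF q] smooth_function_chartD[OF W(3) chart_at(1)[OF q] subset_refl] W
      open_chart_dom[OF is_chart[OF chart_at(1)[OF q]]]
    by (intro bexI[of _ "chart_at M p"] exI[of _ "chart_dom (chart_at M p) \<inter> W"]) auto
qed

context
  fixes U :: "'a set"
  assumes U: "open U"
begin

lemma open_image: "c \<in> atlas M \<Longrightarrow> open (chart_map c ` (chart_dom c \<inter> U))"
  using open_chart_image[OF is_chart U] .

lemma smooth_function_cong: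
  assumes "smooth_function M U f" "\<And>p. p \<in> U \<Longrightarrow> f p = h p"
  shows "smooth_function M U h"
  unfolding smooth_function_def
proof
  fix c
  assume c: "c \<in> atlas M"
  show "smooth_on (\<lambda>x. h (chart_inv c x)) (chart_map c ` (chart_dom c \<inter> U))"
    by (rule smooth_on_cong[OF open_image[OF c], of "\<lambda>x. f (chart_inv c x)"])
      (use assms c in \<open>auto simp: smooth_function_def inv_map\<close>)
qed

lemma vector_field_cong:
  assumes "vector_field M U X" "\<And>p. p \<in> U \<Longrightarrow> X p = Y p"
  shows "vector_field M U Y"
  unfolding vector_field_eq
proof
  fix c
  assume c: "c \<in> atlas M"
  show "smooth_on (field_rep M c Y) (chart_map c ` (chart_dom c \<inter> U))"
    by (rule smooth_on_cong[OF open_image[OF c], of "field_rep M c X"])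
      (use assms c in \<open>auto simp: vector_field_eq field_rep_def inv_map\<close>)
qed

lemma smooth_function_const: "smooth_function M U (\<lambda>p. k)"
  by (simp add: smooth_function_def smooth_on_const)

lemma smooth_function_add:
  "smooth_function M U f \<Longrightarrow> smooth_function M U h \<Longrightarrow> smooth_function M U (\<lambda>p. f p + h p)"
  by (simp add: smooth_function_def smooth_on_add open_image)

lemma smooth_function_mult:
  "smooth_function M U f \<Longrightarrow> smooth_function M U h \<Longrightarrow> smooth_function M U (\<lambda>p. f p * h p)"
  by (simp add: smooth_function_def smooth_on_mult open_image)

lemma smooth_function_sum:
  "(\<And>i. i \<in> A \<Longrightarrow> smooth_function M U (f i)) \<Longrightarrow> smooth_function M U (\<lambda>p. \<Sum>i\<in>A. f i p)"
  by (simp add: smooth_function_def smooth_on_sum open_image)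

lemma smooth_function_divide:
  assumes "smooth_function M U f" "smooth_function M U h" "\<And>p. p \<in> U \<Longrightarrow> h p \<noteq> 0"
  shows "smooth_function M U (\<lambda>p. f p / h p)"
proof -
  have "smooth_function M U (\<lambda>p. inverse (h p))"
    using assms(2,3) unfolding smooth_function_def
    by (auto intro!: smooth_on_inverse open_image simp: inv_map)
  then show ?thesis
    using smooth_function_mult[OF assms(1)] by (simp add: divide_inverse)
qed

lemma vector_field_add:
  assumes "vector_field M U X" "vector_field M U Y"
  shows "vector_field M U (\<lambda>p. X p + Y p)"
  unfolding vector_field_eq
proof
  fix c
  assume c: "c \<in> atlas M"
  have "smooth_on (\<lambda>x. field_rep M c X x + field_rep M c Y x) (chart_map c ` (chart_dom c \<inter> U))"
    using assms c by (auto simp: vector_field_eq intro: smooth_on_add open_image)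
  then show "smooth_on (field_rep M c (\<lambda>p. X p + Y p)) (chart_map c ` (chart_dom c \<inter> U))"
    by (rule smooth_on_cong[OF open_image[OF c]])
      (auto simp: field_rep_def inv_map c linear_add[OF linear_chart_components])
qed

lemma vector_field_scale:
  assumes "smooth_function M U f" "vector_field M U X"
  shows "vector_field M U (\<lambda>p. f p *\<^sub>R X p)"
  unfolding vector_field_eq
proof
  fix c
  assume c: "c \<in> atlas M"
  have "smooth_on (\<lambda>x. f (chart_inv c x) *\<^sub>R field_rep M c X x) (chart_map c ` (chart_dom c \<inter> U))"
    using assms c
    by (auto simp: vector_field_eq smooth_function_def intro: smooth_on_scaleR open_image)
  then show "smooth_on (field_rep M c (\<lambda>p. f p *\<^sub>R X p)) (chart_map c ` (chart_dom c \<inter> U))"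
    by (rule smooth_on_cong[OF open_image[OF c]])
      (auto simp: field_rep_def inv_map c linear_cmul[OF linear_chart_components])
qed

lemma vector_field_zero: "vector_field M U (\<lambda>p. 0)"
  unfolding vector_field_eq
proof
  fix c
  assume c: "c \<in> atlas M"
  show "smooth_on (field_rep M c (\<lambda>p. 0)) (chart_map c ` (chart_dom c \<inter> U))"
    by (rule smooth_on_cong[OF open_image[OF c] smooth_on_const[of 0]])
      (auto simp: field_rep_def inv_map c linear_0[OF linear_chart_components])
qed

lemma vector_field_diff:
  assumes "vector_field M U X" "vector_field M U Y"
  shows "vector_field M U (\<lambda>p. X p - Y p)"
  using vector_field_add[OF assms(1) vector_field_scale[OF smooth_function_const[of "-1"] assms(2)]]
  by simp

lemma vector_field_sum:
  "(\<And>i. i \<in> A \<Longrightarrow> vector_field M U (E i)) \<Longrightarrow> vector_field M U (\<lambda>p. \<Sum>i\<in>A. E i p)"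
  by (induction A rule: infinite_finite_induct) (auto intro: vector_field_zero vector_field_add)

lemma vector_field_coord:
  assumes "c \<in> atlas M" "U \<subseteq> chart_dom c"
  shows "vector_field M U (coord_field M c w)"
proof (rule vector_field_chartI[OF assms(1) U assms(2)])
  show "smooth_on (field_rep M c (coord_field M c w)) (chart_map c ` U)"
    by (rule smooth_on_cong[OF _ smooth_on_const[of w]])
      (use assms U in \<open>auto simp: field_rep_def inv_map subset_iff intro!: open_chart_image_subset is_chart\<close>)
qed

lemma smooth_function_components:
  assumes "c \<in> atlas M" "U \<subseteq> chart_dom c" "vector_field M U X"
  shows "smooth_function M U (\<lambda>p. chart_components M c p (X p) \<bullet> b)"
proof (rule smooth_function_chartI[OF assms(1) U assms(2)])
  have "smooth_on (\<lambda>x. field_rep M c X x \<bullet> b) (chart_map c ` U)"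
    using assms(2)
    by (intro smooth_on_inner_left vector_field_chartD[OF assms(3,1)]
        open_chart_image_subset is_chart assms U) auto
  then show "smooth_on (\<lambda>x. chart_components M c (chart_inv c x) (X (chart_inv c x)) \<bullet> b)
      (chart_map c ` U)"
    by (simp add: field_rep_def)
qed

end

lemma smooth_function_continuous:
  assumes "smooth_function M U f" "open U" "U \<subseteq> pts M"
  shows "continuous_on U f"
proof (rule continuous_at_imp_continuous_on, rule ballI)
  fix p
  assume p: "p \<in> U"
  define c where "c = chart_at M p"
  have c: "c \<in> atlas M" "p \<in> chart_dom c" using chart_at p assms(3) by (auto simp: c_def)
  let ?W = "chart_dom c \<inter> U"
  have "continuous_on (chart_map c ` ?W) (\<lambda>x. f (chart_inv c x))"
    by (rule smooth_on_continuous[OF smooth_function_chartD[OF assms(1) c(1)]]) simp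
  then have "continuous_on ?W (\<lambda>q. f (chart_inv c (chart_map c q)))"
    by (rule continuous_on_compose2[OF _ continuous_on_subset[OF continuous_on_chart_map[OF is_chart]]])
      (use c in auto)
  then have "continuous_on ?W f"
    by (rule continuous_on_eq) (simp add: inv_map c)
  moreover have "open ?W" using open_chart_dom[OF is_chart[OF c(1)]] assms(2) by auto
  ultimately show "isCont f p" using c p continuous_on_eq_continuous_at by blast
qed

subsection \<open>Directional derivatives\<close>

lemma dir_deriv_has_derivative:
  assumes "smooth_function M U f" "p \<in> U" "p \<in> pts M"
  shows "((\<lambda>y. f (chart_inv (chart_at M p) y)) has_derivative (\<lambda>x. dir_deriv M p x f))
    (at (chart_map (chart_at M p) p))"
  unfolding dir_deriv_def
  by (rule smooth_on_has_derivative[OF smooth_function_chartD[OF assms(1) chart_at(1)[OF assms(3)] subset_refl]])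
    (use assms chart_at in auto)

lemma dir_deriv_cong:
  assumes "open W" "p \<in> W" "p \<in> pts M" "\<And>q. q \<in> W \<Longrightarrow> f q = h q"
  shows "dir_deriv M p x f = dir_deriv M p x h"
  unfolding dir_deriv_def
  by (subst frechet_derivative_local[OF open_chart_image[OF is_chart \<open>open W\<close>],
        of "chart_at M p" _ _ "\<lambda>y. h (chart_inv (chart_at M p) y)"])
    (use assms chart_at in \<open>auto simp: inv_map\<close>)

lemma dir_deriv_const: "dir_deriv M p x (\<lambda>q. k) = 0"
  by (simp add: dir_deriv_def)

lemma dir_deriv_linear: "smooth_function M U f \<Longrightarrow> p \<in> U \<Longrightarrow> p \<in> pts M \<Longrightarrow> linear (\<lambda>x. dir_deriv M p x f)"
  using dir_deriv_has_derivative has_derivative_linear by blast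

end

section \<open>Connections\<close>

locale affine_mfd = smooth_mfd M
  for M :: "('a::{t2_space, second_countable_topology}, 'b::euclidean_space) manifold" +
  fixes nabla :: "'a \<Rightarrow> 'b \<Rightarrow> ('a \<Rightarrow> 'b) \<Rightarrow> 'b"
  assumes affine: "affine_connection M nabla"
begin

context
  fixes U :: "'a set"
  assumes U: "open U" "U \<subseteq> pts M"
begin

lemmas affineD =
  mp[OF spec[OF spec[OF affine[unfolded affine_connection_def]]], OF conjI[OF U(1) conjI[OF U(2)]]]

lemma linear_nabla: "vector_field M U Y \<Longrightarrow> p \<in> U \<Longrightarrow> linear (\<lambda>x. nabla p x Y)"
  by (rule bspec[OF conjunct1[OF affineD]])

lemma vector_field_nabla:
  "vector_field M U X \<Longrightarrow> vector_field M U Y \<Longrightarrow> vector_field M U (\<lambda>q. nabla q (X q) Y)"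
  using affineD[of Y] by simp

lemma nabla_add:
  "vector_field M U Y \<Longrightarrow> vector_field M U Y' \<Longrightarrow> p \<in> U
    \<Longrightarrow> nabla p x (\<lambda>q. Y q + Y' q) = nabla p x Y + nabla p x Y'"
  using affineD[of Y] by simp

lemma nabla_scale:
  "smooth_function M U f \<Longrightarrow> vector_field M U Y \<Longrightarrow> p \<in> U
    \<Longrightarrow> nabla p x (\<lambda>q. f q *\<^sub>R Y q) = dir_deriv M p x f *\<^sub>R Y p + f p *\<^sub>R nabla p x Y"
  using affineD[of Y] by simp

text \<open>The indicator function of \<open>U\<close> is smooth on \<open>U\<close>, and multiplying two fields
  that agree on \<open>U\<close> by it makes them equal everywhere; the Leibniz rule shows that this does
  not change their covariant derivatives on \<open>U\<close>.\<close>

lemma nabla_cong: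
  assumes Y: "vector_field M U Y" and p: "p \<in> U" and eq: "\<And>q. q \<in> U \<Longrightarrow> Y q = Y' q"
  shows "nabla p x Y = nabla p x Y'"
proof -
  define f :: "'a \<Rightarrow> real" where "f = (\<lambda>q. if q \<in> U then 1 else 0)"
  have f: "smooth_function M U f"
    by (rule smooth_function_cong[OF U(1) smooth_function_const[OF U(1), of 1]]) (simp add: f_def)
  have "dir_deriv M p x f = 0"
    using dir_deriv_cong[OF U(1) p, of f "\<lambda>q. 1" x] p U dir_deriv_const[of p x 1]
    by (auto simp: f_def)
  then have "nabla p x (\<lambda>q. f q *\<^sub>R W q) = nabla p x W" if "vector_field M U W" for W
    using nabla_scale[OF f that p] p by (simp add: f_def)
  moreover have "(\<lambda>q. f q *\<^sub>R Y q) = (\<lambda>q. f q *\<^sub>R Y' q)"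
    using eq by (auto simp: f_def)
  ultimately show ?thesis using Y vector_field_cong[OF U(1) Y eq] by metis
qed

lemma nabla_sum:
  assumes "finite A" "\<And>i. i \<in> A \<Longrightarrow> vector_field M U (E i)" "p \<in> U"
  shows "nabla p x (\<lambda>q. \<Sum>i\<in>A. E i q) = (\<Sum>i\<in>A. nabla p x (E i))"
  using assms(1,2)
proof (induction A rule: finite_induct)
  case empty
  show ?case
    using nabla_scale[OF smooth_function_const[OF U(1), of 0] vector_field_zero[OF U(1)] assms(3), of x]
    by (simp add: dir_deriv_const)
next
  case (insert i A)
  then show ?case
    using nabla_add[of "E i" "\<lambda>q. \<Sum>i\<in>A. E i q" p x] vector_field_sum[OF U(1), of A E] assms(3)
    by simp
qed

end

lemma nabla_coord_field_expansion:
  assumes "c \<in> atlas M" "p \<in> chart_dom c"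
  shows "nabla p x (coord_field M c w) = (\<Sum>b\<in>Basis. (w \<bullet> b) *\<^sub>R nabla p x (coord_field M c b))"
proof -
  have D: "open (chart_dom c)" "chart_dom c \<subseteq> pts M"
    using open_chart_dom[OF is_chart] in_pts assms by auto
  have E: "vector_field M (chart_dom c) (coord_field M c b)" for b
    by (rule vector_field_coord) (use D assms in auto)
  have s: "vector_field M (chart_dom c) (\<lambda>q. (w \<bullet> b) *\<^sub>R coord_field M c b q)" for b
    by (intro vector_field_scale smooth_function_const D E)
  have "nabla p x (coord_field M c w) = nabla p x (\<lambda>q. \<Sum>b\<in>Basis. (w \<bullet> b) *\<^sub>R coord_field M c b q)"
    by (rule nabla_cong[OF D E assms(2)])
      (use assms in \<open>auto intro!: linear_basis_expansion linear_coord_field\<close>)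
  also have "\<dots> = (\<Sum>b\<in>Basis. nabla p x (\<lambda>q. (w \<bullet> b) *\<^sub>R coord_field M c b q))"
    by (rule nabla_sum[OF D]) (use s assms in auto)
  also have "\<dots> = (\<Sum>b\<in>Basis. (w \<bullet> b) *\<^sub>R nabla p x (coord_field M c b))"
    using nabla_scale[OF D smooth_function_const[OF D(1)] E assms(2)] by (simp add: dir_deriv_const)
  finally show ?thesis .
qed

text \<open>Expand \<open>E\<close> in coordinate fields; the Leibniz rule separates the derivative of the
  coefficients from that of the coordinate fields, and in the second part only the value \<open>E p\<close>
  enters. This is the form in which covariant derivatives along curves are defined.\<close>

lemma nabla_in_chart:
  assumes U: "open U" "U \<subseteq> pts M" and E: "vector_field M U E" and p: "p \<in> U"
  defines "d \<equiv> chart_at M p"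
  shows "nabla p v E = frechet_derivative (field_rep M d E) (at (chart_map d p)) v
    + nabla p v (coord_field M d (E p))"
proof -
  have P: "p \<in> pts M" using p U by auto
  have d: "d \<in> atlas M" "p \<in> chart_dom d" using chart_at[OF P] by (auto simp: d_def)
  define W where "W = U \<inter> chart_dom d"
  have W: "open W" "W \<subseteq> pts M" "p \<in> W" "W \<subseteq> chart_dom d"
    using U p d open_chart_dom[OF is_chart[OF d(1)]] by (auto simp: W_def)
  have EW: "vector_field M W E" using vector_field_subset[OF E] W_def by auto
  define f where "f = (\<lambda>b q. chart_components M d q (E q) \<bullet> b)"
  let ?D = "frechet_derivative (field_rep M d E) (at (chart_map d p)) v"
  have f: "smooth_function M W (f b)" for b
    unfolding f_def by (rule smooth_function_components[OF W(1) d(1) W(4) EW])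
  have C: "vector_field M W (coord_field M d b)" for b
    by (rule vector_field_coord[OF W(1) d(1) W(4)])
  have s: "vector_field M W (\<lambda>q. f b q *\<^sub>R coord_field M d b q)" for b
    by (rule vector_field_scale[OF W(1) f C])
  have deriv: "dir_deriv M p v (f b) = ?D \<bullet> b" for b
  proof -
    have "(field_rep M d E has_derivative frechet_derivative (field_rep M d E) (at (chart_map d p)))
        (at (chart_map d p))"
      by (rule smooth_on_has_derivative[OF vector_field_chartD[OF E d(1) subset_refl]]) (use d p in auto)
    then have "((\<lambda>y. field_rep M d E y \<bullet> b) has_derivative
        (\<lambda>v. frechet_derivative (field_rep M d E) (at (chart_map d p)) v \<bullet> b)) (at (chart_map d p))"
      by (rule bounded_linear.has_derivative[OF bounded_linear_inner_left])
    from frechet_derivative_at[OF this] show ?thesis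
      by (simp add: dir_deriv_def f_def d_def field_rep_def fun_eq_iff)
  qed
  have "nabla p v E = nabla p v (\<lambda>q. \<Sum>b\<in>Basis. f b q *\<^sub>R coord_field M d b q)"
    by (rule nabla_cong[OF W(1,2) EW W(3)])
      (use W in \<open>auto simp: f_def intro!: coord_expansion d\<close>)
  also have "\<dots> = (\<Sum>b\<in>Basis. nabla p v (\<lambda>q. f b q *\<^sub>R coord_field M d b q))"
    by (rule nabla_sum[OF W(1,2)]) (use s W in auto)
  also have "\<dots> = (\<Sum>b\<in>Basis. (?D \<bullet> b) *\<^sub>R b + (E p \<bullet> b) *\<^sub>R nabla p v (coord_field M d b))"
  proof (rule sum.cong[OF refl])
    fix b :: 'b
    have "f b p = E p \<bullet> b" "coord_field M d b p = b"
      using coord_field_self[OF P] chart_components_self[OF P] by (simp_all add: d_def f_def)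
    then show "nabla p v (\<lambda>q. f b q *\<^sub>R coord_field M d b q)
        = (?D \<bullet> b) *\<^sub>R b + (E p \<bullet> b) *\<^sub>R nabla p v (coord_field M d b)"
      by (simp only: nabla_scale[OF W(1,2) f C W(3)] deriv)
  qed
  also have "\<dots> = ?D + nabla p v (coord_field M d (E p))"
    by (simp only: sum.distrib euclidean_representation nabla_coord_field_expansion[OF d, of v "E p"])
  finally show ?thesis .
qed

end

text \<open>Both the base and the cone are instances.\<close>

locale levi_civita_mfd = affine_mfd M nabla
  for M :: "('a::{t2_space, second_countable_topology}, 'b::euclidean_space) manifold" and nabla +
  fixes g :: "'a \<Rightarrow> 'b \<Rightarrow> 'b \<Rightarrow> real"
  assumes torsion_free: "torsion_free M nabla"
    and metric_conn: "metric_connection M g nabla"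
    and bilinear_metric: "p \<in> pts M \<Longrightarrow> bilinear (g p)"
    and metric_sym: "p \<in> pts M \<Longrightarrow> g p u v = g p v u"
    and metric_nondegenerate: "p \<in> pts M \<Longrightarrow> (\<And>v. g p u v = 0) \<Longrightarrow> u = 0"
begin

lemmas metric_simps =
  bilinear_ladd[OF bilinear_metric] bilinear_radd[OF bilinear_metric]
  bilinear_lsub[OF bilinear_metric] bilinear_rsub[OF bilinear_metric]
  bilinear_lmul[OF bilinear_metric] bilinear_rmul[OF bilinear_metric]
  bilinear_lneg[OF bilinear_metric] bilinear_rneg[OF bilinear_metric]
  bilinear_lzero[OF bilinear_metric] bilinear_rzero[OF bilinear_metric]

lemma metric_derivative:
  assumes "open U" "U \<subseteq> pts M" "vector_field M U Y" "vector_field M U Z" "p \<in> U"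
  shows "dir_deriv M p x (\<lambda>q. g q (Y q) (Z q)) = g p (nabla p x Y) (Z p) + g p (Y p) (nabla p x Z)"
  using metric_conn assms unfolding metric_connection_def by simp

lemma lie_bracket_eq:
  assumes "open U" "U \<subseteq> pts M" "vector_field M U X" "vector_field M U Y" "p \<in> U"
  shows "lie_bracket M X Y p = nabla p (X p) Y - nabla p (Y p) X"
  using torsion_free assms unfolding torsion_free_def by metis

lemma koszul:
  assumes "open U" "U \<subseteq> pts M" "vector_field M U X" "vector_field M U Y" "vector_field M U Z" "p \<in> U"
  shows "2 * g p (nabla p (X p) Y) (Z p) =
      dir_deriv M p (X p) (\<lambda>q. g q (Y q) (Z q)) + dir_deriv M p (Y p) (\<lambda>q. g q (X q) (Z q))
      - dir_deriv M p (Z p) (\<lambda>q. g q (X q) (Y q)) + g p (lie_bracket M X Y p) (Z p)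
      - g p (lie_bracket M X Z p) (Y p) - g p (lie_bracket M Y Z p) (X p)"
proof -
  have P: "p \<in> pts M" using assms by auto
  show ?thesis
    using assms metric_sym[OF P, of "X p"] metric_sym[OF P, of "Y p"]
    by (simp add: metric_derivative lie_bracket_eq metric_simps P)
qed

end

lemma (in smooth_mfd) smooth_function_metric:
  assumes sr: "semi_riemannian M g" and U: "open U" "U \<subseteq> pts M"
    and X: "vector_field M U X" and Y: "vector_field M U Y"
  shows "smooth_function M U (\<lambda>p. g p (X p) (Y p))"
proof (rule smooth_function_open_cover[OF _ U(2)])
  fix p
  assume p: "p \<in> U"
  define c where "c = chart_at M p"
  have c: "c \<in> atlas M" "p \<in> chart_dom c" using p U chart_at by (auto simp: c_def)
  define W where "W = U \<inter> chart_dom c"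
  have W: "open W" "W \<subseteq> pts M" "p \<in> W" "W \<subseteq> chart_dom c"
    using U p c open_chart_dom[OF is_chart[OF c(1)]] by (auto simp: W_def)
  let ?x = "\<lambda>X b q. chart_components M c q (X q) \<bullet> b"
  let ?G = "\<lambda>b b' q. g q (coord_field M c b q) (coord_field M c b' q)"
  have G: "smooth_function M W (?G b b')" for b b'
    using sr c W smooth_function_subset unfolding semi_riemannian_def by blast
  have x: "smooth_function M W (?x X b)" if "vector_field M U X" for X b
    using W c vector_field_subset[OF that] W_def by (intro smooth_function_components) auto
  have "smooth_function M W (\<lambda>q. \<Sum>b\<in>Basis. \<Sum>b'\<in>Basis. ?x X b q * (?x Y b' q * ?G b b' q))"
    by (intro smooth_function_sum smooth_function_mult W G x X Y)
  then have "smooth_function M W (\<lambda>p. g p (X p) (Y p))"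
  proof (rule smooth_function_cong[OF W(1)])
    fix q
    assume q: "q \<in> W"
    have lin: "linear (\<lambda>u. g q u v)" "linear (g q u)" for u v
      using sr q W unfolding semi_riemannian_def bilinear_def by blast+
    have cq: "linear (\<lambda>w. coord_field M c w q)" using linear_coord_field c W q by auto
    have 1: "g q (X q) v = (\<Sum>b\<in>Basis. ?x X b q * g q (coord_field M c b q) v)" for v
      using linear_basis_expansion[OF linear_compose[OF cq lin(1)[of v]], of "chart_components M c q (X q)"]
        c W q by (auto simp: o_def)
    have 2: "g q u (Y q) = (\<Sum>b\<in>Basis. ?x Y b q * g q u (coord_field M c b q))" for u
      using linear_basis_expansion[OF linear_compose[OF cq lin(2)[of u]], of "chart_components M c q (Y q)"]
        c W q by (auto simp: o_def)
    show "(\<Sum>b\<in>Basis. \<Sum>b'\<in>Basis. ?x X b q * (?x Y b' q * ?G b b' q)) = g q (X q) (Y q)"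
      by (subst 1, subst 2) (simp add: sum_distrib_left)
  qed
  then show "\<exists>W. open W \<and> p \<in> W \<and> smooth_function M W (\<lambda>p. g p (X p) (Y p))"
    using W by blast
qed

section \<open>Linear differential equations\<close>

text \<open>A linear family is bounded by its values on a basis, and these are bounded because each is
  continuous on a compact set.\<close>

lemma linear_family_bound:
  fixes A :: "real \<Rightarrow> 'b::euclidean_space \<Rightarrow> 'b"
  assumes S: "compact S" and lin: "\<And>s. s \<in> S \<Longrightarrow> linear (A s)"
    and cont: "\<And>w. continuous_on S (\<lambda>s. A s w)"
  obtains K where "K > 0" "\<And>s w. s \<in> S \<Longrightarrow> norm (A s w) \<le> K * norm w"
proof -
  have "\<exists>B. \<forall>s\<in>S. norm (A s b) \<le> B" for b
    using compact_imp_bounded[OF compact_continuous_image[OF cont S]] by (auto simp: bounded_iff)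
  then obtain B where B: "\<And>b s. s \<in> S \<Longrightarrow> norm (A s b) \<le> B b" by metis
  define K where "K = 1 + (\<Sum>b\<in>Basis. \<bar>B b\<bar>)"
  have "norm (A s w) \<le> K * norm w" if s: "s \<in> S" for s w
  proof -
    have "norm (A s w) = norm (\<Sum>b\<in>Basis. (w \<bullet> b) *\<^sub>R A s b)"
      by (subst linear_basis_expansion[OF lin[OF s], of w]) (rule refl)
    also have "\<dots> \<le> (\<Sum>b\<in>Basis. norm w * \<bar>B b\<bar>)"
    proof (rule sum_norm_le)
      fix b :: 'b
      assume "b \<in> Basis"
      then show "norm ((w \<bullet> b) *\<^sub>R A s b) \<le> norm w * \<bar>B b\<bar>"
        using B[OF s, of b] Basis_le_norm[of b w] by (auto intro!: mult_mono)
    qed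
    also have "\<dots> \<le> K * norm w"
      by (simp add: K_def algebra_simps flip: sum_distrib_left)
    finally show ?thesis .
  qed
  moreover have "K > 0" by (auto simp: K_def intro!: add_pos_nonneg sum_nonneg)
  ultimately show thesis using that by blast
qed

lemma continuous_on_linear_family:
  fixes A :: "real \<Rightarrow> 'b::euclidean_space \<Rightarrow> 'b"
  assumes lin: "\<And>s. s \<in> S \<Longrightarrow> linear (A s)"
    and cont: "\<And>w. continuous_on S (\<lambda>s. A s w)" and y: "continuous_on S y"
  shows "continuous_on S (\<lambda>s. A s (y s))"
proof -
  have "continuous_on S (\<lambda>s. \<Sum>b\<in>Basis. (y s \<bullet> b) *\<^sub>R A s b)"
    by (intro continuous_intros y cont)
  then show ?thesis
    by (rule continuous_on_eq) (rule linear_basis_expansion[OF lin, symmetric])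
qed

text \<open>Picard's argument: on a short interval the integral operator
  \<open>y \<mapsto> y0 + \<integral>\<^sub>0\<^sup>t A s (y s) ds\<close> is a contraction of the Banach space of bounded continuous
  functions on the line. Functions on the interval are extended to the line by clamping the
  argument, and the integral from \<open>0\<close> is a difference of integrals from the left end point, so
  that both signs of \<open>t\<close> are covered at once.\<close>

lemma linear_ode_exists:
  fixes A :: "real \<Rightarrow> 'b::euclidean_space \<Rightarrow> 'b"
  assumes a: "a > 0" and lin: "\<And>s. s \<in> {-a..a} \<Longrightarrow> linear (A s)"
    and cont: "\<And>w. continuous_on {-a..a} (\<lambda>s. A s w)"
  obtains \<delta> where "\<delta> > 0" "\<delta> \<le> a"
    "\<And>y0. \<exists>y. y 0 = y0 \<and> (\<forall>s\<in>{-\<delta><..<\<delta>}. (y has_vector_derivative A s (y s)) (at s))"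
proof -
  obtain K where K: "K > 0" "\<And>s w. s \<in> {-a..a} \<Longrightarrow> norm (A s w) \<le> K * norm w"
    using linear_family_bound[of "{-a..a}" A] lin cont by (metis compact_Icc)
  \<comment> \<open>The two integrals over intervals of length at most \<open>2 * \<delta>\<close> then contribute a
    contraction factor \<open>1 / 4\<close> each.\<close>
  define \<delta> where "\<delta> = min a (1 / (8 * K))"
  have \<delta>: "\<delta> > 0" "\<delta> \<le> a" "8 * K * \<delta> \<le> 1"
    using a K(1) by (auto simp: \<delta>_def min_def field_simps)
  let ?I = "{-\<delta>..\<delta>}"
  have sub: "?I \<subseteq> {-a..a}" using \<delta> by auto
  define clamp where "clamp t = max (-\<delta>) (min \<delta> t)" for t
  have clamp: "clamp t \<in> ?I" "t \<in> ?I \<Longrightarrow> clamp t = t" for t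
    using \<delta> by (auto simp: clamp_def)
  have "\<exists>y. y 0 = y0 \<and> (\<forall>s\<in>{-\<delta><..<\<delta>}. (y has_vector_derivative A s (y s)) (at s))" for y0
  proof -
    define h where "h \<phi> s = A s (apply_bcontfun \<phi> s)" for \<phi> s
    have h: "continuous_on ?I (h \<phi>)" for \<phi>
      unfolding h_def
    proof (rule continuous_on_linear_family[where A = A])
      show "linear (A s)" if "s \<in> ?I" for s using lin that sub by blast
      show "continuous_on ?I (\<lambda>s. A s w)" for w by (rule continuous_on_subset[OF cont sub])
    qed simp
    define P where "P \<phi> u = y0 + integral {-\<delta>..u} (h \<phi>) - integral {-\<delta>..0} (h \<phi>)" for \<phi> u
    have P': "(P \<phi> has_vector_derivative h \<phi> u) (at u within ?I)" if "u \<in> ?I" for \<phi> u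
      using has_vector_derivative_diff[OF has_vector_derivative_add[OF has_vector_derivative_const
            integral_has_vector_derivative[OF h that]] has_vector_derivative_const]
      unfolding P_def by simp
    then have Pc: "continuous_on ?I (P \<phi>)" for \<phi>
      using has_vector_derivative_continuous continuous_on_eq_continuous_within by blast
    have "continuous_on UNIV clamp" unfolding clamp_def by (intro continuous_intros)
    then have "continuous_on UNIV (\<lambda>t. P \<phi> (clamp t))" for \<phi>
      by (rule continuous_on_compose2[OF Pc]) (use clamp in auto)
    moreover have "bounded (range (\<lambda>t. P \<phi> (clamp t)))" for \<phi>
      by (rule bounded_subset[OF compact_imp_bounded[OF compact_continuous_image[OF Pc]]])
        (use clamp in auto)
    ultimately have bc: "(\<lambda>t. P \<phi> (clamp t)) \<in> bcontfun" for \<phi> by (simp add: bcontfun_def)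
    define T where "T \<phi> = Bcontfun (\<lambda>t. P \<phi> (clamp t))" for \<phi>
    have T: "apply_bcontfun (T \<phi>) t = P \<phi> (clamp t)" for \<phi> t
      by (simp add: T_def Bcontfun_inverse[OF bc])
    have int: "norm (integral {-\<delta>..u} (h \<phi>) - integral {-\<delta>..u} (h \<psi>)) \<le> dist \<phi> \<psi> / 4"
      if u: "u \<in> ?I" for \<phi> \<psi> u
    proof -
      have sb: "{-\<delta>..u} \<subseteq> ?I" using u by auto
      note i = integrable_continuous_real[OF continuous_on_subset[OF h sb]]
      have "norm (h \<phi> s - h \<psi> s) \<le> K * dist \<phi> \<psi>" if "s \<in> {-\<delta>..u}" for s
      proof -
        have s: "s \<in> {-a..a}" using that sb sub by auto
        have "norm (h \<phi> s - h \<psi> s) = norm (A s (apply_bcontfun \<phi> s - apply_bcontfun \<psi> s))"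
          by (simp add: h_def linear_diff[OF lin[OF s]])
        also have "\<dots> \<le> K * dist (apply_bcontfun \<phi> s) (apply_bcontfun \<psi> s)"
          using K(2)[OF s] by (simp add: dist_norm)
        also have "\<dots> \<le> K * dist \<phi> \<psi>"
          using K(1) dist_bounded by (intro mult_left_mono) auto
        finally show ?thesis .
      qed
      then have "norm (integral {-\<delta>..u} (\<lambda>s. h \<phi> s - h \<psi> s)) \<le> K * dist \<phi> \<psi> * (u - (-\<delta>))"
        using u \<delta> by (intro integral_bound continuous_on_diff continuous_on_subset[OF h sb]) auto
      also have "\<dots> \<le> K * dist \<phi> \<psi> * (2 * \<delta>)"
        using u K(1) by (intro mult_left_mono) auto
      also have "\<dots> = (8 * K * \<delta>) * (dist \<phi> \<psi> / 4)" by simp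
      also have "\<dots> \<le> 1 * (dist \<phi> \<psi> / 4)" by (intro mult_right_mono \<delta>) auto
      finally show ?thesis using integral_diff[OF i i] by simp
    qed
    have "dist (T \<phi>) (T \<psi>) \<le> (1 / 2) * dist \<phi> \<psi>" for \<phi> \<psi>
    proof (rule dist_bound)
      fix t
      have "dist (T \<phi> t) (T \<psi> t)
          = norm ((integral {-\<delta>..clamp t} (h \<phi>) - integral {-\<delta>..clamp t} (h \<psi>))
             - (integral {-\<delta>..0} (h \<phi>) - integral {-\<delta>..0} (h \<psi>)))"
        by (simp add: T P_def dist_norm algebra_simps)
      also have "\<dots> \<le> dist \<phi> \<psi> / 4 + dist \<phi> \<psi> / 4"
        by (rule order_trans[OF norm_triangle_ineq4 add_mono[OF int int]]) (use clamp \<delta> in auto)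
      finally show "dist (T \<phi> t) (T \<psi> t) \<le> (1 / 2) * dist \<phi> \<psi>" by simp
    qed
    then obtain \<phi> where \<phi>: "T \<phi> = \<phi>"
      using banach_fix_type[of "1/2" T] by auto
    have eq: "apply_bcontfun \<phi> t = P \<phi> t" if "t \<in> ?I" for t
      using T[of \<phi> t] clamp(2)[OF that] \<phi> by simp
    have "(apply_bcontfun \<phi> has_vector_derivative A s (apply_bcontfun \<phi> s)) (at s)"
      if s: "s \<in> {-\<delta><..<\<delta>}" for s
    proof -
      have "(P \<phi> has_vector_derivative h \<phi> s) (at s)"
        using P'[of s \<phi>] s at_within_Icc_at[of "-\<delta>" s \<delta>] by auto
      then have "(apply_bcontfun \<phi> has_vector_derivative h \<phi> s) (at s)"
        by (rule has_vector_derivative_transform_within_open[of _ _ _ "{-\<delta><..<\<delta>}"])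
          (use s eq in auto)
      then show ?thesis by (simp add: h_def)
    qed
    moreover have "apply_bcontfun \<phi> 0 = y0" using eq[of 0] \<delta> by (simp add: P_def)
    ultimately show ?thesis by blast
  qed
  then show thesis using that \<delta> by blast
qed

text \<open>The function \<open>f s * exp (- K * s)\<close> is nonincreasing.\<close>

lemma gronwall_zero_forward:
  fixes f :: "real \<Rightarrow> real"
  assumes "a \<le> b" and f: "\<And>s. s \<in> {a..b} \<Longrightarrow> (f has_real_derivative f' s) (at s)"
    and le: "\<And>s. s \<in> {a..b} \<Longrightarrow> f' s \<le> K * f s" and "f a = 0" "f b \<ge> 0"
  shows "f b = 0"
proof -
  have "f b * exp (- K * b) \<le> f a * exp (- K * a)"
  proof (rule DERIV_nonpos_imp_nonincreasing[OF \<open>a \<le> b\<close>])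
    fix s
    assume s: "a \<le> s" "s \<le> b"
    then have "((\<lambda>s. f s * exp (- K * s)) has_real_derivative (f' s - K * f s) * exp (- K * s)) (at s)"
      using f[of s] by (auto intro!: derivative_eq_intros simp: algebra_simps)
    moreover have "(f' s - K * f s) * exp (- K * s) \<le> 0"
      using le[of s] s by (intro mult_nonpos_nonneg) auto
    ultimately show "\<exists>y. ((\<lambda>s. f s * exp (- K * s)) has_real_derivative y) (at s) \<and> y \<le> 0" by blast
  qed
  then show ?thesis using assms(4,5) by (simp add: mult_le_0_iff)
qed

lemma gronwall_zero:
  fixes f :: "real \<Rightarrow> real"
  assumes f: "\<And>s. s \<in> {a..b} \<Longrightarrow> (f has_real_derivative f' s) (at s)"
    and le: "\<And>s. s \<in> {a..b} \<Longrightarrow> \<bar>f' s\<bar> \<le> K * f s" and nonneg: "\<And>s. s \<in> {a..b} \<Longrightarrow> f s \<ge> 0"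
    and s: "s \<in> {a..b}" "f s = 0" and t: "t \<in> {a..b}"
  shows "f t = 0"
proof (cases "s \<le> t")
  case True
  show ?thesis
  proof (rule gronwall_zero_forward[OF True f, of K])
    fix u
    assume "u \<in> {s..t}"
    then show "f' u \<le> K * f u" using le[of u] s t by auto
  qed (use nonneg s t in auto)
next
  case False
  let ?g = "\<lambda>u. f (- u)"
  have "?g (- t) = 0"
  proof (rule gronwall_zero_forward[of "-s" "-t" ?g "\<lambda>u. - f' (- u)" K])
    fix u
    assume u: "u \<in> {-s..-t}"
    then have "- u \<in> {a..b}" using s t by auto
    from DERIV_chain'[of "\<lambda>u. - u" "-1" u UNIV f, OF _ f[OF this]]
    show "(?g has_real_derivative - f' (- u)) (at u)"
      by (simp add: DERIV_minus)
    show "- f' (- u) \<le> K * f (- u)" using le[OF \<open>- u \<in> {a..b}\<close>] by auto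
  qed (use False s t nonneg in auto)
  then show ?thesis by simp
qed

section \<open>Planes spanned by two vectors\<close>

text \<open>This is stated for the pair and not for the set \<open>{a, b}\<close>, which may be independent
  when \<open>a = b\<close>.\<close>

definition independent_pair :: "'v::real_vector \<Rightarrow> 'v \<Rightarrow> bool" where
  "independent_pair a b \<longleftrightarrow> (\<forall>s t. s *\<^sub>R a + t *\<^sub>R b = 0 \<longrightarrow> s = 0 \<and> t = 0)"

lemma independent_pair_commute: "independent_pair a b \<Longrightarrow> independent_pair b a"
  unfolding independent_pair_def by (metis add.commute)

lemma span_pair: "span {a, b} = {s *\<^sub>R a + t *\<^sub>R b | s t. True}"
proof safe
  fix x
  assume "x \<in> span {a, b}"
  then obtain k where "x - k *\<^sub>R a \<in> span {b}" using span_breakdown_eq by blast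
  then obtain l where "x - k *\<^sub>R a = l *\<^sub>R b" by (auto simp: span_singleton)
  then have "x = k *\<^sub>R a + l *\<^sub>R b" by (simp add: algebra_simps)
  then show "\<exists>s t. x = s *\<^sub>R a + t *\<^sub>R b \<and> True" by blast
next
  fix s t
  show "s *\<^sub>R a + t *\<^sub>R b \<in> span {a, b}"
    by (intro span_add span_scale span_base) auto
qed

lemma independent_pair_iff_dim:
  fixes a b :: "'v::euclidean_space"
  shows "independent_pair a b \<longleftrightarrow> dim (span {a, b}) = 2"
proof
  assume ind: "independent_pair a b"
  have ab: "a \<noteq> b" using ind[unfolded independent_pair_def, rule_format, of 1 "-1"] by auto
  have "b \<noteq> 0" using ind[unfolded independent_pair_def, rule_format, of 0 1] by auto
  moreover have "a \<notin> span {b}"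
  proof
    assume "a \<in> span {b}"
    then obtain k where "a = k *\<^sub>R b" by (auto simp: span_singleton)
    then show False using ind[unfolded independent_pair_def, rule_format, of 1 "-k"] by simp
  qed
  ultimately have "independent {a, b}"
    by (metis independent_insert independent_empty insert_absorb singletonD span_empty)
  then show "dim (span {a, b}) = 2"
    using dim_span_eq_card_independent ab by fastforce
next
  assume d: "dim (span {a, b}) = 2"
  have small: "dim (span {a, b}) \<le> 1" if "span {a, b} \<subseteq> span {c}" for c
  proof -
    have "dim (span {a, b}) \<le> dim {c}" using dim_subset[OF that] dim_span by metis
    also have "\<dots> \<le> 1" using dim_le_card'[of "{c}"] by simp
    finally show ?thesis .
  qed
  show "independent_pair a b"
    unfolding independent_pair_def
  proof (intro allI impI)
    fix s t
    assume st: "s *\<^sub>R a + t *\<^sub>R b = 0"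
    have "s = 0"
    proof (rule ccontr)
      assume s: "s \<noteq> 0"
      have "s *\<^sub>R a = - (t *\<^sub>R b)" using st by (simp add: add_eq_0_iff2)
      then have "a = (- t / s) *\<^sub>R b" using s by (metis divide_inverse_commute real_vector_affinity_eq scaleR_minus_left scaleR_scaleR scale_one left_inverse)
      then have "a \<in> span {b}" by (metis span_base span_scale singletonI)
      then have "span {a, b} \<subseteq> span {b}" by (simp add: span_minimal span_base)
      then show False using small d by fastforce
    qed
    moreover have "t = 0"
    proof (rule ccontr)
      assume "t \<noteq> 0"
      then have "b \<in> span {a}" using st \<open>s = 0\<close> span_zero by force
      then have "span {a, b} \<subseteq> span {a}" by (simp add: span_minimal span_base)
      then show False using small d by fastforce
    qed
    ultimately show "s = 0 \<and> t = 0" by simp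
  qed
qed

lemma independent_pair_linear_image:
  assumes "linear L" "inj L" "independent_pair a b"
  shows "independent_pair (L a) (L b)"
proof -
  have "s = 0 \<and> t = 0" if "s *\<^sub>R L a + t *\<^sub>R L b = 0" for s t
  proof -
    have "L (s *\<^sub>R a + t *\<^sub>R b) = L 0"
      using that by (simp add: linear_add[OF assms(1)] linear_cmul[OF assms(1)] linear_0[OF assms(1)])
    then show ?thesis using assms(2,3) by (auto simp: independent_pair_def dest: injD)
  qed
  then show ?thesis by (auto simp: independent_pair_def)
qed

text \<open>The Gram determinant.\<close>

definition gram :: "'v::real_inner \<Rightarrow> 'v \<Rightarrow> real" where
  "gram a b = (a \<bullet> a) * (b \<bullet> b) - (a \<bullet> b)\<^sup>2"

lemma independent_pair_iff_gram: "independent_pair a b \<longleftrightarrow> gram a b \<noteq> 0"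
proof
  assume ind: "independent_pair a b"
  have b: "b \<noteq> 0" using ind[unfolded independent_pair_def, rule_format, of 0 1] by auto
  show "gram a b \<noteq> 0"
  proof
    assume 0: "gram a b = 0"
    \<comment> \<open>\<open>b \<bullet> b\<close> times the part of \<open>a\<close> orthogonal to \<open>b\<close>\<close>
    let ?x = "(b \<bullet> b) *\<^sub>R a + (- (a \<bullet> b)) *\<^sub>R b"
    have "?x \<bullet> ?x = (b \<bullet> b) * gram a b"
      by (simp add: gram_def algebra_simps power2_eq_square inner_commute inner_simps)
    then have "?x = 0" using 0 by simp
    then have "b \<bullet> b = 0" using ind unfolding independent_pair_def by blast
    then show False using b by simp
  qed
next
  assume g: "gram a b \<noteq> 0"
  show "independent_pair a b"
    unfolding independent_pair_def
  proof (intro allI impI)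
    fix s t
    assume st: "s *\<^sub>R a + t *\<^sub>R b = 0"
    have 1: "s * (a \<bullet> a) + t * (a \<bullet> b) = 0" using arg_cong[OF st, of "\<lambda>x. a \<bullet> x"] by (simp add: inner_simps)
    have 2: "s * (a \<bullet> b) + t * (b \<bullet> b) = 0"
      using arg_cong[OF st, of "\<lambda>x. x \<bullet> b"] by (simp add: inner_simps)
    have "s * gram a b = (s * (a \<bullet> a) + t * (a \<bullet> b)) * (b \<bullet> b) - (s * (a \<bullet> b) + t * (b \<bullet> b)) * (a \<bullet> b)"
      "t * gram a b = (s * (a \<bullet> b) + t * (b \<bullet> b)) * (a \<bullet> a) - (s * (a \<bullet> a) + t * (a \<bullet> b)) * (a \<bullet> b)"
      by (simp_all add: gram_def algebra_simps power2_eq_square)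
    then have "s * gram a b = 0" "t * gram a b = 0" unfolding 1 2 by simp_all
    then show "s = 0 \<and> t = 0" using g by simp
  qed
qed

text \<open>The coefficient of \<open>a\<close> in the orthogonal projection of \<open>y\<close> to the plane spanned by
  \<open>a\<close> and \<open>b\<close>. Being rational in the inner products, it depends differentiably on the
  vectors.\<close>

definition proj_coeff :: "'v::real_inner \<Rightarrow> 'v \<Rightarrow> 'v \<Rightarrow> real" where
  "proj_coeff a b y = ((y \<bullet> a) * (b \<bullet> b) - (y \<bullet> b) * (a \<bullet> b)) / gram a b"

definition proj_rest :: "'v::real_inner \<Rightarrow> 'v \<Rightarrow> 'v \<Rightarrow> 'v" where
  "proj_rest a b y = y - (proj_coeff a b y *\<^sub>R a + proj_coeff b a y *\<^sub>R b)"

lemma gram_commute: "gram a b = gram b a"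
  by (simp add: gram_def inner_commute)

lemma proj_rest_orthogonal:
  assumes "gram a b \<noteq> 0"
  shows "proj_rest a b y \<bullet> a = 0" "proj_rest a b y \<bullet> b = 0"
proof -
  have "gram a b * (proj_rest a b y \<bullet> a) = 0" "gram a b * (proj_rest a b y \<bullet> b) = 0"
    using assms
    by (simp_all add: proj_rest_def proj_coeff_def gram_commute[of b a] inner_simps
        right_diff_distrib distrib_left)
      (simp_all add: gram_def algebra_simps power2_eq_square inner_commute)
  then show "proj_rest a b y \<bullet> a = 0" "proj_rest a b y \<bullet> b = 0" using assms by simp_all
qed

lemma proj_rest_eq_0_iff:
  assumes "gram a b \<noteq> 0"
  shows "proj_rest a b y = 0 \<longleftrightarrow> y \<in> span {a, b}"
proof
  assume "proj_rest a b y = 0"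
  then have "y = proj_coeff a b y *\<^sub>R a + proj_coeff b a y *\<^sub>R b" by (simp add: proj_rest_def)
  then show "y \<in> span {a, b}" unfolding span_pair by blast
next
  assume "y \<in> span {a, b}"
  then have "proj_rest a b y \<in> span {a, b}"
    unfolding proj_rest_def by (intro span_diff span_add span_scale) (auto intro: span_base)
  then obtain s t where st: "proj_rest a b y = s *\<^sub>R a + t *\<^sub>R b" unfolding span_pair by blast
  have "proj_rest a b y \<bullet> proj_rest a b y = 0"
    by (subst (2) st) (simp add: inner_simps proj_rest_orthogonal[OF assms])
  then show "proj_rest a b y = 0" by simp
qed

lemma proj_coeff_differentiable:
  assumes "a differentiable (at t)" "b differentiable (at t)" "y differentiable (at t)"
    and "gram (a t) (b t) \<noteq> 0"
  shows "(\<lambda>s. proj_coeff (a s) (b s) (y s)) differentiable (at (t::real))"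
  unfolding proj_coeff_def
  by (rule differentiable_divide)
    (use assms in \<open>auto simp: gram_def power2_eq_square intro!: differentiable_diff differentiable_mult\<close>)

section \<open>Parallel transport\<close>

lemma open_curve_preimage:
  "smooth_curve M I \<gamma> \<Longrightarrow> open W \<Longrightarrow> open {s \<in> I. \<gamma> s \<in> W}"
  using continuous_on_open_vimage[of I \<gamma>]
  by (auto simp: smooth_curve_def vimage_def Int_def conj_commute)

context affine_mfd
begin

lemma curve_in_chart:
  assumes "smooth_curve M I \<gamma>" "c \<in> atlas M"
  shows "smooth_on (\<lambda>s. chart_map c (\<gamma> s)) {s \<in> I. \<gamma> s \<in> chart_dom c}"
  using assms by (auto simp: smooth_curve_def)

lemma curve_has_vector_derivative:
  assumes "smooth_curve M I \<gamma>" "c \<in> atlas M" "t \<in> I" "\<gamma> t \<in> chart_dom c"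
  shows "((\<lambda>s. chart_map c (\<gamma> s)) has_vector_derivative
      vector_derivative (\<lambda>s. chart_map c (\<gamma> s)) (at t)) (at t)"
  using smooth_on_differentiable[OF curve_in_chart[OF assms(1,2)], of t] assms
  by (simp add: vector_derivative_works)

lemma velocity_components:
  assumes \<gamma>: "smooth_curve M I \<gamma>" and c: "c \<in> atlas M" and t: "t \<in> I" "\<gamma> t \<in> chart_dom c"
  shows "chart_components M c (\<gamma> t) (velocity M \<gamma> t)
    = vector_derivative (\<lambda>s. chart_map c (\<gamma> s)) (at t)"
proof -
  define d where "d = chart_at M (\<gamma> t)"
  have d: "d \<in> atlas M" "\<gamma> t \<in> chart_dom d" using chart_at in_pts c t by (auto simp: d_def)
  have "((\<lambda>s. chart_map d (\<gamma> s)) has_derivative (\<lambda>h. h *\<^sub>R velocity M \<gamma> t)) (at t)"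
    using curve_has_vector_derivative[OF \<gamma> d(1) t(1) d(2)]
    by (simp add: velocity_def d_def has_vector_derivative_def)
  from has_derivative_compose[OF this has_derivative_transition[OF d(1) c d(2) t(2)]]
  have "((\<lambda>s. (chart_map c \<circ> chart_inv d) (chart_map d (\<gamma> s))) has_derivative
      (\<lambda>h. transition_deriv d c (\<gamma> t) (h *\<^sub>R velocity M \<gamma> t))) (at t)" .
  then have "((\<lambda>s. chart_map c (\<gamma> s)) has_derivative
      (\<lambda>h. transition_deriv d c (\<gamma> t) (h *\<^sub>R velocity M \<gamma> t))) (at t)"
    by (rule has_derivative_transform_within_open[OF _
          open_curve_preimage[OF \<gamma> open_chart_dom[OF is_chart[OF d(1)]]]])
      (use t d in \<open>auto simp: inv_map\<close>)
  then have "((\<lambda>s. chart_map c (\<gamma> s)) has_vector_derivative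
      transition_deriv d c (\<gamma> t) (velocity M \<gamma> t)) (at t)"
    by (simp add: has_vector_derivative_def linear_cmul[OF linear_transition_deriv] d c t)
  then show ?thesis
    by (simp add: vector_derivative_at chart_components_eq d_def)
qed

text \<open>The Leibniz rule along a curve. The covariant derivative at time \<open>t\<close> is defined by
  components in the preferred chart at \<open>\<gamma> t\<close>, which changes with \<open>t\<close>; after this
  lemma it can be computed with any fields \<open>E i\<close>, in particular with the coordinate fields of a
  fixed chart.\<close>

lemma cov_deriv_along_combination:
  assumes \<gamma>: "smooth_curve M I \<gamma>" and t: "t \<in> I" and A: "finite A"
    and U: "open U" "U \<subseteq> pts M" "\<gamma> t \<in> U"
    and E: "\<And>i. i \<in> A \<Longrightarrow> vector_field M U (E i)"
    and f: "\<And>i. i \<in> A \<Longrightarrow> (f i has_real_derivative f' i) (at t)"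
    and S: "open S" "t \<in> S" "\<And>s. s \<in> S \<Longrightarrow> Y s = (\<Sum>i\<in>A. f i s *\<^sub>R E i (\<gamma> s))"
  shows "chart_components_along M \<gamma> Y t differentiable (at t)"
    and "cov_deriv_along M nabla \<gamma> Y t
      = (\<Sum>i\<in>A. f' i *\<^sub>R E i (\<gamma> t) + f i t *\<^sub>R nabla (\<gamma> t) (velocity M \<gamma> t) (E i))"
proof -
  define p where "p = \<gamma> t"
  define d where "d = chart_at M p"
  define v where "v = velocity M \<gamma> t"
  define x where "x = (\<lambda>s. chart_map d (\<gamma> s))"
  have p: "p \<in> pts M" using U by (auto simp: p_def)
  have d: "d \<in> atlas M" "p \<in> chart_dom d" using chart_at[OF p] by (auto simp: d_def)
  let ?D = "\<lambda>i. frechet_derivative (field_rep M d (E i)) (at (chart_map d p))"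
  let ?L = "\<Sum>i\<in>A. f i t *\<^sub>R ?D i v + f' i *\<^sub>R E i p"
  have xd: "(x has_derivative (\<lambda>h. h *\<^sub>R v)) (at t)"
    using curve_has_vector_derivative[OF \<gamma> d(1) t] d(2)
    by (simp add: velocity_def d_def has_vector_derivative_def v_def x_def p_def)
  have "((\<lambda>s. f i s *\<^sub>R field_rep M d (E i) (x s)) has_vector_derivative
      (f i t *\<^sub>R ?D i v + f' i *\<^sub>R E i p)) (at t)" if i: "i \<in> A" for i
  proof -
    have "(field_rep M d (E i) has_derivative ?D i) (at (x t))"
      using smooth_on_has_derivative[OF vector_field_chartD[OF E[OF i] d(1) subset_refl], of "x t"] U d
      by (auto simp: p_def x_def)
    from has_derivative_compose[OF xd this]
    have 1: "((\<lambda>s. field_rep M d (E i) (x s)) has_vector_derivative ?D i v) (at t)"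
      using linear_cmul[OF has_derivative_linear[OF \<open>(field_rep M d (E i) has_derivative ?D i) (at (x t))\<close>]]
      by (simp add: has_vector_derivative_def)
    have 2: "field_rep M d (E i) (x t) = E i p"
      using d chart_components_self[OF p] by (simp add: field_rep_def x_def inv_map flip: d_def p_def)
    show ?thesis using has_vector_derivative_scaleR[OF f[OF i] 1] by (simp only: 2)
  qed
  then have "((\<lambda>s. \<Sum>i\<in>A. f i s *\<^sub>R field_rep M d (E i) (x s)) has_vector_derivative ?L) (at t)"
    by (rule has_vector_derivative_sum)
  then have L: "(chart_components_along M \<gamma> Y t has_vector_derivative ?L) (at t)"
  proof (rule has_vector_derivative_transform_within_open)
    show "open (S \<inter> {s \<in> I. \<gamma> s \<in> chart_dom d})"
      using S open_curve_preimage[OF \<gamma> open_chart_dom[OF is_chart[OF d(1)]]] by auto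
    show "t \<in> S \<inter> {s \<in> I. \<gamma> s \<in> chart_dom d}" using t S d by (auto simp: p_def)
    fix s
    assume s: "s \<in> S \<inter> {s \<in> I. \<gamma> s \<in> chart_dom d}"
    then have lin: "linear (chart_components M d (\<gamma> s))" using linear_chart_components d by auto
    show "(\<Sum>i\<in>A. f i s *\<^sub>R field_rep M d (E i) (x s)) = chart_components_along M \<gamma> Y t s"
      using s d by (simp add: chart_components_along_def S(3) linear_sum[OF lin] linear_cmul[OF lin]
          field_rep_def x_def inv_map flip: d_def p_def)
  qed
  show "chart_components_along M \<gamma> Y t differentiable (at t)"
    using L has_vector_derivative_def differentiable_def by blast
  have Y: "Y t = (\<Sum>i\<in>A. f i t *\<^sub>R E i p)" using S by (simp add: p_def)
  have lin: "linear (\<lambda>w. nabla p v (coord_field M d w))"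
  proof (rule linearI)
    fix w w' :: 'b and k
    show "nabla p v (coord_field M d (w + w')) = nabla p v (coord_field M d w) + nabla p v (coord_field M d w')"
      unfolding nabla_coord_field_expansion[OF d, of v "w + w'"] nabla_coord_field_expansion[OF d, of v w]
        nabla_coord_field_expansion[OF d, of v w']
      by (simp add: inner_simps scaleR_left_distrib sum.distrib)
    show "nabla p v (coord_field M d (k *\<^sub>R w)) = k *\<^sub>R nabla p v (coord_field M d w)"
      unfolding nabla_coord_field_expansion[OF d, of v "k *\<^sub>R w"] nabla_coord_field_expansion[OF d, of v w]
      by (simp add: scaleR_sum_right)
  qed
  have "nabla p v (coord_field M d (Y t)) = (\<Sum>i\<in>A. f i t *\<^sub>R nabla p v (coord_field M d (E i p)))"
    by (simp add: Y linear_sum[OF lin] linear_cmul[OF lin])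
  then have "cov_deriv_along M nabla \<gamma> Y t
      = ?L + (\<Sum>i\<in>A. f i t *\<^sub>R nabla p v (coord_field M d (E i p)))"
    by (simp add: cov_deriv_along_def vector_derivative_at[OF L] v_def flip: d_def p_def)
  also have "\<dots> = (\<Sum>i\<in>A. f' i *\<^sub>R E i p + f i t *\<^sub>R nabla p v (E i))"
    unfolding sum.distrib[symmetric]
  proof (rule sum.cong[OF refl])
    fix i
    assume i: "i \<in> A"
    show "f i t *\<^sub>R ?D i v + f' i *\<^sub>R E i p + f i t *\<^sub>R nabla p v (coord_field M d (E i p))
        = f' i *\<^sub>R E i p + f i t *\<^sub>R nabla p v (E i)"
      using nabla_in_chart[OF U(1,2) E[OF i], of p v] U by (simp add: scaleR_right_distrib p_def d_def)
  qed
  finally show "cov_deriv_along M nabla \<gamma> Y t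
      = (\<Sum>i\<in>A. f' i *\<^sub>R E i (\<gamma> t) + f i t *\<^sub>R nabla (\<gamma> t) (velocity M \<gamma> t) (E i))"
    by (simp add: p_def v_def)
qed

text \<open>The Christoffel symbols of the chart \<open>c\<close> along \<open>\<gamma>\<close>, contracted with the
  velocity: a field with components \<open>y\<close> is parallel if \<open>y' = - conn_coeff c \<gamma> s y\<close>.\<close>

definition conn_coeff :: "('a, 'b) chart \<Rightarrow> (real \<Rightarrow> 'a) \<Rightarrow> real \<Rightarrow> 'b \<Rightarrow> 'b" where
  "conn_coeff c \<gamma> s w =
     chart_components M c (\<gamma> s) (nabla (\<gamma> s) (velocity M \<gamma> s) (coord_field M c w))"

lemma linear_conn_coeff:
  assumes "c \<in> atlas M" "\<gamma> s \<in> chart_dom c"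
  shows "linear (conn_coeff c \<gamma> s)"
proof (rule linearI)
  note lin = linear_chart_components[OF assms]
  note exp = nabla_coord_field_expansion[OF assms, of "velocity M \<gamma> s"]
  fix w w' :: 'b and k
  show "conn_coeff c \<gamma> s (w + w') = conn_coeff c \<gamma> s w + conn_coeff c \<gamma> s w'"
    unfolding conn_coeff_def exp[of "w + w'"] exp[of w] exp[of w']
    by (simp add: inner_simps scaleR_left_distrib sum.distrib linear_add[OF lin])
  show "conn_coeff c \<gamma> s (k *\<^sub>R w) = k *\<^sub>R conn_coeff c \<gamma> s w"
    unfolding conn_coeff_def exp[of "k *\<^sub>R w"] exp[of w]
    by (simp add: linear_cmul[OF lin] flip: scaleR_sum_right scaleR_scaleR)
qed

lemma continuous_on_conn_coeff:
  assumes \<gamma>: "smooth_curve M I \<gamma>" and c: "c \<in> atlas M"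
  shows "continuous_on {s \<in> I. \<gamma> s \<in> chart_dom c} (\<lambda>s. conn_coeff c \<gamma> s w)"
proof -
  let ?J = "{s \<in> I. \<gamma> s \<in> chart_dom c}"
  define x where "x = (\<lambda>s. chart_map c (\<gamma> s))"
  define B where "B b = (\<lambda>q. nabla q (coord_field M c b q) (coord_field M c w))" for b
  have D: "open (chart_dom c)" "chart_dom c \<subseteq> pts M"
    using open_chart_dom[OF is_chart] in_pts c by auto
  have C: "vector_field M (chart_dom c) (coord_field M c b)" for b
    by (rule vector_field_coord[OF D(1) c subset_refl])
  have x: "smooth_on x ?J" unfolding x_def by (rule curve_in_chart[OF \<gamma> c])
  have x': "continuous_on ?J (\<lambda>s. vector_derivative x (at s))"
    by (rule continuous_on_eq[OF smooth_on_continuous[OF smooth_on_derivative[OF x, of 1]]])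
      (simp add: frechet_derivative_eq_vector_derivative smooth_on_differentiable[OF x])
  have "continuous_on (chart_map c ` chart_dom c) (field_rep M c (B b))" for b
    unfolding B_def
    by (rule smooth_on_continuous[OF vector_field_chartD[OF vector_field_nabla[OF D C C] c]]) simp
  then have Bx: "continuous_on ?J (\<lambda>s. field_rep M c (B b) (x s))" for b
    by (rule continuous_on_compose2[OF _ smooth_on_continuous[OF x]]) (auto simp: x_def)
  have "continuous_on ?J (\<lambda>s. \<Sum>b\<in>Basis. (vector_derivative x (at s) \<bullet> b) *\<^sub>R field_rep M c (B b) (x s))"
    by (intro continuous_intros x' Bx)
  then show ?thesis
  proof (rule continuous_on_eq)
    fix s
    assume s: "s \<in> ?J"
    then have sc: "\<gamma> s \<in> chart_dom c" by simp
    have "conn_coeff c \<gamma> s w = chart_components M c (\<gamma> s)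
        (nabla (\<gamma> s) (\<Sum>b\<in>Basis. (vector_derivative x (at s) \<bullet> b) *\<^sub>R coord_field M c b (\<gamma> s)) (coord_field M c w))"
      using coord_expansion[OF c sc, of "velocity M \<gamma> s"] velocity_components[OF \<gamma> c _ sc] s
      by (simp add: conn_coeff_def x_def)
    also have "\<dots> = (\<Sum>b\<in>Basis. (vector_derivative x (at s) \<bullet> b) *\<^sub>R field_rep M c (B b) (x s))"
      by (simp add: linear_sum[OF linear_nabla[OF D C sc]] linear_cmul[OF linear_nabla[OF D C sc]]
          linear_sum[OF linear_chart_components[OF c sc]] linear_cmul[OF linear_chart_components[OF c sc]]
          field_rep_def x_def B_def inv_map c sc)
    finally show "(\<Sum>b\<in>Basis. (vector_derivative x (at s) \<bullet> b) *\<^sub>R field_rep M c (B b) (x s))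
        = conn_coeff c \<gamma> s w" by simp
  qed
qed

lemma cov_deriv_along_coord:
  assumes \<gamma>: "smooth_curve M I \<gamma>" and c: "c \<in> atlas M" and t: "t \<in> I" "\<gamma> t \<in> chart_dom c"
    and y: "(y has_vector_derivative y') (at t)"
    and S: "open S" "t \<in> S" "\<And>s. s \<in> S \<Longrightarrow> Y s = coord_field M c (y s) (\<gamma> s)"
  shows "chart_components_along M \<gamma> Y t differentiable (at t)"
    and "chart_components M c (\<gamma> t) (cov_deriv_along M nabla \<gamma> Y t) = y' + conn_coeff c \<gamma> t (y t)"
proof -
  let ?v = "velocity M \<gamma> t"
  let ?S = "S \<inter> {s \<in> I. \<gamma> s \<in> chart_dom c}"
  have D: "open (chart_dom c)" "chart_dom c \<subseteq> pts M"
    using open_chart_dom[OF is_chart] in_pts c by auto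
  have C: "vector_field M (chart_dom c) (coord_field M c b)" for b
    by (rule vector_field_coord[OF D(1) c subset_refl])
  have f: "((\<lambda>s. y s \<bullet> b) has_real_derivative y' \<bullet> b) (at t)" for b
    using bounded_linear.has_vector_derivative[OF bounded_linear_inner_left y]
    by (simp add: has_real_derivative_iff_has_vector_derivative)
  have So: "open ?S" "t \<in> ?S" using S t open_curve_preimage[OF \<gamma> D(1)] by auto
  have YS: "Y s = (\<Sum>b\<in>Basis. (y s \<bullet> b) *\<^sub>R coord_field M c b (\<gamma> s))" if "s \<in> ?S" for s
    using S(3)[of s] that linear_basis_expansion[OF linear_coord_field[OF c], of "\<gamma> s" "y s"] by simp
  note comb = cov_deriv_along_combination[OF \<gamma> t(1) finite_Basis D t(2) C f So YS]
  show "chart_components_along M \<gamma> Y t differentiable (at t)" by (rule comb(1))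
  have "cov_deriv_along M nabla \<gamma> Y t = (\<Sum>b\<in>Basis. (y' \<bullet> b) *\<^sub>R coord_field M c b (\<gamma> t))
      + (\<Sum>b\<in>Basis. (y t \<bullet> b) *\<^sub>R nabla (\<gamma> t) ?v (coord_field M c b))"
    by (simp only: comb(2) sum.distrib)
  also have "\<dots> = coord_field M c y' (\<gamma> t) + nabla (\<gamma> t) ?v (coord_field M c (y t))"
    using linear_basis_expansion[OF linear_coord_field[OF c t(2)], of y']
      nabla_coord_field_expansion[OF c t(2), of ?v "y t"] by metis
  finally show "chart_components M c (\<gamma> t) (cov_deriv_along M nabla \<gamma> Y t) = y' + conn_coeff c \<gamma> t (y t)"
    by (simp add: conn_coeff_def linear_add[OF linear_chart_components[OF c t(2)]] c t)
qed

text \<open>A parallel field is only known to be differentiable in the preferred chart at each time. Its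
  components in \<open>c\<close> arise from those by a transition derivative that varies smoothly along the
  curve.\<close>

lemma parallel_components:
  assumes \<gamma>: "smooth_curve M I \<gamma>" and c: "c \<in> atlas M" and t: "t \<in> I" "\<gamma> t \<in> chart_dom c"
    and Y: "parallel_along M nabla I \<gamma> Y"
  shows "((\<lambda>s. chart_components M c (\<gamma> s) (Y s)) has_vector_derivative
      - conn_coeff c \<gamma> t (chart_components M c (\<gamma> t) (Y t))) (at t)"
proof -
  define y where "y = (\<lambda>s. chart_components M c (\<gamma> s) (Y s))"
  define d where "d = chart_at M (\<gamma> t)"
  have d: "d \<in> atlas M" "\<gamma> t \<in> chart_dom d" using chart_at in_pts c t by (auto simp: d_def)
  define z where "z = chart_components_along M \<gamma> Y t"
  have z: "z differentiable (at t)" using Y t by (simp add: parallel_along_def z_def)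
  let ?T = "\<lambda>b x. frechet_derivative (chart_map c \<circ> chart_inv d) (at x) b"
  let ?S = "{s \<in> I. \<gamma> s \<in> chart_dom c \<inter> chart_dom d}"
  have S: "open ?S" "t \<in> ?S"
    using open_curve_preimage[OF \<gamma> open_Int[OF open_chart_dom open_chart_dom]] is_chart c d t by auto
  have "(\<lambda>s. \<Sum>b\<in>Basis. (z s \<bullet> b) *\<^sub>R ?T b (chart_map d (\<gamma> s))) differentiable (at t)"
  proof (intro differentiable_sum ballI differentiable_scaleR finite_Basis)
    fix b :: 'b
    show "(\<lambda>s. z s \<bullet> b) differentiable (at t)" using z by simp
    have "(\<lambda>s. chart_map d (\<gamma> s)) differentiable (at t)"
      using smooth_on_differentiable[OF curve_in_chart[OF \<gamma> d(1)]] t d by auto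
    moreover have "?T b differentiable (at (chart_map d (\<gamma> t)))"
      using smooth_on_differentiable[OF smooth_on_derivative[OF smooth_transition[OF d(1) c]]] t d by auto
    ultimately show "(\<lambda>s. ?T b (chart_map d (\<gamma> s))) differentiable (at t)"
      using differentiable_chain_at by (fastforce simp: o_def)
  qed
  then obtain D where D: "((\<lambda>s. \<Sum>b\<in>Basis. (z s \<bullet> b) *\<^sub>R ?T b (chart_map d (\<gamma> s))) has_derivative D) (at t)"
    by (auto simp: differentiable_def)
  have "(y has_derivative D) (at t)"
  proof (rule has_derivative_transform_within_open[OF D S])
    fix s
    assume "s \<in> ?S"
    then have s: "\<gamma> s \<in> chart_dom c" "\<gamma> s \<in> chart_dom d" by auto
    have "y s = transition_deriv d c (\<gamma> s) (z s)"
      using chart_components_change[OF d(1) s(2) c s(1), of "Y s"]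
      by (simp add: y_def z_def chart_components_along_def d_def)
    also have "\<dots> = (\<Sum>b\<in>Basis. (z s \<bullet> b) *\<^sub>R ?T b (chart_map d (\<gamma> s)))"
      using linear_basis_expansion[OF linear_transition_deriv[OF d(1) c s(2,1)], of "z s"]
      by (simp add: transition_deriv_def)
    finally show "(\<Sum>b\<in>Basis. (z s \<bullet> b) *\<^sub>R ?T b (chart_map d (\<gamma> s))) = y s" by simp
  qed
  then obtain y' where y': "(y has_vector_derivative y') (at t)"
    using differentiableI vector_derivative_works by blast
  have "chart_components M c (\<gamma> t) (cov_deriv_along M nabla \<gamma> Y t) = y' + conn_coeff c \<gamma> t (y t)"
    by (rule cov_deriv_along_coord(2)[OF \<gamma> c t y' S]) (simp add: y_def c)
  moreover have "cov_deriv_along M nabla \<gamma> Y t = 0" using Y t by (simp add: parallel_along_def)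
  ultimately have "y' = - conn_coeff c \<gamma> t (y t)"
    using linear_0[OF linear_chart_components[OF c t(2)]] by (simp add: eq_neg_iff_add_eq_0)
  then show ?thesis using y' by (simp add: y_def)
qed

lemma field_along_curve:
  assumes \<gamma>: "smooth_curve M I \<gamma>" and c: "c \<in> atlas M" and t: "t \<in> I" "\<gamma> t \<in> chart_dom c"
    and U: "open U" "U \<subseteq> pts M" "\<gamma> t \<in> U" and E: "vector_field M U E"
  shows "((\<lambda>s. chart_components M c (\<gamma> s) (E (\<gamma> s))) has_vector_derivative
      chart_components M c (\<gamma> t) (nabla (\<gamma> t) (velocity M \<gamma> t) E)
      - conn_coeff c \<gamma> t (chart_components M c (\<gamma> t) (E (\<gamma> t)))) (at t)"
proof -
  define y where "y = (\<lambda>s. chart_components M c (\<gamma> s) (E (\<gamma> s)))"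
  have "field_rep M c E differentiable (at (chart_map c (\<gamma> t)))"
    using smooth_on_differentiable[OF vector_field_chartD[OF E c subset_refl]] t U by auto
  moreover have "(\<lambda>s. chart_map c (\<gamma> s)) differentiable (at t)"
    using smooth_on_differentiable[OF curve_in_chart[OF \<gamma> c]] t by auto
  ultimately have "(field_rep M c E \<circ> (\<lambda>s. chart_map c (\<gamma> s))) differentiable (at t)"
    by (intro differentiable_chain_at)
  then obtain D where D: "((field_rep M c E \<circ> (\<lambda>s. chart_map c (\<gamma> s))) has_derivative D) (at t)"
    by (auto simp: differentiable_def)
  have S: "open {s \<in> I. \<gamma> s \<in> chart_dom c}"
    by (rule open_curve_preimage[OF \<gamma> open_chart_dom[OF is_chart[OF c]]])
  have "(y has_derivative D) (at t)"
    by (rule has_derivative_transform_within_open[OF D S])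
      (use t c in \<open>auto simp: field_rep_def inv_map y_def\<close>)
  then obtain y' where y': "(y has_vector_derivative y') (at t)"
    using differentiableI vector_derivative_works by blast
  have "chart_components M c (\<gamma> t) (cov_deriv_along M nabla \<gamma> (\<lambda>s. E (\<gamma> s)) t)
      = y' + conn_coeff c \<gamma> t (y t)"
    by (rule cov_deriv_along_coord(2)[OF \<gamma> c t y' S]) (use t in \<open>auto simp: y_def c\<close>)
  moreover have "cov_deriv_along M nabla \<gamma> (\<lambda>s. E (\<gamma> s)) t = nabla (\<gamma> t) (velocity M \<gamma> t) E"
    using cov_deriv_along_combination(2)[OF \<gamma> t(1), of "{()}" U "\<lambda>_. E" "\<lambda>_ _. 1" "\<lambda>_. 0" UNIV
        "\<lambda>s. E (\<gamma> s)"] U E by simp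
  ultimately have "y' = chart_components M c (\<gamma> t) (nabla (\<gamma> t) (velocity M \<gamma> t) E) - conn_coeff c \<gamma> t (y t)"
    by simp
  then show ?thesis using y' by (simp add: y_def)
qed

lemma inj_coord_field: "c \<in> atlas M \<Longrightarrow> p \<in> chart_dom c \<Longrightarrow> inj (\<lambda>w. coord_field M c w p)"
  by (rule inj_on_inverseI[of _ "chart_components M c p"]) simp

lemma inj_chart_components: "c \<in> atlas M \<Longrightarrow> p \<in> chart_dom c \<Longrightarrow> inj (chart_components M c p)"
  by (rule inj_on_inverseI[of _ "\<lambda>w. coord_field M c w p"]) simp

lemma chart_components_in_span_iff:
  assumes "c \<in> atlas M" "p \<in> chart_dom c"
  shows "chart_components M c p w \<in> span {chart_components M c p u, chart_components M c p v}
    \<longleftrightarrow> w \<in> span {u, v}"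
  using linear_span_image[OF linear_chart_components[OF assms], of "{u, v}"]
    inj_image_mem_iff[OF inj_chart_components[OF assms]] by simp

lemma smooth_curve_chart_line:
  assumes c: "c \<in> atlas M" and I: "open I" "is_interval I"
    and line: "\<And>s. s \<in> I \<Longrightarrow> x + s *\<^sub>R v \<in> chart_map c ` chart_dom c"
  shows "smooth_curve M I (\<lambda>s. chart_inv c (x + s *\<^sub>R v))"
proof -
  let ?\<gamma> = "\<lambda>s. chart_inv c (x + s *\<^sub>R v)"
  have dom: "?\<gamma> s \<in> chart_dom c" "chart_map c (?\<gamma> s) = x + s *\<^sub>R v" if "s \<in> I" for s
  proof -
    obtain q where q: "x + s *\<^sub>R v = chart_map c q" "q \<in> chart_dom c"
      using line \<open>s \<in> I\<close> by blast
    show "?\<gamma> s \<in> chart_dom c" "chart_map c (?\<gamma> s) = x + s *\<^sub>R v"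
      unfolding q(1) using q(2) by (simp_all add: inv_map c)
  qed
  have "continuous_on (chart_map c ` chart_dom c) (chart_inv c)"
    using is_chart[OF c] unfolding is_chart_def homeomorphism_def by blast
  then have cont: "continuous_on I ?\<gamma>"
    by (rule continuous_on_compose2) (use line in \<open>auto intro!: continuous_intros\<close>)
  have "smooth_on (\<lambda>s. chart_map d (?\<gamma> s)) {s \<in> I. ?\<gamma> s \<in> chart_dom d}" if d: "d \<in> atlas M" for d
  proof -
    have O: "open {s \<in> I. ?\<gamma> s \<in> chart_dom d}"
      using continuous_on_open_vimage[OF I(1), of ?\<gamma>] cont open_chart_dom[OF is_chart[OF d]]
      by (auto simp: vimage_def Int_def conj_commute)
    have l: "smooth_on (\<lambda>s. x + s *\<^sub>R v) {s \<in> I. ?\<gamma> s \<in> chart_dom d}"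
      by (intro smooth_on_add smooth_on_const smooth_on_linear bounded_linear_scaleR_left O)
    have "smooth_on (\<lambda>s. (chart_map d \<circ> chart_inv c) (x + s *\<^sub>R v)) {s \<in> I. ?\<gamma> s \<in> chart_dom d}"
    proof (rule smooth_on_compose[OF smooth_transition[OF c d] l O], rule image_subsetI)
      fix s
      assume "s \<in> {s \<in> I. ?\<gamma> s \<in> chart_dom d}"
      then show "x + s *\<^sub>R v \<in> chart_map c ` (chart_dom c \<inter> chart_dom d)"
        using dom[of s] by (intro rev_image_eqI[of "?\<gamma> s"]) auto
    qed
    then show ?thesis by simp
  qed
  then show ?thesis using I cont dom(1) in_pts[OF c] by (auto simp: smooth_curve_def)
qed

text \<open>Invariance under parallel transport is turned into an infinitesimal statement: a basis of
  \<open>N p\<close> extended by parallel transport along a curve through \<open>p\<close> with velocity \<open>v\<close>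
  remains a basis of \<open>N\<close>, and in the expansion of \<open>E\<close> in this basis only the coefficients
  contribute to \<open>\<nabla>\<^sub>v E\<close>.\<close>

lemma nabla_in_parallel_distribution:
  assumes N: "subbundle M 2 N" "parallel_distribution M nabla N"
    and U: "open U" "U \<subseteq> pts M" and E: "vector_field M U E" "\<And>q. q \<in> U \<Longrightarrow> E q \<in> N q"
    and p: "p \<in> U"
  shows "nabla p v E \<in> N p"
proof -
  have P: "p \<in> pts M" using U p by auto
  define c where "c = chart_at M p"
  have c: "c \<in> atlas M" "p \<in> chart_dom c" using chart_at[OF P] by (auto simp: c_def)
  define x where "x = chart_map c p"
  have "open (chart_map c ` (chart_dom c \<inter> U))" "x \<in> chart_map c ` (chart_dom c \<inter> U)"
    using open_image[OF U(1) c(1)] c p by (auto simp: x_def)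
  then obtain \<epsilon> where \<epsilon>: "\<epsilon> > 0" "ball x \<epsilon> \<subseteq> chart_map c ` (chart_dom c \<inter> U)"
    using open_contains_ball by blast
  \<comment> \<open>The coordinate line \<open>x + s *\<^sub>R v\<close> stays in the ball for \<open>\<bar>s\<bar> < 2 * a\<close>; the
    differential equation is solved on the compact interval up to \<open>a\<close>.\<close>
  define a where "a = \<epsilon> / (2 * (norm v + 1))"
  have n: "norm v + 1 > 0" using norm_ge_zero[of v] by linarith
  have a: "a > 0" "2 * a * (norm v + 1) = \<epsilon>" using \<epsilon>(1) n by (auto simp: a_def field_simps)
  have line: "x + s *\<^sub>R v \<in> chart_map c ` (chart_dom c \<inter> U)" if "\<bar>s\<bar> < 2 * a" for s
  proof -
    have "\<bar>s\<bar> * norm v \<le> \<bar>s\<bar> * (norm v + 1)" by (intro mult_left_mono) auto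
    also have "\<dots> < 2 * a * (norm v + 1)" using that n by (intro mult_strict_right_mono) auto
    finally show ?thesis using \<epsilon>(2) a(2) by (auto simp: dist_norm)
  qed
  define \<gamma> where "\<gamma> = (\<lambda>s. chart_inv c (x + s *\<^sub>R v))"
  have \<gamma>s: "\<gamma> s \<in> chart_dom c" "\<gamma> s \<in> U" "chart_map c (\<gamma> s) = x + s *\<^sub>R v" if "\<bar>s\<bar> < 2 * a" for s
  proof -
    obtain q where q: "x + s *\<^sub>R v = chart_map c q" "q \<in> chart_dom c" "q \<in> U"
      using line[OF \<open>\<bar>s\<bar> < 2 * a\<close>] by blast
    show "\<gamma> s \<in> chart_dom c" "\<gamma> s \<in> U" "chart_map c (\<gamma> s) = x + s *\<^sub>R v"
      unfolding \<gamma>_def q(1) using q(2,3) by (simp_all add: inv_map c)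
  qed
  have \<gamma>0: "\<gamma> 0 = p" using c by (simp add: \<gamma>_def x_def inv_map)
  have curve: "smooth_curve M {-r<..<r} \<gamma>" if "r \<le> 2 * a" for r
    unfolding \<gamma>_def
    by (rule smooth_curve_chart_line[OF c(1)]) (use line that in \<open>force simp: is_interval_oo\<close>)+
  note curve2 = curve[OF order_refl]
  have "((\<lambda>s. x + s *\<^sub>R v) has_vector_derivative v) (at 0)"
    by (auto intro!: derivative_eq_intros)
  then have "((\<lambda>s. chart_map c (\<gamma> s)) has_vector_derivative v) (at 0)"
    by (rule has_vector_derivative_transform_within_open[of _ _ _ "{-2*a<..<2*a}"])
      (use a \<gamma>s(3) in auto)
  then have vel: "velocity M \<gamma> 0 = v"
    by (simp add: velocity_def \<gamma>0 vector_derivative_at flip: c_def)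
  have linA: "linear (\<lambda>w. - conn_coeff c \<gamma> s w)" if "s \<in> {-a..a}" for s
    using linear_compose_neg[OF linear_conn_coeff[of c \<gamma> s, OF c(1) \<gamma>s(1)]] that a by auto
  have contA: "continuous_on {-a..a} (\<lambda>s. - conn_coeff c \<gamma> s w)" for w
    by (intro continuous_on_minus continuous_on_subset[OF continuous_on_conn_coeff[OF curve2 c(1)]])
      (use \<gamma>s(1) a in auto)
  obtain \<delta> where \<delta>: "\<delta> > 0" "\<delta> \<le> a" and ode: "\<And>y0. \<exists>y. y 0 = y0 \<and>
      (\<forall>s\<in>{-\<delta><..<\<delta>}. (y has_vector_derivative - conn_coeff c \<gamma> s (y s)) (at s))"
    using linear_ode_exists[OF a(1) linA contA] by metis
  have smallI: "s \<in> {-\<delta><..<\<delta>} \<Longrightarrow> \<bar>s\<bar> < 2 * a" for s using \<delta> by auto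
  have curve\<delta>: "smooth_curve M {-\<delta><..<\<delta>} \<gamma>" by (rule curve) (use \<delta> in auto)
  have transport: "\<exists>y. y 0 = e \<and> (y has_vector_derivative - conn_coeff c \<gamma> 0 e) (at 0)
      \<and> (\<forall>s\<in>{-\<delta><..<\<delta>}. coord_field M c (y s) (\<gamma> s) \<in> N (\<gamma> s))" if e: "e \<in> N p" for e
  proof -
    obtain y where y: "y 0 = e"
      "\<And>s. s \<in> {-\<delta><..<\<delta>} \<Longrightarrow> (y has_vector_derivative - conn_coeff c \<gamma> s (y s)) (at s)"
      using ode by blast
    let ?P = "\<lambda>s. coord_field M c (y s) (\<gamma> s)"
    have "parallel_along M nabla {-\<delta><..<\<delta>} \<gamma> ?P"
      unfolding parallel_along_def
    proof (intro ballI conjI)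
      fix t
      assume t: "t \<in> {-\<delta><..<\<delta>}"
      note tc = \<gamma>s(1)[OF smallI[OF t]]
      note cd = cov_deriv_along_coord[OF curve\<delta> c(1) t tc y(2)[OF t] open_UNIV UNIV_I refl]
      show "chart_components_along M \<gamma> ?P t differentiable (at t)" by (rule cd(1))
      have "chart_components M c (\<gamma> t) (cov_deriv_along M nabla \<gamma> ?P t) = 0"
        using cd(2) by simp
      then show "cov_deriv_along M nabla \<gamma> ?P t = 0"
        using chart_components_eq_iff[OF c(1) tc] linear_0[OF linear_chart_components[OF c(1) tc]]
        by metis
    qed
    moreover have "?P 0 \<in> N (\<gamma> 0)"
      using e coord_field_self[OF P] by (simp add: y(1) \<gamma>0 c_def)
    moreover have "0 \<in> {-\<delta><..<\<delta>}" using \<delta> by simp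
    ultimately have "?P s \<in> N (\<gamma> s)" if "s \<in> {-\<delta><..<\<delta>}" for s
      using N(2) curve\<delta> that unfolding parallel_distribution_def by blast
    moreover have "(y has_vector_derivative - conn_coeff c \<gamma> 0 e) (at 0)"
      using y(2)[of 0] y(1) \<delta> by simp
    ultimately show ?thesis using y(1) by blast
  qed
  have frame: "\<exists>e0 e1. N q = span {e0, e1} \<and> dim (N q) = 2" if q: "q \<in> pts M" for q
  proof -
    obtain W and F :: "nat \<Rightarrow> 'a \<Rightarrow> 'b" where F: "q \<in> W"
      "\<And>q. q \<in> W \<Longrightarrow> N q = span ((\<lambda>i. F i q) ` {..<2}) \<and> dim (N q) = 2"
      using N(1) q unfolding subbundle_def by metis
    have "(\<lambda>i. F i q) ` {..<2} = {F 0 q, F 1 q}" by (auto simp: less_2_cases_iff)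
    then show ?thesis using F(2)[OF F(1)] by auto
  qed
  obtain e0 e1 where e: "N p = span {e0, e1}" "dim (N p) = 2" using frame[OF P] by blast
  have eN: "e0 \<in> N p" "e1 \<in> N p" by (auto simp: e(1) intro: span_base)
  obtain y0 where y0: "y0 0 = e0" "(y0 has_vector_derivative - conn_coeff c \<gamma> 0 e0) (at 0)"
      "\<And>s. s \<in> {-\<delta><..<\<delta>} \<Longrightarrow> coord_field M c (y0 s) (\<gamma> s) \<in> N (\<gamma> s)"
    using transport[OF eN(1)] by blast
  obtain y1 where y1: "y1 0 = e1" "(y1 has_vector_derivative - conn_coeff c \<gamma> 0 e1) (at 0)"
      "\<And>s. s \<in> {-\<delta><..<\<delta>} \<Longrightarrow> coord_field M c (y1 s) (\<gamma> s) \<in> N (\<gamma> s)"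
    using transport[OF eN(2)] by blast
  have g0: "gram (y0 0) (y1 0) \<noteq> 0"
    using e independent_pair_iff_dim[of e0 e1] by (simp add: y0(1) y1(1) flip: independent_pair_iff_gram)
  have "continuous (at 0) (\<lambda>s. gram (y0 s) (y1 s))"
    using has_vector_derivative_continuous[OF y0(2)] has_vector_derivative_continuous[OF y1(2)]
    unfolding gram_def by (intro continuous_intros)
  from continuous_at_avoid[OF this g0] obtain \<eta> where
    \<eta>: "\<eta> > 0" "\<And>s. \<bar>s\<bar> < \<eta> \<Longrightarrow> gram (y0 s) (y1 s) \<noteq> 0"
    by (auto simp: dist_real_def)
  let ?S = "{-\<delta><..<\<delta>} \<inter> {-\<eta><..<\<eta>}"
  have S: "open ?S" "0 \<in> ?S" using \<delta> \<eta> by auto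
  define z where "z = (\<lambda>s. chart_components M c (\<gamma> s) (E (\<gamma> s)))"
  have zspan: "z s = proj_coeff (y0 s) (y1 s) (z s) *\<^sub>R y0 s + proj_coeff (y1 s) (y0 s) (z s) *\<^sub>R y1 s"
    if s: "s \<in> ?S" for s
  proof -
    have sa: "\<bar>s\<bar> < 2 * a" and s\<delta>: "s \<in> {-\<delta><..<\<delta>}" using s smallI by auto
    have g: "gram (y0 s) (y1 s) \<noteq> 0" using s \<eta> by auto
    note cs = \<gamma>s(1)[OF sa]
    let ?P0 = "coord_field M c (y0 s) (\<gamma> s)" and ?P1 = "coord_field M c (y1 s) (\<gamma> s)"
    have "independent_pair ?P0 ?P1"
      using independent_pair_linear_image[OF linear_coord_field[OF c(1) cs] inj_coord_field[OF c(1) cs]] g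
      by (simp add: independent_pair_iff_gram)
    then have d: "dim (span {?P0, ?P1}) = 2" by (simp add: independent_pair_iff_dim)
    obtain f0 f1 where f: "N (\<gamma> s) = span {f0, f1}" "dim (N (\<gamma> s)) = 2"
      using frame[OF subsetD[OF U(2) \<gamma>s(2)[OF sa]]] by blast
    have "span {?P0, ?P1} \<subseteq> N (\<gamma> s)"
      using y0(3)[OF s\<delta>] y1(3)[OF s\<delta>] by (intro span_minimal) (auto simp: f(1))
    then have "span {?P0, ?P1} = N (\<gamma> s)"
      using subspace_dim_equal[of "span {?P0, ?P1}" "N (\<gamma> s)"] d f by auto
    then have "E (\<gamma> s) \<in> span {?P0, ?P1}" using E(2)[OF \<gamma>s(2)[OF sa]] by simp
    then have "z s \<in> span {y0 s, y1 s}"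
      using chart_components_in_span_iff[OF c(1) cs, of "E (\<gamma> s)" ?P0 ?P1] c cs by (simp add: z_def)
    then show ?thesis using proj_rest_eq_0_iff[OF g] by (simp add: proj_rest_def)
  qed
  have z': "(z has_vector_derivative nabla p v E - conn_coeff c \<gamma> 0 (z 0)) (at 0)"
    using field_along_curve[OF curve\<delta> c(1) _ _ U _ E(1), of 0] c p \<delta> chart_components_self[OF P]
    by (simp add: \<gamma>0 vel z_def c_def)
  have diff: "y0 differentiable (at 0)" "y1 differentiable (at 0)" "z differentiable (at 0)"
    using y0(2) y1(2) z' by (auto simp: has_vector_derivative_def differentiable_def)
  have g0': "gram (y1 0) (y0 0) \<noteq> 0" using g0 gram_commute by metis
  obtain k0 where k0: "((\<lambda>s. proj_coeff (y0 s) (y1 s) (z s)) has_real_derivative k0) (at 0)"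
    using proj_coeff_differentiable[OF diff g0] real_differentiable_def by blast
  obtain k1 where k1: "((\<lambda>s. proj_coeff (y1 s) (y0 s) (z s)) has_real_derivative k1) (at 0)"
    using proj_coeff_differentiable[OF diff(2,1,3) g0'] real_differentiable_def by blast
  let ?c0 = "proj_coeff (y0 0) (y1 0) (z 0)" and ?c1 = "proj_coeff (y1 0) (y0 0) (z 0)"
  have "((\<lambda>s. proj_coeff (y0 s) (y1 s) (z s) *\<^sub>R y0 s + proj_coeff (y1 s) (y0 s) (z s) *\<^sub>R y1 s)
      has_vector_derivative ?c0 *\<^sub>R (- conn_coeff c \<gamma> 0 e0) + k0 *\<^sub>R y0 0
        + (?c1 *\<^sub>R (- conn_coeff c \<gamma> 0 e1) + k1 *\<^sub>R y1 0)) (at 0)"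
    by (intro has_vector_derivative_add has_vector_derivative_scaleR k0 k1 y0 y1)
  then have "(z has_vector_derivative ?c0 *\<^sub>R (- conn_coeff c \<gamma> 0 e0) + k0 *\<^sub>R y0 0
        + (?c1 *\<^sub>R (- conn_coeff c \<gamma> 0 e1) + k1 *\<^sub>R y1 0)) (at 0)"
    by (rule has_vector_derivative_transform_within_open[OF _ S zspan[symmetric]])
  from vector_derivative_unique_at[OF z' this]
  have "nabla p v E = conn_coeff c \<gamma> 0 (z 0) + ?c0 *\<^sub>R (- conn_coeff c \<gamma> 0 e0) + k0 *\<^sub>R e0
        + (?c1 *\<^sub>R (- conn_coeff c \<gamma> 0 e1) + k1 *\<^sub>R e1)"
    by (simp add: algebra_simps y0(1) y1(1))
  moreover have lin0: "linear (conn_coeff c \<gamma> 0)"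
    by (rule linear_conn_coeff) (use c \<gamma>0 in auto)
  have "conn_coeff c \<gamma> 0 (z 0) = conn_coeff c \<gamma> 0 (?c0 *\<^sub>R e0 + ?c1 *\<^sub>R e1)"
    using zspan[OF S(2)] by (simp add: y0(1) y1(1))
  then have "conn_coeff c \<gamma> 0 (z 0) = ?c0 *\<^sub>R conn_coeff c \<gamma> 0 e0 + ?c1 *\<^sub>R conn_coeff c \<gamma> 0 e1"
    by (simp only: linear_add[OF lin0] linear_cmul[OF lin0])
  ultimately have "nabla p v E = k0 *\<^sub>R e0 + k1 *\<^sub>R e1" by simp
  then show ?thesis unfolding e(1) span_pair by blast
qed

text \<open>Conversely, let \<open>u\<close> be the component of a parallel field orthogonal to the plane, in the
  Euclidean inner product of a chart. Because the plane field is preserved by \<open>\<nabla>\<close>, up to terms in the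
  plane \<open>u\<close> solves the equation of parallel transport, so that \<open>\<bar>u\<bar>\<^sup>2\<close> satisfies a
  linear differential inequality and vanishes as soon as it vanishes once.\<close>

lemma parallel_distribution_span:
  assumes E: "vector_field M (pts M) E0" "vector_field M (pts M) E1"
    and ind: "\<And>q. q \<in> pts M \<Longrightarrow> independent_pair (E0 q) (E1 q)"
    and nab: "\<And>q x. q \<in> pts M \<Longrightarrow> nabla q x E0 \<in> span {E0 q, E1 q}"
      "\<And>q x. q \<in> pts M \<Longrightarrow> nabla q x E1 \<in> span {E0 q, E1 q}"
  shows "parallel_distribution M nabla (\<lambda>q. span {E0 q, E1 q})"
  unfolding parallel_distribution_def
proof (intro allI impI ballI)
  fix I \<gamma> Y s t
  assume "smooth_curve M I \<gamma> \<and> parallel_along M nabla I \<gamma> Y"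
  then have \<gamma>: "smooth_curve M I \<gamma>" and Y: "parallel_along M nabla I \<gamma> Y" by auto
  assume s: "s \<in> I" and t: "t \<in> I" and start: "Y s \<in> span {E0 (\<gamma> s), E1 (\<gamma> s)}"
  define in_plane where "in_plane r \<longleftrightarrow> Y r \<in> span {E0 (\<gamma> r), E1 (\<gamma> r)}" for r
  have I: "open I" "connected I" using \<gamma> is_interval_connected by (auto simp: smooth_curve_def)
  have "in_plane s = in_plane t"
  proof (rule connected_local_const[OF I(2) s t], rule ballI)
    fix t0
    assume t0: "t0 \<in> I"
    then have P: "\<gamma> t0 \<in> pts M" using \<gamma> by (auto simp: smooth_curve_def)
    define c where "c = chart_at M (\<gamma> t0)"
    have c: "c \<in> atlas M" "\<gamma> t0 \<in> chart_dom c" using chart_at[OF P] by (auto simp: c_def)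
    let ?J = "{r \<in> I. \<gamma> r \<in> chart_dom c}"
    have "open ?J" by (rule open_curve_preimage[OF \<gamma> open_chart_dom[OF is_chart[OF c(1)]]])
    then obtain \<epsilon> where \<epsilon>: "\<epsilon> > 0" "cball t0 \<epsilon> \<subseteq> ?J" using t0 c open_contains_cball by blast
    have K: "{t0-\<epsilon>..t0+\<epsilon>} \<subseteq> ?J" using \<epsilon>(2) by (simp add: cball_eq_atLeastAtMost)
    let ?\<Gamma> = "conn_coeff c \<gamma>"
    obtain k where k: "\<And>r w. r \<in> {t0-\<epsilon>..t0+\<epsilon>} \<Longrightarrow> norm (?\<Gamma> r w) \<le> k * norm w"
    proof (rule linear_family_bound[of "{t0-\<epsilon>..t0+\<epsilon>}" ?\<Gamma>])
      show "linear (?\<Gamma> r)" if "r \<in> {t0-\<epsilon>..t0+\<epsilon>}" for r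
        by (rule linear_conn_coeff[OF c(1)]) (use that K in auto)
      show "continuous_on {t0-\<epsilon>..t0+\<epsilon>} (\<lambda>r. ?\<Gamma> r w)" for w
        by (rule continuous_on_subset[OF continuous_on_conn_coeff[OF \<gamma> c(1)] K])
    qed auto
    define y where "y = (\<lambda>r. chart_components M c (\<gamma> r) (Y r))"
    define e0 where "e0 = (\<lambda>r. chart_components M c (\<gamma> r) (E0 (\<gamma> r)))"
    define e1 where "e1 = (\<lambda>r. chart_components M c (\<gamma> r) (E1 (\<gamma> r)))"
    define u where "u = (\<lambda>r. proj_rest (e0 r) (e1 r) (y r))"
    have facts: "gram (e0 r) (e1 r) \<noteq> 0 \<and> (in_plane r \<longleftrightarrow> u r \<bullet> u r = 0)
        \<and> ((\<lambda>r. u r \<bullet> u r) has_real_derivative - 2 * (u r \<bullet> ?\<Gamma> r (u r))) (at r)"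
      if r: "r \<in> {t0-\<epsilon>..t0+\<epsilon>}" for r
    proof -
      have rI: "r \<in> I" and rc: "\<gamma> r \<in> chart_dom c" using r K by auto
      have rP: "\<gamma> r \<in> pts M" using in_pts[OF c(1) rc] .
      let ?L = "chart_components M c (\<gamma> r)" and ?v = "velocity M \<gamma> r"
      have "independent_pair (e0 r) (e1 r)"
        unfolding e0_def e1_def
        by (rule independent_pair_linear_image[OF linear_chart_components[OF c(1) rc]
              inj_chart_components[OF c(1) rc] ind[OF rP]])
      then have g: "gram (e0 r) (e1 r) \<noteq> 0" by (simp add: independent_pair_iff_gram)
      have "in_plane r \<longleftrightarrow> y r \<in> span {e0 r, e1 r}"
        unfolding y_def e0_def e1_def chart_components_in_span_iff[OF c(1) rc] in_plane_def ..
      then have iff: "in_plane r \<longleftrightarrow> u r \<bullet> u r = 0"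
        using proj_rest_eq_0_iff[OF g] by (simp add: u_def)
      have n: "?L (nabla (\<gamma> r) ?v E0) \<in> span {e0 r, e1 r}" "?L (nabla (\<gamma> r) ?v E1) \<in> span {e0 r, e1 r}"
        unfolding e0_def e1_def chart_components_in_span_iff[OF c(1) rc] using nab[OF rP] by auto
      note fc = field_along_curve[OF \<gamma> c(1) rI rc open_pts order_refl rP]
      have y': "(y has_vector_derivative - ?\<Gamma> r (y r)) (at r)"
        unfolding y_def by (rule parallel_components[OF \<gamma> c(1) rI rc Y])
      have e0': "(e0 has_vector_derivative ?L (nabla (\<gamma> r) ?v E0) - ?\<Gamma> r (e0 r)) (at r)"
        unfolding e0_def by (rule fc[OF E(1)])
      have e1': "(e1 has_vector_derivative ?L (nabla (\<gamma> r) ?v E1) - ?\<Gamma> r (e1 r)) (at r)"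
        unfolding e1_def by (rule fc[OF E(2)])
      have diff: "y differentiable (at r)" "e0 differentiable (at r)" "e1 differentiable (at r)"
        using y' e0' e1' by (auto simp: has_vector_derivative_def differentiable_def)
      have g': "gram (e1 r) (e0 r) \<noteq> 0" using g gram_commute by metis
      obtain k0 where k0: "((\<lambda>r. proj_coeff (e0 r) (e1 r) (y r)) has_real_derivative k0) (at r)"
        using proj_coeff_differentiable[OF diff(2,3,1) g] real_differentiable_def by blast
      obtain k1 where k1: "((\<lambda>r. proj_coeff (e1 r) (e0 r) (y r)) has_real_derivative k1) (at r)"
        using proj_coeff_differentiable[OF diff(3,2,1) g'] real_differentiable_def by blast
      let ?c0 = "proj_coeff (e0 r) (e1 r) (y r)" and ?c1 = "proj_coeff (e1 r) (e0 r) (y r)"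
      let ?n0 = "?L (nabla (\<gamma> r) ?v E0)" and ?n1 = "?L (nabla (\<gamma> r) ?v E1)"
      \<comment> \<open>\<open>m\<close> lies in the plane, to which \<open>u r\<close> is orthogonal.\<close>
      define m where "m = ?c0 *\<^sub>R ?n0 + k0 *\<^sub>R e0 r + (?c1 *\<^sub>R ?n1 + k1 *\<^sub>R e1 r)"
      have "(u has_vector_derivative - ?\<Gamma> r (y r) -
          (?c0 *\<^sub>R (?n0 - ?\<Gamma> r (e0 r)) + k0 *\<^sub>R e0 r + (?c1 *\<^sub>R (?n1 - ?\<Gamma> r (e1 r)) + k1 *\<^sub>R e1 r))) (at r)"
        unfolding u_def proj_rest_def
        by (intro has_vector_derivative_diff has_vector_derivative_add has_vector_derivative_scaleR
            k0 k1 y' e0' e1')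
      moreover have lin: "linear (?\<Gamma> r)" by (rule linear_conn_coeff) (fact c(1) rc)+
      have "?\<Gamma> r (u r) = ?\<Gamma> r (y r) - (?c0 *\<^sub>R ?\<Gamma> r (e0 r) + ?c1 *\<^sub>R ?\<Gamma> r (e1 r))"
        unfolding u_def proj_rest_def
        by (simp only: linear_diff[OF lin] linear_add[OF lin] linear_cmul[OF lin])
      then have "- ?\<Gamma> r (y r) -
          (?c0 *\<^sub>R (?n0 - ?\<Gamma> r (e0 r)) + k0 *\<^sub>R e0 r + (?c1 *\<^sub>R (?n1 - ?\<Gamma> r (e1 r)) + k1 *\<^sub>R e1 r))
          = - ?\<Gamma> r (u r) - m"
        by (simp add: m_def algebra_simps)
      ultimately have u': "(u has_vector_derivative - ?\<Gamma> r (u r) - m) (at r)" by simp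
      have "m \<in> span {e0 r, e1 r}"
        unfolding m_def by (intro span_add span_scale n) (auto intro: span_base)
      then obtain a b where "m = a *\<^sub>R e0 r + b *\<^sub>R e1 r" unfolding span_pair by blast
      then have um: "u r \<bullet> m = 0"
        using proj_rest_orthogonal[OF g, of "y r"] by (simp add: u_def inner_simps)
      have "((\<lambda>r. u r \<bullet> u r) has_vector_derivative u r \<bullet> (- ?\<Gamma> r (u r) - m) + (- ?\<Gamma> r (u r) - m) \<bullet> u r) (at r)"
        by (rule bounded_bilinear.has_vector_derivative[OF bounded_bilinear_inner u' u'])
      then have "((\<lambda>r. u r \<bullet> u r) has_real_derivative - 2 * (u r \<bullet> ?\<Gamma> r (u r))) (at r)"
        using um by (simp add: has_real_derivative_iff_has_vector_derivative inner_simps inner_commute)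
      then show ?thesis using g iff by blast
    qed
    have bound: "\<bar>- 2 * (u r \<bullet> ?\<Gamma> r (u r))\<bar> \<le> (2 * k) * (u r \<bullet> u r)" if "r \<in> {t0-\<epsilon>..t0+\<epsilon>}" for r
    proof -
      have "\<bar>u r \<bullet> ?\<Gamma> r (u r)\<bar> \<le> norm (u r) * norm (?\<Gamma> r (u r))" by (rule Cauchy_Schwarz_ineq2)
      also have "\<dots> \<le> norm (u r) * (k * norm (u r))" by (intro mult_left_mono k that) auto
      finally show ?thesis by (simp add: abs_mult power2_norm_eq_inner[symmetric] power2_eq_square ac_simps)
    qed
    have same: "in_plane r \<Longrightarrow> in_plane r'"
      if "r \<in> {t0-\<epsilon>..t0+\<epsilon>}" "r' \<in> {t0-\<epsilon>..t0+\<epsilon>}" for r r'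
    proof -
      assume "in_plane r"
      then have "u r \<bullet> u r = 0" using facts[OF that(1)] by blast
      have deriv: "((\<lambda>r. u r \<bullet> u r) has_real_derivative - 2 * (u q \<bullet> ?\<Gamma> q (u q))) (at q)"
        if "q \<in> {t0-\<epsilon>..t0+\<epsilon>}" for q
        using facts[OF that] by blast
      have "u r' \<bullet> u r' = 0"
        by (rule gronwall_zero[OF deriv bound inner_ge_zero that(1) \<open>u r \<bullet> u r = 0\<close> that(2)])
      then show "in_plane r'" using facts[OF that(2)] by blast
    qed
    show "\<forall>\<^sub>F r in at t0 within I. in_plane t0 = in_plane r"
      unfolding eventually_at_topological
    proof (rule exI[of _ "ball t0 \<epsilon>"], intro conjI ballI impI)
      fix r
      assume "r \<in> ball t0 \<epsilon>"
      then have "r \<in> {t0-\<epsilon>..t0+\<epsilon>}" "t0 \<in> {t0-\<epsilon>..t0+\<epsilon>}"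
        using \<epsilon>(1) by (auto simp: ball_eq_greaterThanLessThan)
      then show "in_plane t0 = in_plane r" using same by blast
    qed (use \<epsilon>(1) in auto)
  qed
  then show "Y t \<in> span {E0 (\<gamma> t), E1 (\<gamma> t)}" using start by (simp add: in_plane_def)
qed

end

section \<open>The cone as a manifold\<close>

lemma chart_dom_cone [simp]: "chart_dom (cone_chart c) = {0<..} \<times> chart_dom c"
  by (simp add: cone_chart_def)

lemma chart_map_cone [simp]: "chart_map (cone_chart c) (r, p) = (r, chart_map c p)"
  by (simp add: cone_chart_def)

lemma chart_map_cone_image:
  "chart_map (cone_chart c) ` ({0<..} \<times> W) = {0<..} \<times> chart_map c ` W"
  by (force simp: cone_chart_def)

lemma atlas_cone: "atlas (cone_manifold M) = cone_chart ` atlas M"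
  and chart_at_cone: "chart_at (cone_manifold M) (r, p) = cone_chart (chart_at M p)"
  by (simp_all add: cone_manifold_def)

lemma cone_lift_apply: "cone_lift X (r, p) = (0, X p)"
  and euler_field_apply: "euler_field (r, p) = (r, 0)"
  by (simp_all add: cone_lift_def euler_field_def)

lemma pts_cone: "pts (cone_manifold M) = {0<..} \<times> pts M"
  by (auto simp: pts_def atlas_cone)

lemma smooth_on_cone:
  fixes f :: "'c::euclidean_space \<Rightarrow> 'd::real_normed_vector"
  assumes "smooth_on f S" "open S"
  shows "smooth_on (\<lambda>q. f (snd q)) ({0<..} \<times> S :: (real \<times> 'c) set)"
  by (rule smooth_on_compose[OF assms(1) smooth_on_linear[OF bounded_linear_snd]])
    (use assms in \<open>auto intro: open_Times\<close>)

lemma cone_image: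
  "chart_map (cone_chart c) ` (chart_dom (cone_chart c) \<inter> {0<..} \<times> U)
    = {0<..} \<times> chart_map c ` (chart_dom c \<inter> U)"
  by (simp add: Times_Int_Times chart_map_cone_image)

context smooth_mfd
begin

lemma chart_inv_cone:
  assumes c: "c \<in> atlas M" and x: "r > 0" "x \<in> chart_map c ` chart_dom c"
  shows "chart_inv (cone_chart c) (r, x) = (r, chart_inv c x)"
proof -
  have inj: "inj_on (chart_map (cone_chart c)) (chart_dom (cone_chart c))"
    by (rule inj_on_inverseI[of _ "\<lambda>(r, x). (r, chart_inv c x)"]) (auto simp: inv_map c)
  show ?thesis
    unfolding chart_inv_def[of "cone_chart c"]
    by (rule inv_into_f_eq[OF inj]) (use x c in \<open>auto simp: inv_map\<close>)
qed

lemma is_chart_cone: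
  assumes c: "c \<in> atlas M"
  shows "is_chart (cone_chart c)"
proof -
  let ?T = "{0<..} \<times> chart_map c ` chart_dom c"
  have im: "chart_map (cone_chart c) ` chart_dom (cone_chart c) = ?T"
    by (simp add: chart_map_cone_image)
  have open_im: "open (chart_map c ` chart_dom c)"
    using open_chart_image_subset[OF is_chart[OF c] open_chart_dom[OF is_chart[OF c]]] by simp
  have inv: "continuous_on (chart_map c ` chart_dom c) (chart_inv c)"
    using is_chart[OF c] unfolding is_chart_def homeomorphism_def by blast
  have "homeomorphism (chart_dom (cone_chart c)) ?T (chart_map (cone_chart c)) (chart_inv (cone_chart c))"
  proof (rule homeomorphismI)
    have "continuous_on ({0<..} \<times> chart_dom c) (\<lambda>q. (fst q :: real, chart_map c (snd q)))"
      by (intro continuous_on_Pair continuous_on_fst continuous_on_id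
          continuous_on_compose2[OF continuous_on_chart_map[OF is_chart[OF c]]] continuous_on_snd) auto
    then show "continuous_on (chart_dom (cone_chart c)) (chart_map (cone_chart c))"
      by (simp add: cone_chart_def split_beta')
    have "continuous_on ?T (\<lambda>q. (fst q :: real, chart_inv c (snd q)))"
      by (intro continuous_on_Pair continuous_on_fst continuous_on_id
          continuous_on_compose2[OF inv] continuous_on_snd) auto
    then show "continuous_on ?T (chart_inv (cone_chart c))"
      by (rule continuous_on_eq) (auto simp: chart_inv_cone c)
  qed (auto simp: chart_inv_cone c inv_map)
  then show ?thesis
    using open_im open_chart_dom[OF is_chart[OF c]] im by (simp add: is_chart_def open_Times)
qed

lemma transition_cone:
  assumes "c \<in> atlas M" "r > 0" "x \<in> chart_map c ` (chart_dom c \<inter> chart_dom d)"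
  shows "(chart_map (cone_chart d) \<circ> chart_inv (cone_chart c)) (r, x)
    = (r, (chart_map d \<circ> chart_inv c) x)"
  using chart_inv_cone[OF assms(1,2), of x] assms(3) by auto

lemma smooth_manifold_cone: "smooth_manifold (cone_manifold M)"
  unfolding smooth_manifold_def
proof (intro conjI ballI)
  show "is_chart c" if "c \<in> atlas (cone_manifold M)" for c
    using that is_chart_cone by (auto simp: atlas_cone)
  show "chart_at (cone_manifold M) q \<in> atlas (cone_manifold M)"
    "q \<in> chart_dom (chart_at (cone_manifold M) q)" if "q \<in> pts (cone_manifold M)" for q
    using that chart_at by (auto simp: pts_cone chart_at_cone atlas_cone)
  fix c' d'
  assume "c' \<in> atlas (cone_manifold M)" "d' \<in> atlas (cone_manifold M)"
  then obtain c d where c: "c' = cone_chart c" "c \<in> atlas M" and d: "d' = cone_chart d" "d \<in> atlas M"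
    by (auto simp: atlas_cone)
  let ?S = "chart_map c ` (chart_dom c \<inter> chart_dom d)"
  have im: "chart_map c' ` (chart_dom c' \<inter> chart_dom d') = {0<..} \<times> ?S"
    by (simp add: c d Times_Int_Times chart_map_cone_image)
  have S: "open ?S" using open_chart_image[OF is_chart[OF c(2)] open_chart_dom[OF is_chart[OF d(2)]]] .
  then have O: "open ({0<..} \<times> ?S :: (real \<times> 'b) set)" by (simp add: open_Times)
  have "smooth_on (\<lambda>q. (fst q, (chart_map d \<circ> chart_inv c) (snd q))) ({0<..} \<times> ?S :: (real \<times> 'b) set)"
    by (rule smooth_on_Pair[OF smooth_on_linear[OF bounded_linear_fst]
          smooth_on_cone[OF smooth_transition[OF c(2) d(2)] S] O])
  then show "smooth_on (chart_map d' \<circ> chart_inv c') (chart_map c' ` (chart_dom c' \<inter> chart_dom d'))"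
    unfolding im
  proof (rule smooth_on_cong[OF O])
    show "(fst q, (chart_map d \<circ> chart_inv c) (snd q)) = (chart_map d' \<circ> chart_inv c') q"
      if "q \<in> {0<..} \<times> ?S" for q
      using transition_cone[OF c(2), of "fst q" "snd q" d] that by (auto simp: c(1) d(1))
  qed
qed

lemma transition_deriv_cone:
  assumes c: "c \<in> atlas M" "p \<in> chart_dom c" and d: "d \<in> atlas M" "p \<in> chart_dom d" and r: "r > 0"
  shows "transition_deriv (cone_chart c) (cone_chart d) (r, p) (a, u) = (a, transition_deriv c d p u)"
proof -
  let ?S = "chart_map c ` (chart_dom c \<inter> chart_dom d)"
  have "open ?S" using open_chart_image[OF is_chart[OF c(1)] open_chart_dom[OF is_chart[OF d(1)]]] .
  then have O: "open ({0<..} \<times> ?S :: (real \<times> 'b) set)" by (simp add: open_Times)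
  have "((chart_map d \<circ> chart_inv c) has_derivative transition_deriv c d p) (at (snd (r, chart_map c p)))"
    using has_derivative_transition[OF c(1) d(1) c(2) d(2)] by simp
  from has_derivative_Pair[OF has_derivative_fst[OF has_derivative_ident]
      has_derivative_compose[OF has_derivative_snd[OF has_derivative_ident] this]]
  have "((\<lambda>q. (fst q, (chart_map d \<circ> chart_inv c) (snd q))) has_derivative
      (\<lambda>h. (fst h, transition_deriv c d p (snd h)))) (at (r, chart_map c p))" .
  then have "((chart_map (cone_chart d) \<circ> chart_inv (cone_chart c)) has_derivative
      (\<lambda>h. (fst h, transition_deriv c d p (snd h)))) (at (r, chart_map c p))"
  proof (rule has_derivative_transform_within_open[OF _ O])
    show "(r, chart_map c p) \<in> {0<..} \<times> ?S" using c d r by auto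
    show "(fst q, (chart_map d \<circ> chart_inv c) (snd q))
        = (chart_map (cone_chart d) \<circ> chart_inv (cone_chart c)) q" if "q \<in> {0<..} \<times> ?S" for q
      using transition_cone[OF c(1), of "fst q" "snd q" d] that by auto
  qed
  from frechet_derivative_at[OF this] show ?thesis
    by (simp add: transition_deriv_def fun_eq_iff)
qed

lemma chart_components_cone:
  assumes "c \<in> atlas M" "p \<in> chart_dom c" "r > 0"
  shows "chart_components (cone_manifold M) (cone_chart c) (r, p) (a, u) = (a, chart_components M c p u)"
  unfolding chart_components_eq chart_at_cone
  using transition_deriv_cone[OF chart_at[OF in_pts] assms(1,2,3)] assms by auto

lemma field_rep_cone:
  assumes "c \<in> atlas M" "x \<in> chart_map c ` chart_dom c" "r > 0"
  shows "field_rep (cone_manifold M) (cone_chart c) X (r, x)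
    = (fst (X (r, chart_inv c x)), chart_components M c (chart_inv c x) (snd (X (r, chart_inv c x))))"
proof -
  have "chart_inv c x \<in> chart_dom c" using assms inv_map by auto
  from chart_components_cone[OF assms(1) this assms(3),
      of "fst (X (r, chart_inv c x))" "snd (X (r, chart_inv c x))"]
  show ?thesis by (simp add: field_rep_def chart_inv_cone[OF assms(1,3,2)])
qed

lemma vector_field_coneI:
  assumes U: "open U"
    and f: "\<And>c. c \<in> atlas M \<Longrightarrow> smooth_on (f c) ({0<..} \<times> chart_map c ` (chart_dom c \<inter> U))"
    and eq: "\<And>c r p. c \<in> atlas M \<Longrightarrow> r > 0 \<Longrightarrow> p \<in> chart_dom c \<Longrightarrow> p \<in> U
      \<Longrightarrow> f c (r, chart_map c p) = (fst (X (r, p)), chart_components M c p (snd (X (r, p))))"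
  shows "vector_field (cone_manifold M) ({0<..} \<times> U) X"
  unfolding vector_field_eq
proof
  fix c'
  assume "c' \<in> atlas (cone_manifold M)"
  then obtain c where c: "c' = cone_chart c" "c \<in> atlas M" by (auto simp: atlas_cone)
  have O: "open ({0<..} \<times> chart_map c ` (chart_dom c \<inter> U) :: (real \<times> 'b) set)"
    using open_image[OF U c(2)] by (simp add: open_Times)
  show "smooth_on (field_rep (cone_manifold M) c' X) (chart_map c' ` (chart_dom c' \<inter> {0<..} \<times> U))"
    unfolding c(1) cone_image
  proof (rule smooth_on_cong[OF O f[OF c(2)]])
    fix y :: "real \<times> 'b"
    assume "y \<in> {0<..} \<times> chart_map c ` (chart_dom c \<inter> U)"
    then obtain r p where y: "y = (r, chart_map c p)" "r > 0" "p \<in> chart_dom c" "p \<in> U" by auto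
    show "f c y = field_rep (cone_manifold M) (cone_chart c) X y"
      using eq[OF c(2) y(2-4)] field_rep_cone[OF c(2), of "chart_map c p" r X] y c
      by (simp add: inv_map)
  qed
qed

lemma vector_field_cone_lift:
  assumes "open U" "vector_field M U X"
  shows "vector_field (cone_manifold M) ({0<..} \<times> U) (cone_lift X)"
proof (rule vector_field_coneI[OF assms(1), of "\<lambda>c q. (0, field_rep M c X (snd q))"])
  fix c
  assume c: "c \<in> atlas M"
  have O: "open ({0<..} \<times> chart_map c ` (chart_dom c \<inter> U) :: (real \<times> 'b) set)"
    using open_image[OF assms(1) c] by (simp add: open_Times)
  show "smooth_on (\<lambda>q. (0 :: real, field_rep M c X (snd q)))
      ({0<..} \<times> chart_map c ` (chart_dom c \<inter> U) :: (real \<times> 'b) set)"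
    by (intro smooth_on_Pair smooth_on_const smooth_on_cone[OF vector_field_chartD[OF assms(2) c]]
        open_image[OF assms(1) c] O) simp
qed (auto simp: cone_lift_apply field_rep_def inv_map)

lemma vector_field_euler:
  assumes "open U"
  shows "vector_field (cone_manifold M) ({0<..} \<times> U) euler_field"
proof (rule vector_field_coneI[OF assms(1), of "\<lambda>c q. (fst q, 0)"])
  fix c
  assume c: "c \<in> atlas M"
  have O: "open ({0<..} \<times> chart_map c ` (chart_dom c \<inter> U) :: (real \<times> 'b) set)"
    using open_image[OF assms(1) c] by (simp add: open_Times)
  show "smooth_on (\<lambda>q. (fst q, 0 :: 'b)) ({0<..} \<times> chart_map c ` (chart_dom c \<inter> U) :: (real \<times> 'b) set)"
    by (intro smooth_on_Pair smooth_on_const smooth_on_linear bounded_linear_fst O)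
qed (auto simp: euler_field_def linear_0[OF linear_chart_components])

text \<open>This is how sections of a plane field on the cone give fields on \<open>M\<close>: the hypersurface
  \<open>r = 1\<close> is a copy of \<open>M\<close>.\<close>

lemma slice_smooth:
  assumes X: "vector_field (cone_manifold M) W' X" and W: "open W" "\<And>q. q \<in> W \<Longrightarrow> (1, q) \<in> W'"
  shows "smooth_function M W (\<lambda>q. fst (X (1, q)))" "vector_field M W (\<lambda>q. snd (X (1, q)))"
proof -
  have *: "smooth_on (\<lambda>x. field_rep (cone_manifold M) (cone_chart c) X (1, x)) (chart_map c ` (chart_dom c \<inter> W))"
    if c: "c \<in> atlas M" for c
  proof (rule smooth_on_compose[where h = "field_rep (cone_manifold M) (cone_chart c) X" and f = "Pair 1"])
    show "smooth_on (field_rep (cone_manifold M) (cone_chart c) X)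
        (chart_map (cone_chart c) ` (chart_dom (cone_chart c) \<inter> W'))"
      using X c by (auto simp: vector_field_eq atlas_cone)
    show "smooth_on (\<lambda>x. (1 :: real, x)) (chart_map c ` (chart_dom c \<inter> W))"
      by (intro smooth_on_Pair smooth_on_const smooth_on_ident open_image[OF W(1) c])
    show "open (chart_map c ` (chart_dom c \<inter> W))" by (rule open_image[OF W(1) c])
    show "Pair 1 ` chart_map c ` (chart_dom c \<inter> W)
        \<subseteq> chart_map (cone_chart c) ` (chart_dom (cone_chart c) \<inter> W')"
    proof (rule image_subsetI)
      fix x
      assume "x \<in> chart_map c ` (chart_dom c \<inter> W)"
      then obtain q where "x = chart_map c q" "q \<in> chart_dom c" "q \<in> W" by blast
      then show "(1, x) \<in> chart_map (cone_chart c) ` (chart_dom (cone_chart c) \<inter> W')"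
        using W(2) by (intro rev_image_eqI[of "(1, q)"]) auto
    qed
  qed
  have rep: "field_rep (cone_manifold M) (cone_chart c) X (1, x)
      = (fst (X (1, chart_inv c x)), field_rep M c (\<lambda>q. snd (X (1, q))) x)"
    if "c \<in> atlas M" "x \<in> chart_map c ` (chart_dom c \<inter> W)" for c x
    using field_rep_cone[OF that(1), of x 1 X] that(2) by (auto simp: field_rep_def)
  show "smooth_function M W (\<lambda>q. fst (X (1, q)))"
    unfolding smooth_function_def
    by (intro ballI smooth_on_cong[OF open_image[OF W(1)]
          smooth_on_bounded_linear[OF bounded_linear_fst * open_image[OF W(1)]]])
      (simp_all add: rep)
  show "vector_field M W (\<lambda>q. snd (X (1, q)))"
    unfolding vector_field_eq
    by (intro ballI smooth_on_cong[OF open_image[OF W(1)]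
          smooth_on_bounded_linear[OF bounded_linear_snd * open_image[OF W(1)]]])
      (simp_all add: rep)
qed

text \<open>All inner products of lifts and Euler fields have the form \<open>\<rho>\<^sup>2 * f q\<close>.\<close>

lemma dir_deriv_cone:
  assumes f: "smooth_function M U f" and U: "open U" "p \<in> U" "U \<subseteq> pts M" and r: "r > 0"
    and F: "\<And>\<rho> q. \<rho> > 0 \<Longrightarrow> q \<in> U \<Longrightarrow> F (\<rho>, q) = \<rho>\<^sup>2 * f q"
  shows "dir_deriv (cone_manifold M) (r, p) (a, x) F = 2 * r * a * f p + r\<^sup>2 * dir_deriv M p x f"
proof -
  have P: "p \<in> pts M" using U by auto
  define d where "d = chart_at M p"
  have d: "d \<in> atlas M" "p \<in> chart_dom d" using chart_at[OF P] by (auto simp: d_def)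
  let ?S = "{0<..} \<times> chart_map d ` (chart_dom d \<inter> U) :: (real \<times> 'b) set"
  have O: "open ?S" using open_image[OF U(1) d(1)] by (simp add: open_Times)
  have fd: "((\<lambda>y. f (chart_inv d y)) has_derivative (\<lambda>x. dir_deriv M p x f)) (at (snd (r, chart_map d p)))"
    using dir_deriv_has_derivative[OF f U(2) P] by (simp add: d_def)
  have "((\<lambda>q. (fst q)\<^sup>2 * f (chart_inv d (snd q))) has_derivative
      (\<lambda>h. 2 * r * fst h * f p + r\<^sup>2 * dir_deriv M p (snd h) f)) (at (r, chart_map d p))"
    by (rule derivative_eq_intros has_derivative_compose[OF has_derivative_snd[OF has_derivative_ident] fd] refl)+
      (use d in \<open>auto simp: inv_map\<close>)
  then have "((\<lambda>y. F (chart_inv (cone_chart d) y)) has_derivative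
      (\<lambda>h. 2 * r * fst h * f p + r\<^sup>2 * dir_deriv M p (snd h) f)) (at (r, chart_map d p))"
    by (rule has_derivative_transform_within_open[OF _ O])
      (use r d U F in \<open>auto simp: chart_inv_cone inv_map\<close>)
  from frechet_derivative_at[OF this] show ?thesis
    by (simp add: dir_deriv_def chart_at_cone fun_eq_iff flip: d_def)
qed

context
  fixes U and p and r :: real
  assumes U: "open U" "p \<in> U" "U \<subseteq> pts M" and r: "r > 0"
begin

lemma cone_lift_derivative:
  assumes X: "vector_field M U X"
  shows "frechet_derivative (field_rep (cone_manifold M) (cone_chart (chart_at M p)) (cone_lift X))
      (at (r, chart_map (chart_at M p) p)) (a, u)
    = (0, frechet_derivative (field_rep M (chart_at M p) X) (at (chart_map (chart_at M p) p)) u)"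
proof -
  have P: "p \<in> pts M" using U by auto
  define d where "d = chart_at M p"
  have d: "d \<in> atlas M" "p \<in> chart_dom d" using chart_at[OF P] by (auto simp: d_def)
  let ?S = "{0<..} \<times> chart_map d ` (chart_dom d \<inter> U) :: (real \<times> 'b) set"
  have O: "open ?S" using open_image[OF U(1) d(1)] by (simp add: open_Times)
  let ?D = "frechet_derivative (field_rep M d X) (at (chart_map d p))"
  have "(field_rep M d X has_derivative ?D) (at (snd (r, chart_map d p)))"
    using smooth_on_has_derivative[OF vector_field_chartD[OF X d(1) subset_refl], of "chart_map d p"] d U
    by auto
  from has_derivative_Pair[OF has_derivative_const
      has_derivative_compose[OF has_derivative_snd[OF has_derivative_ident] this]]
  have "((\<lambda>q. (0, field_rep M d X (snd q))) has_derivative (\<lambda>h. (0, ?D (snd h)))) (at (r, chart_map d p))" .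
  then have "(field_rep (cone_manifold M) (cone_chart d) (cone_lift X) has_derivative
      (\<lambda>h. (0, ?D (snd h)))) (at (r, chart_map d p))"
  proof (rule has_derivative_transform_within_open[OF _ O])
    show "(r, chart_map d p) \<in> ?S" using r d U by auto
    show "(0, field_rep M d X (snd q)) = field_rep (cone_manifold M) (cone_chart d) (cone_lift X) q"
      if "q \<in> ?S" for q
      using that field_rep_cone[OF d(1)] by (auto simp: cone_lift_def field_rep_def)
  qed
  from frechet_derivative_at[OF this] show ?thesis by (simp add: d_def fun_eq_iff)
qed

lemma euler_derivative:
  "frechet_derivative (field_rep (cone_manifold M) (cone_chart (chart_at M p)) euler_field)
      (at (r, chart_map (chart_at M p) p)) (a, u) = (a, 0)"
proof -
  have P: "p \<in> pts M" using U by auto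
  define d where "d = chart_at M p"
  have d: "d \<in> atlas M" "p \<in> chart_dom d" using chart_at[OF P] by (auto simp: d_def)
  let ?S = "{0<..} \<times> chart_map d ` (chart_dom d \<inter> U) :: (real \<times> 'b) set"
  have O: "open ?S" using open_image[OF U(1) d(1)] by (simp add: open_Times)
  have "((\<lambda>q. (fst q, 0)) has_derivative (\<lambda>h. (fst h, 0 :: 'b))) (at (r, chart_map d p))"
    by (intro has_derivative_Pair has_derivative_fst has_derivative_ident has_derivative_const)
  then have "(field_rep (cone_manifold M) (cone_chart d) euler_field has_derivative
      (\<lambda>h. (fst h, 0))) (at (r, chart_map d p))"
  proof (rule has_derivative_transform_within_open[OF _ O])
    show "(r, chart_map d p) \<in> ?S" using r d U by auto
    show "(fst q, 0) = field_rep (cone_manifold M) (cone_chart d) euler_field q" if q: "q \<in> ?S" for q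
    proof -
      obtain \<rho> p' where "q = (\<rho>, chart_map d p')" "\<rho> > 0" "p' \<in> chart_dom d" using q by auto
      then show ?thesis
        using field_rep_cone[OF d(1), of "chart_map d p'" \<rho> euler_field]
        by (simp add: euler_field_def inv_map d linear_0[OF linear_chart_components[OF d(1)]])
    qed
  qed
  from frechet_derivative_at[OF this] show ?thesis by (simp add: d_def fun_eq_iff)
qed

lemma lie_bracket_cone_lift:
  assumes "vector_field M U X" "vector_field M U Y"
  shows "lie_bracket (cone_manifold M) (cone_lift X) (cone_lift Y) (r, p) = (0, lie_bracket M X Y p)"
  by (simp add: lie_bracket_eq_field_rep chart_at_cone cone_lift_derivative assms cone_lift_apply)

lemma lie_bracket_euler_lift:
  assumes X: "vector_field M U X"
  shows "lie_bracket (cone_manifold M) euler_field (cone_lift X) (r, p) = 0"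
proof -
  have P: "p \<in> pts M" using U by auto
  have "linear (frechet_derivative (field_rep M (chart_at M p) X) (at (chart_map (chart_at M p) p)))"
    using smooth_on_differentiable[OF vector_field_chartD[OF X chart_at(1)[OF P] subset_refl]]
      chart_at[OF P] U by (intro linear_frechet_derivative) auto
  then show ?thesis
    by (simp add: lie_bracket_eq_field_rep chart_at_cone cone_lift_derivative[OF X] euler_derivative
        cone_lift_apply euler_field_apply linear_0 zero_prod_def)
qed

end

end

section \<open>The Levi-Civita connection of the cone\<close>

lemma cone_metric_apply:
  "cone_metric g (r, p) (a, u) (b, v) = - (a * b) + r\<^sup>2 * g p u v"
  by (simp add: cone_metric_def)

locale cone_mfd = M: levi_civita_mfd M nabla g
    + C: levi_civita_mfd "cone_manifold M" nabla_cone "cone_metric g"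
  for M :: "('a::{t2_space, second_countable_topology}, 'b::euclidean_space) manifold"
    and nabla g nabla_cone +
  assumes metric_smooth: "semi_riemannian M g"
begin

lemma cone_vector_eqI:
  assumes p: "p \<in> pts M" and r: "r > 0"
    and "cone_metric g (r, p) w (r, 0) = cone_metric g (r, p) w' (r, 0)"
    and "\<And>z. cone_metric g (r, p) w (0, z) = cone_metric g (r, p) w' (0, z)"
  shows "w = w'"
proof -
  obtain b u b' u' where w: "w = (b, u)" "w' = (b', u')" by (cases w, cases w') auto
  have "b = b'" using assms(3) r by (simp add: w cone_metric_apply M.metric_simps p)
  moreover have "u - u' = 0"
    by (rule M.metric_nondegenerate[OF p]) (use assms(4) r in \<open>simp add: w cone_metric_apply M.metric_simps p\<close>)
  ultimately show ?thesis by (simp add: w)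
qed

context
  fixes U :: "'a set" and p :: 'a and r :: real
  assumes U: "open U" "U \<subseteq> pts M" "p \<in> U" and r: "r > 0"
begin

lemma cone_nbhd: "open ({0<..} \<times> U :: (real \<times> 'a) set)" "{0<..} \<times> U \<subseteq> pts (cone_manifold M)"
    "(r, p) \<in> {0<..} \<times> U"
  using U r by (auto simp: pts_cone open_Times)

lemma dir_deriv_metric_lift_lift:
  assumes "vector_field M U Y" "vector_field M U Z"
  shows "dir_deriv (cone_manifold M) (r, p) (a, x) (\<lambda>q. cone_metric g q (cone_lift Y q) (cone_lift Z q))
    = 2 * r * a * g p (Y p) (Z p) + r\<^sup>2 * dir_deriv M p x (\<lambda>q. g q (Y q) (Z q))"
  by (rule M.dir_deriv_cone[OF M.smooth_function_metric[OF metric_smooth U(1,2) assms] U(1,3,2) r])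
    (simp add: cone_lift_apply cone_metric_apply)

lemma dir_deriv_metric_euler_lift:
  "dir_deriv (cone_manifold M) (r, p) w (\<lambda>q. cone_metric g q (euler_field q) (cone_lift Z q)) = 0"
  "dir_deriv (cone_manifold M) (r, p) w (\<lambda>q. cone_metric g q (cone_lift Z q) (euler_field q)) = 0"
proof -
  have z: "dir_deriv (cone_manifold M) (r, p) (fst w, snd w) F = 0"
    if "\<And>\<rho> q. q \<in> U \<Longrightarrow> F (\<rho>, q) = 0" for F
    by (subst M.dir_deriv_cone[OF M.smooth_function_const[OF U(1), of 0] U(1,3,2) r])
      (simp_all add: that M.dir_deriv_const)
  show "dir_deriv (cone_manifold M) (r, p) w (\<lambda>q. cone_metric g q (euler_field q) (cone_lift Z q)) = 0"
    "dir_deriv (cone_manifold M) (r, p) w (\<lambda>q. cone_metric g q (cone_lift Z q) (euler_field q)) = 0"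
    by (rule z[unfolded prod.collapse]; use U in
        \<open>auto simp: cone_lift_apply euler_field_apply cone_metric_apply M.metric_simps subset_iff\<close>)+
qed

lemma dir_deriv_metric_euler_euler:
  "dir_deriv (cone_manifold M) (r, p) (a, x) (\<lambda>q. cone_metric g q (euler_field q) (euler_field q)) = - 2 * r * a"
  by (subst M.dir_deriv_cone[OF M.smooth_function_const[OF U(1), of "-1"] U(1,3,2) r])
    (use U in \<open>auto simp: euler_field_apply cone_metric_apply M.metric_simps
       M.dir_deriv_const subset_iff power2_eq_square\<close>)

end

text \<open>The Koszul formula determines the derivative of \<open>\<xi>\<close>. Lifts of fields on \<open>M\<close> do not
  depend on \<open>r\<close> and commute with \<open>\<xi>\<close>, and they are orthogonal to \<open>\<xi>\<close>; so for
  lifts \<open>X\<close> and \<open>Z\<close> only the term \<open>\<xi>(r\<^sup>2 g(X, Z)) = 2 r\<^sup>2 g(X, Z)\<close> remains. If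
  \<open>\<xi>\<close> occurs in place of \<open>X\<close> or \<open>Z\<close>, only derivatives of the inner product
  \<open>- r\<^sup>2\<close> of \<open>\<xi>\<close> with itself are left.\<close>

lemma nabla_cone_euler:
  assumes p: "p \<in> pts M" and r: "r > 0"
  shows "nabla_cone (r, p) w euler_field = w"
proof -
  define d where "d = chart_at M p"
  have d: "d \<in> atlas M" "p \<in> chart_dom d" using M.chart_at[OF p] by (auto simp: d_def)
  let ?U = "chart_dom d"
  have U: "open ?U" "?U \<subseteq> pts M" "p \<in> ?U"
    using open_chart_dom[OF M.is_chart[OF d(1)]] M.in_pts d by auto
  note nb = cone_nbhd[OF U r]
  let ?X = "coord_field M d"
  have X: "vector_field M ?U (?X x)" for x by (rule M.vector_field_coord[OF U(1) d(1) order_refl])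
  have Xp: "?X x p = x" for x using M.coord_field_self[OF p] by (simp add: d_def)
  note L = M.vector_field_cone_lift[OF U(1) X]
  note E = M.vector_field_euler[OF U(1)]
  have eval: "cone_lift (?X x) (r, p) = (0, x)" "euler_field (r, p) = (r, 0 :: 'b)" for x
    by (simp_all add: cone_lift_apply euler_field_apply Xp)
  note br = M.lie_bracket_cone_lift[OF U(1,3,2) r X X] M.lie_bracket_euler_lift[OF U(1,3,2) r X]
  have br': "lie_bracket (cone_manifold M) (cone_lift (?X x)) euler_field (r, p) = 0" for x
    using br(2)[of x] lie_bracket_swap[of "cone_manifold M" "cone_lift (?X x)"] by simp
  have br'': "lie_bracket (cone_manifold M) euler_field euler_field (r, p) = 0"
    by (simp add: lie_bracket_eq_field_rep)
  have z: "cone_metric g (r, p) 0 w = 0" "cone_metric g (r, p) w 0 = 0" for w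
    using C.metric_simps[of "(r, p)"] p r by (auto simp: pts_cone)
  have D0: "dir_deriv M p 0 (\<lambda>q. g q (?X x q) (?X z q)) = 0" for x z
    by (rule linear_0[OF M.dir_deriv_linear[OF M.smooth_function_metric[OF metric_smooth U(1,2) X X] U(3) p]])
  note simps = eval D0 br br' br'' z dir_deriv_metric_lift_lift[OF U r X X]
    dir_deriv_metric_euler_lift[OF U r] dir_deriv_metric_euler_euler[OF U r]
  have EE: "nabla_cone (r, p) (r, 0) euler_field = (r, 0)"
  proof (rule cone_vector_eqI[OF p r])
    show "cone_metric g (r, p) (nabla_cone (r, p) (r, 0) euler_field) (r, 0) = cone_metric g (r, p) (r, 0) (r, 0)"
      using C.koszul[OF nb(1,2) E E E nb(3)] r
      by (simp add: simps) (simp add: cone_metric_apply M.metric_simps p)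
    show "cone_metric g (r, p) (nabla_cone (r, p) (r, 0) euler_field) (0, z) = cone_metric g (r, p) (r, 0) (0, z)" for z
      using C.koszul[OF nb(1,2) E E L nb(3), of z] r
      by (simp add: simps) (simp add: cone_metric_apply M.metric_simps p)
  qed
  have LE: "nabla_cone (r, p) (0, x) euler_field = (0, x)" for x
  proof (rule cone_vector_eqI[OF p r])
    show "cone_metric g (r, p) (nabla_cone (r, p) (0, x) euler_field) (r, 0) = cone_metric g (r, p) (0, x) (r, 0)"
      using C.koszul[OF nb(1,2) L E E nb(3), of x] r
      by (simp add: simps) (simp add: cone_metric_apply M.metric_simps p)
    show "cone_metric g (r, p) (nabla_cone (r, p) (0, x) euler_field) (0, z) = cone_metric g (r, p) (0, x) (0, z)" for z
      using C.koszul[OF nb(1,2) L E L nb(3), of x z] r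
      by (simp add: simps) (simp add: cone_metric_apply M.metric_simps p Xp power2_eq_square)
  qed
  obtain a x where w: "w = (a, x)" by force
  have lin: "linear (\<lambda>w. nabla_cone (r, p) w euler_field)" by (rule C.linear_nabla[OF nb(1,2) E nb(3)])
  have w': "w = (a / r) *\<^sub>R (r, 0) + (0, x)" using r by (simp add: w)
  show ?thesis
    unfolding w' by (simp only: linear_add[OF lin] linear_cmul[OF lin] EE LE)
qed

text \<open>Against lifts, the Koszul formula of the cone is \<open>r\<^sup>2\<close> times that of the base, which gives
  the component along \<open>M\<close>. The radial component is the second fundamental form of the
  hypersurfaces of constant \<open>r\<close> and follows from \<open>\<nabla>\<^sub>X \<xi> = X\<close> by differentiating the
  orthogonality of \<open>Y\<close> and \<open>\<xi>\<close>. The derivative in the direction of \<open>\<xi>\<close> is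
  \<open>Y\<close>, because \<open>[\<xi>, Y] = 0\<close>.\<close>

lemma nabla_cone_lift:
  assumes U: "open U" "U \<subseteq> pts M" "p \<in> U" and r: "r > 0" and Y: "vector_field M U Y"
  shows "nabla_cone (r, p) (a, x) (cone_lift Y) = (r * g p x (Y p), nabla p x Y + (a / r) *\<^sub>R Y p)"
proof -
  have p: "p \<in> pts M" using U by auto
  define d where "d = chart_at M p"
  have d: "d \<in> atlas M" "p \<in> chart_dom d" using M.chart_at[OF p] by (auto simp: d_def)
  define W where "W = U \<inter> chart_dom d"
  have W: "open W" "W \<subseteq> pts M" "p \<in> W" "W \<subseteq> chart_dom d"
    using U d open_chart_dom[OF M.is_chart[OF d(1)]] by (auto simp: W_def)
  have YW: "vector_field M W Y" using M.vector_field_subset[OF Y] W_def by auto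
  note nb = cone_nbhd[OF W(1-3) r]
  let ?X = "coord_field M d"
  have X: "vector_field M W (?X x)" for x by (rule M.vector_field_coord[OF W(1) d(1) W(4)])
  have Xp: "?X x p = x" for x using M.coord_field_self[OF p] by (simp add: d_def)
  note LX = M.vector_field_cone_lift[OF W(1) X]
  note LY = M.vector_field_cone_lift[OF W(1) YW]
  note E = M.vector_field_euler[OF W(1)]
  have eval: "cone_lift (?X x) (r, p) = (0, x)" "cone_lift Y (r, p) = (0, Y p)"
    "euler_field (r, p) = (r, 0 :: 'b)" for x
    by (simp_all add: cone_lift_apply euler_field_apply Xp)
  let ?n = "nabla_cone (r, p) (0, x) (cone_lift Y)"
  have n: "?n = (r * g p x (Y p), nabla p x Y)"
  proof (rule cone_vector_eqI[OF p r])
    have "cone_metric g (r, p) ?n (r, 0) + cone_metric g (r, p) (0, Y p) (0, x) = 0"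
      using C.metric_derivative[OF nb(1,2) LY E nb(3), of "(0, x)"] dir_deriv_metric_euler_lift[OF W(1-3) r]
      by (simp add: eval nabla_cone_euler[OF p r])
    then show "cone_metric g (r, p) ?n (r, 0) = cone_metric g (r, p) (r * g p x (Y p), nabla p x Y) (r, 0)"
      by (simp add: cone_metric_apply M.metric_simps p M.metric_sym[OF p, of x] power2_eq_square
          algebra_simps eq_neg_iff_add_eq_0)
    fix z
    have "2 * cone_metric g (r, p) ?n (0, z) = r\<^sup>2 * (2 * g p (nabla p x Y) z)"
      using C.koszul[OF nb(1,2) LX LY LX nb(3), of x z] M.koszul[OF W(1,2) X YW X W(3), of x z]
      by (simp add: eval Xp dir_deriv_metric_lift_lift[OF W(1-3) r X YW]
          dir_deriv_metric_lift_lift[OF W(1-3) r X X] dir_deriv_metric_lift_lift[OF W(1-3) r YW X]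
          M.lie_bracket_cone_lift[OF W(1,3,2) r X YW] M.lie_bracket_cone_lift[OF W(1,3,2) r YW X]
          M.lie_bracket_cone_lift[OF W(1,3,2) r X X] del: mult_cancel_left)
        (simp add: cone_metric_apply algebra_simps)
    then show "cone_metric g (r, p) ?n (0, z) = cone_metric g (r, p) (r * g p x (Y p), nabla p x Y) (0, z)"
      by (simp add: cone_metric_apply)
  qed
  have "lie_bracket (cone_manifold M) euler_field (cone_lift Y) (r, p)
      = nabla_cone (r, p) (r, 0) (cone_lift Y) - (0, Y p)"
    using C.lie_bracket_eq[OF nb(1,2) E LY nb(3)] by (simp add: eval nabla_cone_euler[OF p r])
  then have e: "nabla_cone (r, p) (r, 0) (cone_lift Y) = (0, Y p)"
    using M.lie_bracket_euler_lift[OF W(1,3,2) r YW] by simp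
  have lin: "linear (\<lambda>w. nabla_cone (r, p) w (cone_lift Y))" by (rule C.linear_nabla[OF nb(1,2) LY nb(3)])
  have "nabla_cone (r, p) (a, x) (cone_lift Y) = nabla_cone (r, p) ((a / r) *\<^sub>R (r, 0) + (0, x)) (cone_lift Y)"
    using r by simp
  also have "\<dots> = (a / r) *\<^sub>R nabla_cone (r, p) (r, 0) (cone_lift Y) + ?n"
    by (simp only: linear_add[OF lin] linear_cmul[OF lin])
  also have "\<dots> = (r * g p x (Y p), nabla p x Y + (a / r) *\<^sub>R Y p)"
    by (simp add: n e)
  finally show ?thesis .
qed

text \<open>Multiplying the component along \<open>M\<close> by \<open>1 / t\<close> gives the parallel fields along
  the rulings of the cone. Hence an invariant distribution is determined by its values at \<open>r = 1\<close>.\<close>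

lemma parallel_distribution_radial:
  assumes N: "parallel_distribution (cone_manifold M) nabla_cone N"
    and p: "p \<in> pts M" and r: "r > 0" "s > 0" and w: "(a, u) \<in> N (r, p)"
  shows "(a, (r / s) *\<^sub>R u) \<in> N (s, p)"
proof -
  define \<gamma> where "\<gamma> = (\<lambda>t::real. (t, p))"
  define Y where "Y = (\<lambda>t. (a, (r / t) *\<^sub>R u))"
  define d where "d = chart_at M p"
  have d: "d \<in> atlas M" "p \<in> chart_dom d" using M.chart_at[OF p] by (auto simp: d_def)
  let ?U = "chart_dom d"
  have U: "open ?U" "?U \<subseteq> pts M" "p \<in> ?U"
    using open_chart_dom[OF M.is_chart[OF d(1)]] M.in_pts d by auto
  have curve: "smooth_curve (cone_manifold M) {0<..} \<gamma>"
    unfolding smooth_curve_def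
  proof (intro conjI ballI)
    show "continuous_on {0<..} \<gamma>" unfolding \<gamma>_def by (intro continuous_intros)
    show "\<gamma> ` {0<..} \<subseteq> pts (cone_manifold M)" using p by (auto simp: \<gamma>_def pts_cone)
    fix c'
    assume "c' \<in> atlas (cone_manifold M)"
    then obtain c where c: "c' = cone_chart c" by (auto simp: atlas_cone)
    have "open {t \<in> {0<..}. \<gamma> t \<in> chart_dom c'}"
      by (cases "p \<in> chart_dom c") (auto simp: \<gamma>_def c simp flip: greaterThan_def)
    then show "smooth_on (\<lambda>t. chart_map c' (\<gamma> t)) {t \<in> {0<..}. \<gamma> t \<in> chart_dom c'}"
      unfolding c \<gamma>_def chart_map_cone
      by (intro smooth_on_Pair smooth_on_ident smooth_on_const)
  qed (auto simp: is_interval_ci)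
  let ?X = "coord_field M d u"
  have X: "vector_field M ?U ?X" by (rule M.vector_field_coord[OF U(1) d(1) order_refl])
  have Xp: "?X p = u" using M.coord_field_self[OF p] by (simp add: d_def)
  have "parallel_along (cone_manifold M) nabla_cone {0<..} \<gamma> Y"
    unfolding parallel_along_def
  proof (rule ballI)
    fix t :: real
    assume t: "t \<in> {0<..}"
    then have t0: "t > 0" by simp
    note nb = cone_nbhd[OF U t0]
    have "((\<lambda>s. (s, chart_map d p)) has_vector_derivative (1, 0)) (at t)"
      by (auto intro!: derivative_eq_intros simp: has_vector_derivative_def)
    then have vel: "velocity (cone_manifold M) \<gamma> t = (1, 0)"
      by (simp add: velocity_def \<gamma>_def chart_at_cone vector_derivative_at flip: d_def)
    define E :: "bool \<Rightarrow> real \<times> 'a \<Rightarrow> real \<times> 'b" where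
      "E = (\<lambda>b. if b then euler_field else cone_lift ?X)"
    define f where "f = (\<lambda>b s. if b then a / s else r / s)"
    define f' where "f' = (\<lambda>b. if b then - a / t\<^sup>2 else - r / t\<^sup>2)"
    have Evf: "vector_field (cone_manifold M) ({0<..} \<times> ?U) (E b)" for b
      using M.vector_field_euler[OF U(1)] M.vector_field_cone_lift[OF U(1) X] by (simp add: E_def)
    have f: "(f b has_real_derivative f' b) (at t)" for b
      using t0 by (cases b) (auto simp: f_def f'_def power2_eq_square intro!: derivative_eq_intros)
    have Y: "Y s = (\<Sum>b\<in>UNIV. f b s *\<^sub>R E b (\<gamma> s))" if "s \<in> {0<..}" for s
      using that by (simp add: UNIV_bool f_def E_def \<gamma>_def Y_def cone_lift_apply euler_field_apply Xp)
    have mem: "\<gamma> t \<in> {0<..} \<times> ?U" using nb(3) by (simp add: \<gamma>_def)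
    note comb = C.cov_deriv_along_combination[where E = E and f = f and f' = f', OF curve t finite[of UNIV] nb(1,2) mem Evf f
        open_greaterThan t Y]
    have "nabla p 0 ?X = 0" using linear_0[OF M.linear_nabla[OF U(1,2) X U(3)]] .
    then have "nabla_cone (t, p) (1, 0) (cone_lift ?X) = (0, (1 / t) *\<^sub>R u)"
      using nabla_cone_lift[OF U t0 X, of 1 0] by (simp add: Xp M.metric_simps p)
    moreover have "nabla_cone (t, p) (1, 0) euler_field = (1, 0)" by (rule nabla_cone_euler[OF p t0])
    moreover have \<gamma>t: "\<gamma> t = (t, p)" by (simp add: \<gamma>_def)
    have "cov_deriv_along (cone_manifold M) nabla_cone \<gamma> Y t
        = (\<Sum>b\<in>UNIV. f' b *\<^sub>R E b (t, p) + f b t *\<^sub>R nabla_cone (t, p) (1, 0) (E b))"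
      using comb(2) by (simp only: vel \<gamma>t)
    ultimately have "cov_deriv_along (cone_manifold M) nabla_cone \<gamma> Y t = 0"
      using t0 by (simp add: UNIV_bool f_def f'_def E_def cone_lift_apply euler_field_apply Xp
          power2_eq_square zero_prod_def flip: scaleR_add_left)
    then show "chart_components_along (cone_manifold M) \<gamma> Y t differentiable at t \<and>
        cov_deriv_along (cone_manifold M) nabla_cone \<gamma> Y t = 0"
      using comb(1) by blast
  qed
  moreover have "Y r \<in> N (\<gamma> r)" using w r by (simp add: Y_def \<gamma>_def)
  ultimately have "Y s \<in> N (\<gamma> s)"
    using N curve r unfolding parallel_distribution_def by (metis greaterThan_iff)
  then show ?thesis by (simp add: Y_def \<gamma>_def)
qed

end

section \<open>One-forms and congruences\<close>

context smooth_mfd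
begin

lemma one_form_apply:
  assumes \<alpha>: "one_form M U \<alpha>" and U: "open U" "U \<subseteq> pts M" and X: "vector_field M U X"
  shows "smooth_function M U (\<lambda>p. \<alpha> p (X p))"
proof (rule smooth_function_open_cover[OF _ U(2)])
  fix p
  assume p: "p \<in> U"
  define c where "c = chart_at M p"
  have c: "c \<in> atlas M" "p \<in> chart_dom c" using p U chart_at by (auto simp: c_def)
  define W where "W = chart_dom c \<inter> U"
  have W: "open W" "p \<in> W" "W \<subseteq> chart_dom c" "W \<subseteq> U"
    using U p c open_chart_dom[OF is_chart[OF c(1)]] by (auto simp: W_def)
  have "smooth_function M W
      (\<lambda>q. \<Sum>b\<in>Basis. (chart_components M c q (X q) \<bullet> b) * \<alpha> q (coord_field M c b q))"
  proof (intro smooth_function_sum smooth_function_mult W)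
    show "smooth_function M W (\<lambda>q. chart_components M c q (X q) \<bullet> b)" for b
      by (rule smooth_function_components[OF W(1) c(1) W(3) vector_field_subset[OF X W(4)]])
    show "smooth_function M W (\<lambda>q. \<alpha> q (coord_field M c b q))" for b
      using \<alpha> c(1) unfolding one_form_def W_def by blast
  qed
  then have "smooth_function M W (\<lambda>q. \<alpha> q (X q))"
  proof (rule smooth_function_cong[OF W(1)])
    fix q
    assume q: "q \<in> W"
    have "linear (\<alpha> q)" using \<alpha> q W by (auto simp: one_form_def)
    from linear_basis_expansion[OF linear_compose[OF linear_coord_field this], of c q "chart_components M c q (X q)"]
    show "(\<Sum>b\<in>Basis. (chart_components M c q (X q) \<bullet> b) * \<alpha> q (coord_field M c b q)) = \<alpha> q (X q)"
      using c q W by (auto simp: o_def)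
  qed
  then show "\<exists>W. open W \<and> p \<in> W \<and> smooth_function M W (\<lambda>p. \<alpha> p (X p))" using W by blast
qed

lemma one_formI:
  assumes "\<And>p. p \<in> U \<Longrightarrow> linear (\<alpha> p)" and U: "open U" "U \<subseteq> pts M"
    and "\<And>W X. open W \<Longrightarrow> W \<subseteq> U \<Longrightarrow> vector_field M W X \<Longrightarrow> smooth_function M W (\<lambda>p. \<alpha> p (X p))"
  shows "one_form M U \<alpha>"
  unfolding one_form_def
proof (intro conjI ballI allI)
  fix c and w :: 'b
  assume c: "c \<in> atlas M"
  have "open (chart_dom c \<inter> U)" using open_chart_dom[OF is_chart[OF c]] U by auto
  then show "smooth_function M (chart_dom c \<inter> U) (\<lambda>p. \<alpha> p (coord_field M c w p))"
    by (intro assms(4) vector_field_coord c) auto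
qed (use assms in auto)

text \<open>A family of linear maps with values in the line spanned by a nowhere vanishing field
  \<open>V\<close> is \<open>\<alpha> \<otimes> V\<close>. The coefficient is written down with the inner product of the model
  space, which has no invariant meaning; smoothness is seen by expressing it near each point as a
  quotient of components in a fixed chart.\<close>

lemma one_form_coefficient:
  assumes U: "open U" "U \<subseteq> pts M" and V: "vector_field M U V" "\<And>p. p \<in> U \<Longrightarrow> V p \<noteq> 0"
    and lin: "\<And>p. p \<in> U \<Longrightarrow> linear (S p)" and line: "\<And>p x. p \<in> U \<Longrightarrow> \<exists>k. S p x = k *\<^sub>R V p"
    and smooth: "\<And>W X. open W \<Longrightarrow> W \<subseteq> U \<Longrightarrow> vector_field M W X \<Longrightarrow> vector_field M W (\<lambda>p. S p (X p))"
  shows "\<exists>\<alpha>. one_form M U \<alpha> \<and> (\<forall>p\<in>U. \<forall>x. S p x = \<alpha> p x *\<^sub>R V p)"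
proof -
  define \<alpha> where "\<alpha> p x = (S p x \<bullet> V p) / (V p \<bullet> V p)" for p x
  have eq: "S p x = \<alpha> p x *\<^sub>R V p" if "p \<in> U" for p x
    using line[OF that, of x] V(2)[OF that] by (auto simp: \<alpha>_def)
  have "one_form M U \<alpha>"
  proof (rule one_formI[OF _ U])
    show "linear (\<alpha> p)" if "p \<in> U" for p
      by (rule linearI)
        (simp_all add: \<alpha>_def linear_add[OF lin[OF that]] linear_cmul[OF lin[OF that]] inner_simps add_divide_distrib)
    fix W X
    assume W: "open W" "W \<subseteq> U" and X: "vector_field M W X"
    show "smooth_function M W (\<lambda>p. \<alpha> p (X p))"
    proof (rule smooth_function_open_cover)
      fix p
      assume p: "p \<in> W"
      define c where "c = chart_at M p"
      have c: "c \<in> atlas M" "p \<in> chart_dom c" using p U W chart_at by (auto simp: c_def)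
      define W0 where "W0 = W \<inter> chart_dom c"
      have W0: "open W0" "p \<in> W0" "W0 \<subseteq> chart_dom c" "W0 \<subseteq> W" "W0 \<subseteq> pts M"
        using U W p c open_chart_dom[OF is_chart[OF c(1)]] by (auto simp: W0_def)
      let ?x = "\<lambda>Y b q. chart_components M c q (Y q) \<bullet> b"
      have "chart_components M c p (V p) \<noteq> 0"
        using chart_components_eq_iff[OF c, of "V p" 0] V(2)[of p] p W linear_0[OF linear_chart_components[OF c]]
        by auto
      then obtain b where b: "b \<in> Basis" "?x V b p \<noteq> 0" using euclidean_all_zero_iff by blast
      have Vb: "smooth_function M W0 (?x V b)"
        using W W0 by (intro smooth_function_components c vector_field_subset[OF V(1)]) auto
      have Sb: "smooth_function M W0 (?x (\<lambda>q. S q (X q)) b)"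
        using W0 by (intro smooth_function_components c vector_field_subset[OF smooth[OF W X]]) auto
      define G0 where "G0 = ?x V b -` (- {0}) \<inter> W0"
      have G0: "open G0" "p \<in> G0" "G0 \<subseteq> W0"
        unfolding G0_def using open_nonzero_set[OF W0(1) smooth_function_continuous[OF Vb W0(1,5)]] b W0
        by auto
      have "smooth_function M G0 (\<lambda>q. ?x (\<lambda>q. S q (X q)) b q / ?x V b q)"
        by (rule smooth_function_divide[OF G0(1) smooth_function_subset[OF Sb G0(3)] smooth_function_subset[OF Vb G0(3)]])
          (simp add: G0_def)
      then have "smooth_function M G0 (\<lambda>q. \<alpha> q (X q))"
      proof (rule smooth_function_cong[OF G0(1)])
        fix q
        assume q: "q \<in> G0"
        then have "q \<in> U" "q \<in> chart_dom c" "?x V b q \<noteq> 0" using G0 W W0 by (auto simp: G0_def)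
        then show "?x (\<lambda>q. S q (X q)) b q / ?x V b q = \<alpha> q (X q)"
          using eq[of q "X q"] by (simp add: linear_cmul[OF linear_chart_components[OF c(1)]])
      qed
      then show "\<exists>W. open W \<and> p \<in> W \<and> smooth_function M W (\<lambda>q. \<alpha> q (X q))" using G0 by blast
    qed (use U W in auto)
  qed
  then show ?thesis using eq by (intro exI[of _ \<alpha>]) simp
qed

end

text \<open>For a null pair the Lie derivative \<open>\<L>\<^sub>V g (X, Y) = g(\<nabla>\<^sub>X V, Y) + g(X, \<nabla>\<^sub>Y V)\<close> equals
  \<open>\<theta> \<cdot> V\<^sup>\<flat>\<close> with \<open>\<theta> = \<alpha> + Z\<^sup>\<flat>\<close>, so the conformal factor is zero.\<close>

lemma (in levi_civita_mfd) null_pair_congruence: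
  assumes sr: "semi_riemannian M g" and W: "open W" "W \<subseteq> pts M" and np: "null_pair M g nabla W V Z \<alpha> \<beta>"
  shows "geodesic_shearfree_null_congruence M g nabla W V"
proof -
  have V: "vector_field M W V" and Z: "vector_field M W Z" and \<alpha>: "one_form M W \<alpha>"
    and alg: "\<And>p. p \<in> W \<Longrightarrow> V p \<noteq> 0 \<and> g p (V p) (V p) = 0"
    and nV: "\<And>p x. p \<in> W \<Longrightarrow> nabla p x V = \<alpha> p x *\<^sub>R V p + g p x (V p) *\<^sub>R Z p"
    using np by (auto simp: null_pair_def)
  have "geodesic_field M nabla W V"
    unfolding geodesic_field_def
    by (rule exI[of _ "\<lambda>p. \<alpha> p (V p)"]) (simp add: one_form_apply[OF \<alpha> W V] nV alg)
  moreover have "shearfree_field M g W V"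
    unfolding shearfree_field_def
  proof (intro exI[of _ "\<lambda>p. 0"] exI[of _ "\<lambda>p x. \<alpha> p x + g p (Z p) x"] conjI allI impI ballI)
    show "smooth_function M W (\<lambda>p. 0)" by (rule smooth_function_const[OF W(1)])
    show "one_form M W (\<lambda>p x. \<alpha> p x + g p (Z p) x)"
    proof (rule one_formI[OF _ W])
      show "linear (\<lambda>x. \<alpha> p x + g p (Z p) x)" if "p \<in> W" for p
        using \<alpha> bilinear_metric[of p] that W by (auto simp: one_form_def bilinear_def intro!: linear_compose_add)
      fix G0 X
      assume G0: "open G0" "G0 \<subseteq> W" and X: "vector_field M G0 X"
      have "one_form M G0 \<alpha>"
        using \<alpha> G0(2) unfolding one_form_def
        by (auto intro: smooth_function_subset[OF _ Int_mono[OF order_refl G0(2)]])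
      then show "smooth_function M G0 (\<lambda>p. \<alpha> p (X p) + g p (Z p) (X p))"
        using G0 W by (intro smooth_function_add smooth_function_metric[OF sr] one_form_apply X
            vector_field_subset[OF Z]) auto
    qed
    fix G0 X Y p
    assume a: "open G0 \<and> G0 \<subseteq> W \<and> vector_field M G0 X \<and> vector_field M G0 Y" and p: "p \<in> G0"
    then have G0: "open G0" "G0 \<subseteq> pts M" and X: "vector_field M G0 X" and Y: "vector_field M G0 Y"
      and VO: "vector_field M G0 V" and pW: "p \<in> W" and P: "p \<in> pts M"
      using W vector_field_subset[OF V] by auto
    show "lie_deriv_metric M g V X Y p = 0 * g p (X p) (Y p)
        + ((\<alpha> p (X p) + g p (Z p) (X p)) * g p (V p) (Y p) + g p (V p) (X p) * (\<alpha> p (Y p) + g p (Z p) (Y p)))"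
      unfolding lie_deriv_metric_def metric_derivative[OF G0 X Y p] lie_bracket_eq[OF G0 VO X p]
        lie_bracket_eq[OF G0 VO Y p] nV[OF pW]
      using metric_sym[OF P, of "X p"] metric_sym[OF P, of "V p" "Y p"]
      by (simp add: metric_simps P algebra_simps)
  qed
  ultimately show ?thesis
    using V alg by (simp add: geodesic_shearfree_null_congruence_def)
qed

section \<open>Null pairs and null plane fields\<close>

text \<open>The points over which \<open>N\<close> is not tangent to the hypersurface \<open>r = 1\<close>, or
  equivalently not orthogonal to the Euler field.\<close>

definition generic_points ::
  "('a, 'b) manifold \<Rightarrow> (real \<times> 'a \<Rightarrow> (real \<times> 'b) set) \<Rightarrow> 'a set" where
  "generic_points M N = {p \<in> pts M. \<exists>w\<in>N (1, p). fst w \<noteq> 0}"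

context cone_mfd
begin

text \<open>For the frame \<open>V\<close>, \<open>\<xi> + Z\<close> and the vector \<open>w = (a, x)\<close> the null pair equations turn
  into \<open>\<nabla>\<^sub>w V = (\<alpha>(x) + a / r) V + g(x, V) (\<xi> + Z)\<close> and
  \<open>\<nabla>\<^sub>w (\<xi> + Z) = \<beta>(x) V + (g(x, Z) + a / r) (\<xi> + Z)\<close>: the term \<open>- x\<close> in the equation
  for \<open>Z\<close> is cancelled by \<open>\<nabla>\<^sub>w \<xi> = w\<close>.\<close>

lemma plane_field_of_null_pair:
  assumes np: "null_pair M g nabla (pts M) V Z \<alpha> \<beta>"
  shows "parallel_null_plane_field (cone_manifold M) (cone_metric g) nabla_cone
    (\<lambda>q. span {cone_lift V q, euler_field q + cone_lift Z q})"
proof -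
  have V: "vector_field M (pts M) V" and Z: "vector_field M (pts M) Z"
    and alg: "\<And>p. p \<in> pts M \<Longrightarrow> V p \<noteq> 0 \<and> g p (V p) (V p) = 0 \<and> g p (Z p) (Z p) = 1 \<and> g p (V p) (Z p) = 0"
    and nV: "\<And>p x. p \<in> pts M \<Longrightarrow> nabla p x V = \<alpha> p x *\<^sub>R V p + g p x (V p) *\<^sub>R Z p"
    and nZ: "\<And>p x. p \<in> pts M \<Longrightarrow> nabla p x Z = - x + \<beta> p x *\<^sub>R V p + g p x (Z p) *\<^sub>R Z p"
    using np by (auto simp: null_pair_def)
  define E0 where "E0 = cone_lift V"
  define E1 where "E1 = (\<lambda>q. euler_field q + cone_lift Z q)"
  have E: "E0 (r, p) = (0, V p)" "E1 (r, p) = (r, Z p)" for r p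
    by (simp_all add: E0_def E1_def cone_lift_apply euler_field_apply)
  note G0 = M.open_pts
  have v0: "vector_field (cone_manifold M) (pts (cone_manifold M)) E0"
    unfolding pts_cone E0_def by (rule M.vector_field_cone_lift[OF G0 V])
  have ve: "vector_field (cone_manifold M) (pts (cone_manifold M)) euler_field"
    unfolding pts_cone by (rule M.vector_field_euler[OF G0])
  have vz: "vector_field (cone_manifold M) (pts (cone_manifold M)) (cone_lift Z)"
    unfolding pts_cone by (rule M.vector_field_cone_lift[OF G0 Z])
  have v1: "vector_field (cone_manifold M) (pts (cone_manifold M)) E1"
    unfolding E1_def by (rule C.vector_field_add[OF C.open_pts ve vz])
  have ind: "independent_pair (E0 q) (E1 q)" if "q \<in> pts (cone_manifold M)" for q
    using that alg by (cases q) (auto simp: pts_cone E independent_pair_def zero_prod_def)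
  have "subbundle (cone_manifold M) 2 (\<lambda>q. span {E0 q, E1 q})"
    unfolding subbundle_def
  proof (intro ballI exI conjI allI impI)
    let ?E = "\<lambda>i :: nat. if i = 0 then E0 else E1"
    fix q
    assume "q \<in> pts (cone_manifold M)"
    then show "q \<in> pts (cone_manifold M)" .
    show "open (pts (cone_manifold M))" by (rule C.open_pts)
    show "vector_field (cone_manifold M) (pts (cone_manifold M)) (?E i)" for i using v0 v1 by simp
    show "span {E0 q, E1 q} = span ((\<lambda>i. ?E i q) ` {..<2})" for q
      by (rule arg_cong[of _ _ span]) (auto simp: numeral_2_eq_2 lessThan_Suc)
    show "dim (span {E0 q, E1 q}) = 2" if "q \<in> pts (cone_manifold M)" for q
      using ind[OF that] by (simp add: independent_pair_iff_dim)
  qed simp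
  moreover have "totally_null (cone_manifold M) (cone_metric g) (\<lambda>q. span {E0 q, E1 q})"
    unfolding totally_null_def
  proof (intro ballI)
    fix q u v
    assume q: "q \<in> pts (cone_manifold M)" and uv: "u \<in> span {E0 q, E1 q}" "v \<in> span {E0 q, E1 q}"
    obtain r p where rp: "q = (r, p)" "r > 0" "p \<in> pts M" using q by (auto simp: pts_cone)
    obtain s t s' t' where "u = s *\<^sub>R E0 q + t *\<^sub>R E1 q" "v = s' *\<^sub>R E0 q + t' *\<^sub>R E1 q"
      using uv unfolding span_pair by auto
    then show "cone_metric g q u v = 0"
      using alg[OF rp(3)] M.metric_sym[OF rp(3), of "Z p" "V p"]
      by (simp add: rp(1,3) E cone_metric_apply M.metric_simps power2_eq_square)
  qed
  moreover have "parallel_distribution (cone_manifold M) nabla_cone (\<lambda>q. span {E0 q, E1 q})"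
  proof (rule C.parallel_distribution_span[OF v0 v1 ind])
    fix q and w :: "real \<times> 'b"
    assume q: "q \<in> pts (cone_manifold M)"
    obtain r p where rp: "q = (r, p)" "r > 0" "p \<in> pts M" using q by (auto simp: pts_cone)
    obtain a x where w: "w = (a, x)" by force
    have "nabla_cone q w E0 = (\<alpha> p x + a / r) *\<^sub>R E0 q + g p x (V p) *\<^sub>R E1 q"
      using nabla_cone_lift[OF G0 order_refl rp(3,2) V, of a x] rp
      by (simp add: E0_def[symmetric] rp(1) w E nV algebra_simps)
    then show "nabla_cone q w E0 \<in> span {E0 q, E1 q}" unfolding span_pair by blast
    have "nabla_cone q w E1 = nabla_cone q w euler_field + nabla_cone q w (cone_lift Z)"
      unfolding E1_def by (rule C.nabla_add[OF C.open_pts order_refl ve vz q])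
    also have "\<dots> = \<beta> p x *\<^sub>R E0 q + (g p x (Z p) + a / r) *\<^sub>R E1 q"
      using nabla_cone_lift[OF G0 order_refl rp(3,2) Z, of a x] nabla_cone_euler[OF rp(3,2), of "(a, x)"] rp
      by (simp add: rp(1) w E nZ algebra_simps)
    finally show "nabla_cone q w E1 \<in> span {E0 q, E1 q}" unfolding span_pair by blast
  qed
  ultimately show ?thesis
    by (simp add: parallel_null_plane_field_def E0_def E1_def)
qed

context
  fixes N :: "real \<times> 'a \<Rightarrow> (real \<times> 'b) set"
  assumes N: "parallel_null_plane_field (cone_manifold M) (cone_metric g) nabla_cone N"
begin

lemma subb: "subbundle (cone_manifold M) 2 N"
  and null: "totally_null (cone_manifold M) (cone_metric g) N"
  and par: "parallel_distribution (cone_manifold M) nabla_cone N"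
  using N by (auto simp: parallel_null_plane_field_def)

lemma local_frame:
  assumes "p \<in> pts M"
  obtains U A B where "open U" "(1, p) \<in> U" "U \<subseteq> pts (cone_manifold M)"
    "vector_field (cone_manifold M) U A" "vector_field (cone_manifold M) U B"
    "\<And>q. q \<in> U \<Longrightarrow> N q = span {A q, B q}" "\<And>q. q \<in> U \<Longrightarrow> independent_pair (A q) (B q)"
proof -
  have "(1, p) \<in> pts (cone_manifold M)" using assms by (simp add: pts_cone)
  then obtain U and E :: "nat \<Rightarrow> real \<times> 'a \<Rightarrow> real \<times> 'b" where U: "open U" "(1, p) \<in> U" "U \<subseteq> pts (cone_manifold M)"
    and E: "\<And>i. i < 2 \<Longrightarrow> vector_field (cone_manifold M) U (E i)"
    and NE: "\<And>q. q \<in> U \<Longrightarrow> N q = span ((\<lambda>i. E i q) ` {..<2}) \<and> dim (N q) = 2"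
    using subb unfolding subbundle_def by metis
  have im: "(\<lambda>i. E i q) ` {..<2} = {E 0 q, E 1 q}" for q by (auto simp: less_2_cases_iff)
  show thesis
  proof (rule that[OF U E E])
    show "N q = span {E 0 q, E 1 q}" if "q \<in> U" for q using NE[OF that] by (simp add: im)
    show "independent_pair (E 0 q) (E 1 q)" if "q \<in> U" for q
      unfolding independent_pair_iff_dim using NE[OF that] im[of q] by metis
  qed auto
qed

text \<open>One member \<open>A\<close> of a local frame has a nonvanishing radial component. Normalising this component to
  \<open>1\<close> gives \<open>Z\<close>, and removing the radial component of the other member by a multiple of
  \<open>A\<close> gives \<open>V\<close>.\<close>

lemma generic_local_fields:
  assumes "p \<in> generic_points M N"
  obtains W V Z where "open W" "p \<in> W" "W \<subseteq> generic_points M N" "vector_field M W V" "vector_field M W Z"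
    "\<And>q. q \<in> W \<Longrightarrow> V q \<noteq> 0" "\<And>q. q \<in> W \<Longrightarrow> N (1, q) = span {(0, V q), (1, Z q)}"
proof -
  have p: "p \<in> pts M" using assms by (simp add: generic_points_def)
  obtain U A0 B0 where U: "open U" "(1, p) \<in> U" "U \<subseteq> pts (cone_manifold M)"
    and A0: "vector_field (cone_manifold M) U A0" and B0: "vector_field (cone_manifold M) U B0"
    and N0: "\<And>q. q \<in> U \<Longrightarrow> N q = span {A0 q, B0 q}" "\<And>q. q \<in> U \<Longrightarrow> independent_pair (A0 q) (B0 q)"
    using local_frame[OF p] by metis
  obtain w where w: "w \<in> N (1, p)" "fst w \<noteq> 0" using assms by (auto simp: generic_points_def)
  then have "fst (A0 (1, p)) \<noteq> 0 \<or> fst (B0 (1, p)) \<noteq> 0"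
    unfolding N0(1)[OF U(2)] span_pair by auto
  moreover have "independent_pair (B0 q) (A0 q)" "N q = span {B0 q, A0 q}" if "q \<in> U" for q
    using N0[OF that] independent_pair_commute by (auto simp: insert_commute)
  ultimately obtain A B where A: "vector_field (cone_manifold M) U A" and B: "vector_field (cone_manifold M) U B"
    and NAB: "\<And>q. q \<in> U \<Longrightarrow> N q = span {A q, B q}" "\<And>q. q \<in> U \<Longrightarrow> independent_pair (A q) (B q)"
    and Ap: "fst (A (1, p)) \<noteq> 0"
    using A0 B0 N0 by metis
  define W0 where "W0 = (\<lambda>q. (1, q)) -` U"
  have W0: "open W0" "p \<in> W0" "W0 \<subseteq> pts M"
    using U by (auto simp: W0_def pts_cone intro!: open_vimage continuous_intros)
  have mem0: "(1, q) \<in> U" if "q \<in> W0" for q using that by (simp add: W0_def)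
  note sA = M.slice_smooth[OF A W0(1) mem0] and sB = M.slice_smooth[OF B W0(1) mem0]
  define W where "W = (\<lambda>q. fst (A (1, q))) -` (- {0}) \<inter> W0"
  have "open W"
    unfolding W_def by (rule open_nonzero_set[OF W0(1) M.smooth_function_continuous[OF sA(1) W0(1,3)]])
  then have W: "open W" "p \<in> W" "W \<subseteq> W0" using Ap W0 by (auto simp: W_def)
  have nz: "fst (A (1, q)) \<noteq> 0" if "q \<in> W" for q using that by (simp add: W_def)
  have mem: "(1, q) \<in> U" if "q \<in> W" for q using that W mem0 by blast
  note fA = M.smooth_function_subset[OF sA(1) W(3)] and fB = M.smooth_function_subset[OF sB(1) W(3)]
    and vA = M.vector_field_subset[OF sA(2) W(3)] and vB = M.vector_field_subset[OF sB(2) W(3)]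
  define V where "V = (\<lambda>q. snd (B (1, q)) - (fst (B (1, q)) / fst (A (1, q))) *\<^sub>R snd (A (1, q)))"
  define Z where "Z = (\<lambda>q. (1 / fst (A (1, q))) *\<^sub>R snd (A (1, q)))"
  have "vector_field M W V"
    unfolding V_def
    by (intro M.vector_field_diff M.vector_field_scale M.smooth_function_divide W(1) fA fB vA vB nz)
  moreover have "vector_field M W Z"
    unfolding Z_def
    by (intro M.vector_field_scale M.smooth_function_divide M.smooth_function_const W(1) fA vA nz)
  moreover have pair: "(0, V q) = B (1, q) - (fst (B (1, q)) / fst (A (1, q))) *\<^sub>R A (1, q)"
    "(1, Z q) = (1 / fst (A (1, q))) *\<^sub>R A (1, q)" if "q \<in> W" for q
    using nz[OF that] by (simp_all add: prod_eq_iff V_def Z_def)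
  have "N (1, q) = span {(0, V q), (1, Z q)}" if q: "q \<in> W" for q
    unfolding NAB(1)[OF mem[OF q]]
  proof (rule span_eq[THEN iffD2], intro conjI)
    have eq: "A (1, q) = fst (A (1, q)) *\<^sub>R (1, Z q)"
      "B (1, q) = (0, V q) + fst (B (1, q)) *\<^sub>R (1, Z q)"
      using nz[OF q] by (simp_all add: prod_eq_iff V_def Z_def)
    have "A (1, q) \<in> span {(0, V q), (1, Z q)}"
      by (subst eq(1)) (intro span_scale span_base insertI2 singletonI)
    moreover have "B (1, q) \<in> span {(0, V q), (1, Z q)}"
      by (subst eq(2)) (intro span_add span_scale span_base insertI1 insertI2 singletonI)
    ultimately show "{A (1, q), B (1, q)} \<subseteq> span {(0, V q), (1, Z q)}" by simp
    show "{(0, V q), (1, Z q)} \<subseteq> span {A (1, q), B (1, q)}"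
      unfolding pair[OF q]
      by (auto intro!: span_diff span_scale intro: span_base)
  qed
  moreover have "V q \<noteq> 0" if q: "q \<in> W" for q
  proof
    assume "V q = 0"
    then have "(- (fst (B (1, q)) / fst (A (1, q)))) *\<^sub>R A (1, q) + 1 *\<^sub>R B (1, q) = 0"
      using pair(1)[OF q] by (simp add: zero_prod_def)
    then show False using NAB(2)[OF mem[OF q]] unfolding independent_pair_def by fastforce
  qed
  moreover have "W \<subseteq> generic_points M N"
  proof
    fix q
    assume q: "q \<in> W"
    have "A (1, q) \<in> N (1, q)" using NAB(1)[OF mem[OF q]] by (simp add: span_base)
    then show "q \<in> generic_points M N" using q W W0 nz by (auto simp: generic_points_def)
  qed
  ultimately show thesis using that W by blast
qed

lemma open_generic_points: "open (generic_points M N)"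
proof (subst open_subopen, rule ballI)
  fix p
  assume "p \<in> generic_points M N"
  then show "\<exists>T. open T \<and> p \<in> T \<and> T \<subseteq> generic_points M N" using generic_local_fields by metis
qed

text \<open>If \<open>N\<close> were orthogonal to \<open>\<xi>\<close> over an open set, then differentiating the inner
  product of \<open>\<xi>\<close> with a section \<open>A\<close> of \<open>N\<close> and using \<open>\<nabla>\<^sub>w \<xi> = w\<close> would
  show that \<open>A\<close> is orthogonal to every \<open>w\<close>. Invariance under radial transport makes the
  condition at \<open>r = 1\<close> one for all \<open>r\<close>, so that it does hold on an open set of the
  cone.\<close>

lemma generic_points_dense: "pts M \<subseteq> closure (generic_points M N)"
proof (rule ccontr)
  assume "\<not> pts M \<subseteq> closure (generic_points M N)"
  then obtain p where p: "p \<in> pts M" "p \<notin> closure (generic_points M N)" by blast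
  define G where "G = pts M - closure (generic_points M N)"
  have G: "open G" "p \<in> G" "G \<subseteq> pts M" using p M.open_pts by (auto simp: G_def)
  have Gfst: "fst w = 0" if q: "q \<in> G" "r > 0" and w: "w \<in> N (r, q)" for q r w
  proof -
    obtain a u where "w = (a, u)" by force
    then have "(a, (r / 1) *\<^sub>R u) \<in> N (1, q)"
      using parallel_distribution_radial[OF par, of q r 1 a u] w q G by auto
    moreover have "q \<in> pts M" "q \<notin> generic_points M N" using q closure_subset by (auto simp: G_def)
    ultimately show ?thesis using \<open>w = (a, u)\<close> by (auto simp: generic_points_def)
  qed
  obtain U A B where U: "open U" "(1, p) \<in> U" "U \<subseteq> pts (cone_manifold M)"
    and A: "vector_field (cone_manifold M) U A"
    and NAB: "\<And>q. q \<in> U \<Longrightarrow> N q = span {A q, B q}" "\<And>q. q \<in> U \<Longrightarrow> independent_pair (A q) (B q)"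
    using local_frame[OF p(1)] by metis
  define U' where "U' = U \<inter> {0<..} \<times> G"
  have U': "open U'" "(1, p) \<in> U'" "U' \<subseteq> pts (cone_manifold M)" "U' \<subseteq> U" "U' \<subseteq> {0<..} \<times> G"
    using U G by (auto simp: U'_def open_Times)
  have A': "vector_field (cone_manifold M) U' A" by (rule C.vector_field_subset[OF A U'(4)])
  have E': "vector_field (cone_manifold M) U' euler_field"
    by (rule C.vector_field_subset[OF M.vector_field_euler[OF G(1)] U'(5)])
  have AN: "A q \<in> N q" if "q \<in> U'" for q
    using NAB(1)[of q] that U'(4) by (auto intro: span_base)
  have perp: "cone_metric g (r, q) w (euler_field (r, q)) = 0" if "q \<in> G" "r > 0" "w \<in> N (r, q)" for q r w
    using Gfst[OF that] that(1) G(3)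
    by (cases w) (auto simp: euler_field_apply cone_metric_apply M.metric_simps subset_iff)
  have "cone_metric g (1, p) (A (1, p)) w = 0" for w
  proof -
    have "dir_deriv (cone_manifold M) (1, p) w (\<lambda>q. cone_metric g q (A q) (euler_field q))
        = dir_deriv (cone_manifold M) (1, p) w (\<lambda>q. 0)"
    proof (rule C.dir_deriv_cong[OF U'(1,2)])
      show "(1, p) \<in> pts (cone_manifold M)" using U' by blast
      show "cone_metric g q (A q) (euler_field q) = 0" if "q \<in> U'" for q
      proof -
        obtain r q' where "q = (r, q')" "r > 0" "q' \<in> G" using U'(5) \<open>q \<in> U'\<close> by blast
        then show ?thesis using perp AN[OF that] by blast
      qed
    qed
    then have "cone_metric g (1, p) (nabla_cone (1, p) w A) (euler_field (1, p))
        + cone_metric g (1, p) (A (1, p)) w = 0"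
      using C.metric_derivative[OF U'(1,3) A' E' U'(2), of w] nabla_cone_euler[OF p(1), of 1 w]
      by (simp add: C.dir_deriv_const)
    moreover have "nabla_cone (1, p) w A \<in> N (1, p)"
      by (rule C.nabla_in_parallel_distribution[OF subb par U'(1,3) A' AN U'(2)])
    ultimately show ?thesis using perp[OF G(2), of 1] by simp
  qed
  then have "A (1, p) = 0" using C.metric_nondegenerate[of "(1, p)"] U by blast
  then show False
    using NAB(2)[OF U(2)] unfolding independent_pair_def by (metis add.right_neutral scaleR_zero_left scaleR_zero_right zero_neq_one)
qed

text \<open>The cone derivatives of \<open>V\<close> and \<open>\<xi> + Z\<close> lie in \<open>N\<close>. At \<open>r = 1\<close> their
  radial components are \<open>g(x, V)\<close> and \<open>g(x, Z)\<close>, which are therefore the coefficients of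
  \<open>\<xi> + Z\<close>; the coefficients of \<open>V\<close> are the one-forms.\<close>

lemma null_pair_of_plane_field:
  assumes "p \<in> generic_points M N"
  obtains W V Z \<alpha> \<beta> where "open W" "p \<in> W" "W \<subseteq> generic_points M N" "null_pair M g nabla W V Z \<alpha> \<beta>"
proof -
  obtain W V Z where W: "open W" "p \<in> W" "W \<subseteq> generic_points M N"
    and V: "vector_field M W V" and Z: "vector_field M W Z" and V0: "\<And>q. q \<in> W \<Longrightarrow> V q \<noteq> 0"
    and NW: "\<And>q. q \<in> W \<Longrightarrow> N (1, q) = span {(0, V q), (1, Z q)}"
    using generic_local_fields[OF assms] by metis
  have Wp: "W \<subseteq> pts M" using W by (auto simp: generic_points_def)
  have VN: "(0, V q) \<in> N (1, q)" "(1, Z q) \<in> N (1, q)" if "q \<in> W" for q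
    unfolding NW[OF that] by (auto intro: span_base)
  have alg: "g q (V q) (V q) = 0 \<and> g q (Z q) (Z q) = 1 \<and> g q (V q) (Z q) = 0" if q: "q \<in> W" for q
  proof -
    have "(1, q) \<in> pts (cone_manifold M)" using q Wp by (auto simp: pts_cone)
    then have n: "cone_metric g (1, q) u v = 0" if "u \<in> N (1, q)" "v \<in> N (1, q)" for u v
      using null that unfolding totally_null_def by blast
    show ?thesis
      using n[OF VN(1)[OF q] VN(1)[OF q]] n[OF VN(1)[OF q] VN(2)[OF q]] n[OF VN(2)[OF q] VN(2)[OF q]]
      by (simp add: cone_metric_apply)
  qed
  let ?U = "{0<..} \<times> W :: (real \<times> 'a) set"
  have U: "open ?U" "?U \<subseteq> pts (cone_manifold M)" using W Wp by (auto simp: open_Times pts_cone)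
  note lV = M.vector_field_cone_lift[OF W(1) V] and lZ = M.vector_field_cone_lift[OF W(1) Z]
    and eu = M.vector_field_euler[OF W(1)]
  have sub: "subspace (N (r, q))" if "r > 0" "q \<in> W" for r q
  proof -
    have "(r, q) \<in> pts (cone_manifold M)" using that Wp by (auto simp: pts_cone)
    then obtain U E where "(r, q) \<in> U" "\<And>q. q \<in> U \<Longrightarrow> N q = span ((\<lambda>i :: nat. E i q) ` {..<2})"
      using subb unfolding subbundle_def by meson
    then show ?thesis by simp
  qed
  \<comment> \<open>Radial transport divides the component along \<open>M\<close> by \<open>r\<close>; multiplication by \<open>r\<close> gives
    back \<open>V\<close> and \<open>\<xi> + Z\<close>.\<close>
  have secV: "cone_lift V x \<in> N x" and secZ: "euler_field x + cone_lift Z x \<in> N x" if x: "x \<in> ?U" for x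
  proof -
    obtain r q where rq: "x = (r, q)" "r > 0" "q \<in> W" using x by auto
    have qp: "q \<in> pts M" using rq Wp by auto
    have "(0, (1 / r) *\<^sub>R V q) \<in> N (r, q)" "(1, (1 / r) *\<^sub>R Z q) \<in> N (r, q)"
      using parallel_distribution_radial[OF par qp _ rq(2)] VN[OF rq(3)] by auto
    from this[THEN subspace_scale[OF sub[OF rq(2,3)], of _ r]]
    show "cone_lift V x \<in> N x" "euler_field x + cone_lift Z x \<in> N x"
      using rq by (simp_all add: cone_lift_apply euler_field_apply)
  qed
  have nab: "(\<exists>k. nabla q x V - g q x (V q) *\<^sub>R Z q = k *\<^sub>R V q) \<and>
      (\<exists>k. nabla q x Z + x - g q x (Z q) *\<^sub>R Z q = k *\<^sub>R V q)" if q: "q \<in> W" for q x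
  proof -
    have mem: "(1, q) \<in> ?U" using q by simp
    have qp: "q \<in> pts M" using q Wp by auto
    have "nabla_cone (1, q) (0, x) (cone_lift V) \<in> N (1, q)"
      by (rule C.nabla_in_parallel_distribution[OF subb par U lV secV mem])
    then have "(g q x (V q), nabla q x V) \<in> span {(0, V q), (1, Z q)}"
      using nabla_cone_lift[OF W(1) Wp q zero_less_one V, of 0 x] NW[OF q] by simp
    then have 1: "\<exists>k. nabla q x V - g q x (V q) *\<^sub>R Z q = k *\<^sub>R V q"
      unfolding span_pair by auto
    have "nabla_cone (1, q) (0, x) (\<lambda>y. euler_field y + cone_lift Z y) \<in> N (1, q)"
      by (rule C.nabla_in_parallel_distribution[OF subb par U C.vector_field_add[OF U(1) eu lZ] secZ mem])
    then have "(0, x) + (g q x (Z q), nabla q x Z) \<in> span {(0, V q), (1, Z q)}"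
      using nabla_cone_lift[OF W(1) Wp q zero_less_one Z, of 0 x] NW[OF q]
        C.nabla_add[OF U eu lZ mem, of "(0, x)"] nabla_cone_euler[OF qp zero_less_one, of "(0, x)"] by simp
    then have "\<exists>k. nabla q x Z + x - g q x (Z q) *\<^sub>R Z q = k *\<^sub>R V q"
      unfolding span_pair by (auto simp: algebra_simps)
    then show ?thesis using 1 by blast
  qed
  have gl: "linear (\<lambda>x. g q x v)" if "q \<in> W" for q v
    using M.bilinear_metric[of q] that Wp by (auto simp: bilinear_def)
  have gs: "smooth_function M G0 (\<lambda>q. g q (X q) (Y q))"
    if "open G0" "G0 \<subseteq> W" "vector_field M G0 X" "vector_field M W Y" for G0 X Y
    using that Wp by (intro M.smooth_function_metric[OF metric_smooth] M.vector_field_subset[OF that(4)]) auto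
  have "\<exists>\<alpha>. one_form M W \<alpha> \<and> (\<forall>q\<in>W. \<forall>x. nabla q x V - g q x (V q) *\<^sub>R Z q = \<alpha> q x *\<^sub>R V q)"
  proof (rule M.one_form_coefficient[OF W(1) Wp V V0, where S = "\<lambda>q x. nabla q x V - g q x (V q) *\<^sub>R Z q"])
    show "linear (\<lambda>x. nabla q x V - g q x (V q) *\<^sub>R Z q)" if "q \<in> W" for q
      by (intro linear_compose_sub M.linear_nabla[OF W(1) Wp V that] linear_compose[OF gl[OF that], unfolded o_def]
          linear_scaleR_left)
    show "vector_field M G0 (\<lambda>q. nabla q (X q) V - g q (X q) (V q) *\<^sub>R Z q)"
      if "open G0" "G0 \<subseteq> W" "vector_field M G0 X" for G0 X
      using that Wp M.vector_field_subset[OF V that(2)] M.vector_field_subset[OF Z that(2)]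
      by (intro M.vector_field_diff M.vector_field_nabla M.vector_field_scale gs V) auto
    show "\<exists>k. nabla q x V - g q x (V q) *\<^sub>R Z q = k *\<^sub>R V q" if "q \<in> W" for q x using nab[OF that] by blast
  qed
  then obtain \<alpha> where \<alpha>: "one_form M W \<alpha>"
    "\<And>q x. q \<in> W \<Longrightarrow> nabla q x V - g q x (V q) *\<^sub>R Z q = \<alpha> q x *\<^sub>R V q"
    by (elim exE conjE) simp
  have "\<exists>\<beta>. one_form M W \<beta> \<and> (\<forall>q\<in>W. \<forall>x. nabla q x Z + x - g q x (Z q) *\<^sub>R Z q = \<beta> q x *\<^sub>R V q)"
  proof (rule M.one_form_coefficient[OF W(1) Wp V V0, where S = "\<lambda>q x. nabla q x Z + x - g q x (Z q) *\<^sub>R Z q"])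
    show "linear (\<lambda>x. nabla q x Z + x - g q x (Z q) *\<^sub>R Z q)" if "q \<in> W" for q
      by (intro linear_compose_sub linear_compose_add linear_ident M.linear_nabla[OF W(1) Wp Z that]
          linear_compose[OF gl[OF that], unfolded o_def] linear_scaleR_left)
    show "vector_field M G0 (\<lambda>q. nabla q (X q) Z + X q - g q (X q) (Z q) *\<^sub>R Z q)"
      if "open G0" "G0 \<subseteq> W" "vector_field M G0 X" for G0 X
      using that Wp M.vector_field_subset[OF Z that(2)]
      by (intro M.vector_field_diff M.vector_field_add M.vector_field_nabla M.vector_field_scale gs Z) auto
    show "\<exists>k. nabla q x Z + x - g q x (Z q) *\<^sub>R Z q = k *\<^sub>R V q" if "q \<in> W" for q x using nab[OF that] by blast
  qed
  then obtain \<beta> where \<beta>: "one_form M W \<beta>"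
    "\<And>q x. q \<in> W \<Longrightarrow> nabla q x Z + x - g q x (Z q) *\<^sub>R Z q = \<beta> q x *\<^sub>R V q"
    by (elim exE conjE) simp
  have "nabla q x V = \<alpha> q x *\<^sub>R V q + g q x (V q) *\<^sub>R Z q"
    "nabla q x Z = - x + \<beta> q x *\<^sub>R V q + g q x (Z q) *\<^sub>R Z q" if "q \<in> W" for q x
    unfolding \<alpha>(2)[OF that, symmetric] \<beta>(2)[OF that, symmetric] by simp_all
  then have "null_pair M g nabla W V Z \<alpha> \<beta>"
    using V Z \<alpha>(1) \<beta>(1) V0 alg by (simp add: null_pair_def)
  then show thesis using that W by blast
qed

end

end

lemma cone_mfdI:
  assumes "semi_riemannian M g" "levi_civita M g nabla"
    and "levi_civita (cone_manifold M) (cone_metric g) nabla_cone"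
  shows "cone_mfd M nabla g nabla_cone"
proof -
  have sm: "smooth_manifold M" using assms by (simp add: semi_riemannian_def)
  have smc: "smooth_manifold (cone_manifold M)"
    by (rule smooth_mfd.smooth_manifold_cone[OF smooth_mfd.intro[OF sm]])
  have g: "bilinear (g p)" "g p u v = g p v u" "(\<And>v. g p u v = 0) \<Longrightarrow> u = 0" if "p \<in> pts M" for p u v
    using assms(1) that by (auto simp: semi_riemannian_def)
  have M: "levi_civita_mfd M nabla g"
    by unfold_locales (use sm assms(2) g in \<open>auto simp: levi_civita_def\<close>)
  have C: "levi_civita_mfd (cone_manifold M) nabla_cone (cone_metric g)"
  proof unfold_locales
    fix q assume "q \<in> pts (cone_manifold M)"
    then obtain r p where q: "q = (r, p)" "r > 0" "p \<in> pts M" by (auto simp: pts_cone)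
    note b = g(1)[OF q(3)]
    show "bilinear (cone_metric g q)"
      unfolding bilinear_def q(1)
      by (auto intro!: linearI simp: cone_metric_apply bilinear_ladd[OF b] bilinear_radd[OF b]
          bilinear_lmul[OF b] bilinear_rmul[OF b] algebra_simps)
    show "cone_metric g q u v = cone_metric g q v u" for u v
      unfolding q(1) by (cases u; cases v) (use g(2)[OF q(3)] in \<open>simp add: cone_metric_apply\<close>)
    show "u = 0" if "\<And>v. cone_metric g q u v = 0" for u
    proof -
      obtain a x where u: "u = (a, x)" by force
      have "a = 0" using that[of "(1, 0)"] by (simp add: q(1) u cone_metric_apply bilinear_rzero[OF b])
      moreover have "x = 0"
        by (rule g(3)[OF q(3)]) (use that[of "(0, _)"] q(2) in \<open>simp add: q(1) u cone_metric_apply\<close>)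
      ultimately show ?thesis by (simp add: u zero_prod_def)
    qed
  qed (use smc assms(3) in \<open>auto simp: levi_civita_def\<close>)
  show ?thesis
    by (intro cone_mfd.intro cone_mfd_axioms.intro M C assms(1))
qed

theorem theorem1p4:
  fixes M :: "('a::{t2_space, second_countable_topology}, 'b::euclidean_space) manifold"
    and g :: "'a \<Rightarrow> 'b \<Rightarrow> 'b \<Rightarrow> real"
    and nabla :: "'a \<Rightarrow> 'b \<Rightarrow> ('a \<Rightarrow> 'b) \<Rightarrow> 'b"
    and nabla_cone :: "real \<times> 'a \<Rightarrow> real \<times> 'b \<Rightarrow> (real \<times> 'a \<Rightarrow> real \<times> 'b) \<Rightarrow> real \<times> 'b"
  assumes "semi_riemannian M g"
    and "levi_civita M g nabla"
    and "levi_civita (cone_manifold M) (cone_metric g) nabla_cone"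
  shows
    "((\<exists>N. parallel_null_plane_field (cone_manifold M) (cone_metric g) nabla_cone N) \<longrightarrow>
       (\<exists>U. open U \<and> U \<subseteq> pts M \<and> pts M \<subseteq> closure U \<and>
          (\<forall>p\<in>U. \<exists>W V Z \<alpha> \<beta>. open W \<and> p \<in> W \<and> W \<subseteq> U \<and>
             null_pair M g nabla W V Z \<alpha> \<beta> \<and>
             geodesic_shearfree_null_congruence M g nabla W V)))
     \<and>
     (\<forall>V Z \<alpha> \<beta>. null_pair M g nabla (pts M) V Z \<alpha> \<beta> \<longrightarrow>
       parallel_null_plane_field (cone_manifold M) (cone_metric g) nabla_cone
         (\<lambda>q. span {cone_lift V q, euler_field q + cone_lift Z q}))"
proof -
  interpret cone_mfd M nabla g nabla_cone by (rule cone_mfdI[OF assms])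
  show ?thesis
  proof (intro conjI impI allI)
    assume "\<exists>N. parallel_null_plane_field (cone_manifold M) (cone_metric g) nabla_cone N"
    then obtain N where N: "parallel_null_plane_field (cone_manifold M) (cone_metric g) nabla_cone N" ..
    let ?U = "generic_points M N"
    have sub: "?U \<subseteq> pts M" by (auto simp: generic_points_def)
    have fields: "\<exists>W V Z \<alpha> \<beta>. open W \<and> p \<in> W \<and> W \<subseteq> ?U \<and> null_pair M g nabla W V Z \<alpha> \<beta> \<and>
        geodesic_shearfree_null_congruence M g nabla W V" if p: "p \<in> ?U" for p
    proof -
      obtain W V Z \<alpha> \<beta> where W: "open W" "p \<in> W" "W \<subseteq> ?U" and np: "null_pair M g nabla W V Z \<alpha> \<beta>"
        by (rule null_pair_of_plane_field[OF N p])
      moreover have "geodesic_shearfree_null_congruence M g nabla W V"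
        by (rule M.null_pair_congruence[OF assms(1) W(1) order_trans[OF W(3) sub] np])
      ultimately show ?thesis by (intro exI conjI)
    qed
    show "\<exists>U. open U \<and> U \<subseteq> pts M \<and> pts M \<subseteq> closure U \<and>
        (\<forall>p\<in>U. \<exists>W V Z \<alpha> \<beta>. open W \<and> p \<in> W \<and> W \<subseteq> U \<and> null_pair M g nabla W V Z \<alpha> \<beta> \<and>
          geodesic_shearfree_null_congruence M g nabla W V)"
    proof (rule exI[of _ ?U], intro conjI ballI)
      show "open ?U" by (rule open_generic_points[OF N])
      show "?U \<subseteq> pts M" by (rule sub)
      show "pts M \<subseteq> closure ?U" by (rule generic_points_dense[OF N])
    qed (rule fields)
  qed (rule plane_field_of_null_pair)
qed

end
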